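(* Let $L$ be a non-degenerate even lattice of rank $3$. Put $$\mathrm{Cl}^{\pm}(L)^\times=\{\alpha\in \mathrm{Cl}^+(L)\cup \mathrm{Cl}^-(L) : N\alpha=\pm1\}.$$ Then there is a natural isomorphism of groups $$O_D(L)\cong \mathrm{Cl}^{\pm}(L)^\times/\{\pm1\},$$ namely the one induced by $\alpha\mapsto h_\alpha$, where $h_\alpha(v)=\varepsilon_\alpha\,\alpha v\alpha^{-1}$ for $v\in L$, with $\varepsilon_\alpha=1$ if $\alpha\in \mathrm{Cl}^+(L)$ and $\varepsilon_\alpha=-1$ if $\alpha\in \mathrm{Cl}^-(L)$. Moreover, under this isomorphism, $$SO_D(L)\cong \mathrm{Cl}^+(L)^\times/\{\pm1\},\qquad \mathrm{Cl}^+(L)^\times=\{\alpha\in \mathrm{Cl}^+(L): N\alpha=\pm1\},$$ $$SO^+_D(L)\cong \mathrm{Cl}^+(L)^1/\{\pm1\},\qquad \mathrm{Cl}^+(L)^1=\{\alpha\in \mathrm{Cl}^+(L): N\alpha=1\}.$$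
   Context: A lattice is a free $\mathbb Z$-module of finite rank with a $\mathbb Z$-valued symmetric bilinear form $\langle\,,\rangle$; it is even if $\langle x,x\rangle\in2\mathbb Z$ for all $x$. $O(L)$ is the group of isometries of $L$, and $SO(L)$ the subgroup of determinant $1$. The discriminant group is $A(L)=L^\vee/L$ with $L^\vee=\{x\in L_{\mathbb Q}:\langle x,y\rangle\in\mathbb Z\ \forall y\in L\}$, with discriminant form $q(L):A(L)\to\mathbb Q/2\mathbb Z$, $x\mapsto\langle x,x\rangle$. For a subgroup $G\subseteq O(L)$, $G_D$ is the subgroup of elements of $G$ acting trivially on $A(L)$; thus $O_D(L)=\ker(O(L)\to O(q(L)))$, and $SO_D(L)$, $SO_D^+(L)$ are defined likewise. The Clifford algebra is $\mathrm{Cl}(L)=T(L)/I_L$, where $T(L)$ is the tensor algebra over $\mathbb Z$ and $I_L$ is the two-sided ideal generated by $v\otimes v-\frac12\langle v,v\rangle$, $v\in L$. $\mathrm{Cl}^+(L)$ and $\mathrm{Cl}^-(L)$ are its even and odd parts; $L\subset\mathrm{Cl}^-(L)$. The map $\alpha\mapsto\alpha^*$ is the anti-automorphism of $\mathrm{Cl}(L)$ induced by $v_1\otimes\cdots\otimes v_k\mapsto v_k\otimes\cdots\otimes v_1$, and $N\alpha=\alpha\alpha^*$, which lies in $\mathbb Z$ for $\alpha\in\mathrm{Cl}^+(L)\cup\mathrm{Cl}^-(L)$ when $L$ has rank $3$. The spinor norm $\theta:O(L_{\mathbb Q})\to\mathbb Q^\times/(\mathbb Q^\times)^2$ is the homomorphism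 sending the reflection in $r\in L_{\mathbb Q}$ ($\langle r,r\rangle\ne0$) to the class of $\frac12\langle r,r\rangle$. $SO^+(L)$ is the group of $g\in SO(L)$ with $\theta(g)>0$. *)

theory Defs
  imports
    "HOL-Algebra.Algebra"
    "HOL-Algebra.Algebraic_Closure_Type"
    "HOL-Library.Poly_Mapping"
    "HOL-Combinatorics.Permutations"
begin

section \<open>Abelian groups as \<open>\<int>\<close>-modules\<close>

definition zmult :: "int \<Rightarrow> 'a::ab_group_add \<Rightarrow> 'a" where
  "zmult k x = (if 0 \<le> k then ((+) x ^^ nat k) 0 else - (((+) x ^^ nat (- k)) 0))"

lemma zmult_0 [simp]: "zmult 0 x = 0"
  by (simp add: zmult_def)

lemma zmult_add_1: "zmult (k + 1) x = zmult k x + x"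
proof (cases "0 \<le> k")
  case True
  then have "nat (k + 1) = Suc (nat k)" by simp
  with True show ?thesis by (simp add: zmult_def)
next
  case False
  then have "nat (- k) = Suc (nat (- (k + 1)))" by simp
  then have "((+) x ^^ nat (- k)) 0 = x + ((+) x ^^ nat (- (k + 1))) 0" by simp
  moreover have "zmult (k + 1) x = - (((+) x ^^ nat (- (k + 1))) 0)"
    using False by (cases "k = - 1") (simp_all add: zmult_def)
  ultimately show ?thesis using False by (simp add: zmult_def)
qed

lemma zmult_diff_1: "zmult (k - 1) x = zmult k x - x"
  using zmult_add_1[of "k - 1" x] by simp

lemma zmult_1 [simp]: "zmult 1 x = x"
  using zmult_add_1[of 0 x] by simp

lemma zmult_add_left: "zmult (j + k) x = zmult j x + zmult k x"
proof (induction k rule: int_induct[where k = 0])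
  case (step1 i)
  then show ?case
    using zmult_add_1[of "j + i" x] zmult_add_1[of i x] by (simp add: add.assoc)
next
  case (step2 i)
  then show ?case
    using zmult_diff_1[of "j + i" x] zmult_diff_1[of i x] by (simp add: add_diff_eq)
qed simp

lemma zmult_add_right: "zmult k (x + y) = zmult k x + zmult k y"
  by (induction k rule: int_induct[where k = 0])
    (simp_all add: zmult_add_1 zmult_diff_1 algebra_simps)

lemma zmult_diff_left: "zmult (j - k) x = zmult j x - zmult k x"
  using zmult_add_left[of "j - k" k x] by simp

lemma zmult_zmult: "zmult j (zmult k x) = zmult (j * k) x"
proof (induction j rule: int_induct[where k = 0])
  case (step1 i)
  then show ?case by (simp add: zmult_add_left distrib_right)
next
  case (step2 i)
  then show ?case by (simp add: zmult_diff_left left_diff_distrib)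
qed simp

global_interpretation zmod: Modules.module zmult
  by unfold_locales (simp_all add: zmult_add_left zmult_add_right zmult_zmult)

lemma zmult_additive:
  assumes "additive f"
  shows "f (zmult k x) = zmult k (f x)"
proof -
  interpret additive f by fact
  show ?thesis
    by (induction k rule: int_induct[where k = 0])
      (simp_all add: zmult_add_1 zmult_diff_1 zero add diff)
qed

lemma zmult_int: "zmult k (n :: int) = k * n"
  by (induction k rule: int_induct[where k = 0])
    (simp_all add: zmult_add_1 zmult_diff_1 algebra_simps)


section \<open>Lattices\<close>

text \<open>
  The underlying module of a lattice is a whole type of class \<^class>\<open>ab_group_add\<close>; its
  bilinear form is a function \<open>b\<close>.
\<close>

definition zbasis :: "'a::ab_group_add set \<Rightarrow> bool" where
  "zbasis B \<longleftrightarrow> finite B \<and> zmod.independent B \<and> zmod.span B = UNIV"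

definition lattice_of_rank :: "nat \<Rightarrow> ('a::ab_group_add \<Rightarrow> 'a \<Rightarrow> int) \<Rightarrow> bool" where
  "lattice_of_rank n b \<longleftrightarrow>
     (\<exists>B :: 'a set. zbasis B \<and> card B = n) \<and>
     (\<forall>x y. b x y = b y x) \<and>
     (\<forall>x y z. b (x + y) z = b x z + b y z)"

definition even_form :: "('a::ab_group_add \<Rightarrow> 'a \<Rightarrow> int) \<Rightarrow> bool" where
  "even_form b \<longleftrightarrow> (\<forall>x. even (b x x))"

definition nondegenerate_form :: "('a::ab_group_add \<Rightarrow> 'a \<Rightarrow> int) \<Rightarrow> bool" where
  "nondegenerate_form b \<longleftrightarrow> (\<forall>x. (\<forall>y. b x y = 0) \<longrightarrow> x = 0)"

definition lattice_O :: "('a::ab_group_add \<Rightarrow> 'a \<Rightarrow> int) \<Rightarrow> ('a \<Rightarrow> 'a) set" where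
  "lattice_O b = {g. additive g \<and> bij g \<and> (\<forall>x y. b (g x) (g y) = b x y)}"

text \<open>The determinant of an endomorphism of a free module; it does not depend on the basis.\<close>

definition lattice_det :: "('a::ab_group_add \<Rightarrow> 'a) \<Rightarrow> int" where
  "lattice_det g = (let B = (SOME B. zbasis B) in
     \<Sum>p | p permutes B. sign p * (\<Prod>x\<in>B. zmod.representation B (g x) (p x)))"

definition lattice_SO :: "('a::ab_group_add \<Rightarrow> 'a \<Rightarrow> int) \<Rightarrow> ('a \<Rightarrow> 'a) set" where
  "lattice_SO b = {g \<in> lattice_O b. lattice_det g = 1}"

definition comp_group :: "('a \<Rightarrow> 'a) set \<Rightarrow> ('a \<Rightarrow> 'a) monoid" where
  "comp_group G = \<lparr>carrier = G, monoid.mult = (\<circ>), one = id\<rparr>"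


section \<open>The rational vector space \<open>L\<^sub>\<rat>\<close>\<close>

text \<open>
  \<open>L\<^sub>\<rat>\<close> is the localisation of \<open>L\<close> at the nonzero integers: the pair \<open>(x, m)\<close> with \<open>m \<noteq> 0\<close>
  stands for the fraction \<open>x/m\<close>.
\<close>

definition ratrel :: "'a::ab_group_add \<times> int \<Rightarrow> 'a \<times> int \<Rightarrow> bool" where
  "ratrel p q \<longleftrightarrow> snd p \<noteq> 0 \<and> snd q \<noteq> 0 \<and>
     (\<exists>k. k \<noteq> 0 \<and> zmult (k * snd q) (fst p) = zmult (k * snd p) (fst q))"

lemma ratrelI:
  "\<lbrakk>snd p \<noteq> 0; snd q \<noteq> 0; k \<noteq> 0; zmult (k * snd q) (fst p) = zmult (k * snd p) (fst q)\<rbrakk>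
    \<Longrightarrow> ratrel p q"
  unfolding ratrel_def by blast

lemma ratrel_refl: "snd p \<noteq> 0 \<Longrightarrow> ratrel p p"
  by (rule ratrelI[where k = 1]) simp_all

lemma part_equivp_ratrel: "part_equivp (ratrel :: 'a::ab_group_add \<times> int \<Rightarrow> _)"
proof (rule part_equivpI)
  show "\<exists>x :: 'a \<times> int. ratrel x x"
    by (rule exI[where x = "(0, 1)"]) (simp add: ratrel_refl)
  show "symp (ratrel :: 'a \<times> int \<Rightarrow> _)"
    by (rule sympI) (auto simp: ratrel_def)
  show "transp (ratrel :: 'a \<times> int \<Rightarrow> _)"
  proof (rule transpI)
    fix p q r :: "'a \<times> int"
    assume "ratrel p q" "ratrel q r"
    then obtain j k where nz: "snd p \<noteq> 0" "snd q \<noteq> 0" "snd r \<noteq> 0" "j \<noteq> 0" "k \<noteq> 0"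
      and j: "zmult (j * snd q) (fst p) = zmult (j * snd p) (fst q)"
      and k: "zmult (k * snd r) (fst q) = zmult (k * snd q) (fst r)"
      unfolding ratrel_def by blast
    have "zmult (j * k * snd q * snd r) (fst p) = zmult (k * snd r) (zmult (j * snd q) (fst p))"
      by (simp add: zmult_zmult mult_ac)
    also have "\<dots> = zmult (j * snd p) (zmult (k * snd r) (fst q))"
      by (simp add: j zmult_zmult mult_ac)
    also have "\<dots> = zmult (j * k * snd q * snd p) (fst r)"
      by (simp add: k zmult_zmult mult_ac)
    finally show "ratrel p r"
      using nz by (intro ratrelI[where k = "j * k * snd q"]) auto
  qed
qed

quotient_type (overloaded) 'a rat_ext = "'a::ab_group_add \<times> int" / partial: ratrel
  by (rule part_equivp_ratrel)

lift_definition rat_frac :: "'a::ab_group_add \<Rightarrow> int \<Rightarrow> 'a rat_ext"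
  is "\<lambda>x m. if m = 0 then (0, 1) else (x, m)"
  by (simp add: ratrel_refl)

lemma rat_frac_cases [cases type: rat_ext]:
  obtains (frac) x m where "q = rat_frac x m" "m \<noteq> 0"
  by transfer (auto simp: ratrel_def)

lemma rat_frac_eq_iff:
  "m \<noteq> 0 \<Longrightarrow> n \<noteq> 0 \<Longrightarrow>
     rat_frac x m = rat_frac y n \<longleftrightarrow> (\<exists>k. k \<noteq> 0 \<and> zmult (k * n) x = zmult (k * m) y)"
  by transfer (simp add: ratrel_def)

lemma rat_frac_cancel:
  assumes "n \<noteq> 0" "m \<noteq> 0"
  shows "rat_frac (zmult n x) (n * m) = rat_frac x m"
proof -
  have "zmult (1 * m) (zmult n x) = zmult (1 * (n * m)) x"
    by (simp only: zmult_zmult mult_1 mult.commute)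
  with assms show ?thesis
    by (subst rat_frac_eq_iff) (auto intro!: exI[where x = 1])
qed

instantiation rat_ext :: (ab_group_add) ab_group_add
begin

lift_definition zero_rat_ext :: "'a rat_ext" is "(0, 1)"
  by (simp add: ratrel_refl)

lift_definition plus_rat_ext :: "'a rat_ext \<Rightarrow> 'a rat_ext \<Rightarrow> 'a rat_ext"
  is "\<lambda>p q. (zmult (snd q) (fst p) + zmult (snd p) (fst q), snd p * snd q)"
proof -
  fix p p' q q' :: "'a \<times> int"
  assume "ratrel p p'" "ratrel q q'"
  then obtain j k where nz: "snd p \<noteq> 0" "snd p' \<noteq> 0" "snd q \<noteq> 0" "snd q' \<noteq> 0" "j \<noteq> 0" "k \<noteq> 0"
    and j: "zmult (j * snd p') (fst p) = zmult (j * snd p) (fst p')"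
    and k: "zmult (k * snd q') (fst q) = zmult (k * snd q) (fst q')"
    unfolding ratrel_def by blast
  have A: "zmult (j * k * (snd p' * snd q') * snd q) (fst p)
      = zmult (j * k * (snd p * snd q) * snd q') (fst p')"
    using arg_cong[OF j, of "zmult (k * snd q' * snd q)"] by (simp only: zmult_zmult mult_ac)
  have B: "zmult (j * k * (snd p' * snd q') * snd p) (fst q)
      = zmult (j * k * (snd p * snd q) * snd p') (fst q')"
    using arg_cong[OF k, of "zmult (j * snd p' * snd p)"] by (simp only: zmult_zmult mult_ac)
  show "ratrel (zmult (snd q) (fst p) + zmult (snd p) (fst q), snd p * snd q)
      (zmult (snd q') (fst p') + zmult (snd p') (fst q'), snd p' * snd q')"
  proof (rule ratrelI)
    show "j * k \<noteq> 0" using nz by simp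
    show "zmult (j * k * snd (zmult (snd q') (fst p') + zmult (snd p') (fst q'), snd p' * snd q'))
        (fst (zmult (snd q) (fst p) + zmult (snd p) (fst q), snd p * snd q))
      = zmult (j * k * snd (zmult (snd q) (fst p) + zmult (snd p) (fst q), snd p * snd q))
        (fst (zmult (snd q') (fst p') + zmult (snd p') (fst q'), snd p' * snd q'))"
      by (simp only: fst_conv snd_conv zmult_add_right zmult_zmult A B)
  qed (use nz in simp_all)
qed

lift_definition uminus_rat_ext :: "'a rat_ext \<Rightarrow> 'a rat_ext"
  is "\<lambda>p. (- fst p, snd p)"
  unfolding ratrel_def fst_conv snd_conv zmod.scale_minus_right neg_equal_iff_equal .

definition minus_rat_ext :: "'a rat_ext \<Rightarrow> 'a rat_ext \<Rightarrow> 'a rat_ext" where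
  "minus_rat_ext x y = x + - y"

lemma rat_frac_add:
  assumes "m \<noteq> 0" "n \<noteq> 0"
  shows "rat_frac x m + rat_frac y n = rat_frac (zmult n x + zmult m y) (m * n)"
  using assms by transfer (simp add: ratrel_refl)

instance
proof
  fix u v w :: "'a rat_ext"
  obtain x l where u: "u = rat_frac x l" "l \<noteq> 0"
    by (rule rat_frac_cases)
  obtain y m where v: "v = rat_frac y m" "m \<noteq> 0"
    by (rule rat_frac_cases)
  obtain z n where w: "w = rat_frac z n" "n \<noteq> 0"
    by (rule rat_frac_cases)
  have lm: "l * m \<noteq> 0" and mn: "m * n \<noteq> 0"
    using u v w by simp_all
  show "u + v + w = u + (v + w)"
    unfolding u(1) v(1) w(1) rat_frac_add[OF u(2) v(2)] rat_frac_add[OF v(2) w(2)]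
      rat_frac_add[OF lm w(2)] rat_frac_add[OF u(2) mn]
    by (simp only: zmult_add_right zmult_zmult mult_ac add_ac)
  show "u + v = v + u"
    unfolding u(1) v(1) rat_frac_add[OF u(2) v(2)] rat_frac_add[OF v(2) u(2)]
    by (simp only: mult.commute add.commute)
  show "0 + u = u"
    by transfer (simp add: ratrel_def)
  show "- u + u = 0"
    by transfer (auto simp: ratrel_def)
  show "u - v = u + - v"
    by (rule minus_rat_ext_def)
qed

end

lift_definition qscale :: "rat \<Rightarrow> 'a::ab_group_add rat_ext \<Rightarrow> 'a rat_ext"
  is "\<lambda>r p. (zmult (fst (quotient_of r)) (fst p), snd (quotient_of r) * snd p)"
proof -
  fix r :: rat and p q :: "'a \<times> int"
  assume "ratrel p q"
  then obtain k where nz: "snd p \<noteq> 0" "snd q \<noteq> 0" "k \<noteq> 0"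
    and k: "zmult (k * snd q) (fst p) = zmult (k * snd p) (fst q)"
    unfolding ratrel_def by blast
  have "snd (quotient_of r) \<noteq> 0"
    using quotient_of_denom_pos'[of r] by simp
  then show "ratrel (zmult (fst (quotient_of r)) (fst p), snd (quotient_of r) * snd p)
      (zmult (fst (quotient_of r)) (fst q), snd (quotient_of r) * snd q)"
    using nz arg_cong[OF k, of "zmult (fst (quotient_of r) * snd (quotient_of r))"]
    by (intro ratrelI[where k = k]) (simp_all add: zmult_zmult mult_ac)
qed

lemma qscale_frac:
  assumes "n \<noteq> 0" "m \<noteq> 0"
  shows "qscale (Rat.Fract l n) (rat_frac x m) = rat_frac (zmult l x) (n * m)"
proof -
  define c d where "c = fst (quotient_of (Rat.Fract l n))" and "d = snd (quotient_of (Rat.Fract l n))"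
  have d: "d \<noteq> 0"
    using quotient_of_denom_pos'[of "Rat.Fract l n"] by (simp add: d_def)
  have "Rat.Fract l n = Rat.Fract c d"
    by (metis Fract_of_int_quotient c_def d_def prod.collapse quotient_of_div)
  then have cd: "l * d = c * n"
    using assms d by (simp add: eq_rat)
  have "qscale (Rat.Fract l n) (rat_frac x m) = rat_frac (zmult c x) (d * m)"
    using assms d unfolding c_def d_def
    by transfer (auto simp: ratrel_def)
  also have "\<dots> = rat_frac (zmult l x) (n * m)"
  proof -
    have "(n * m) * c = m * (c * n)"
      by simp
    also have "\<dots> = (d * m) * l"
      unfolding cd[symmetric] by simp
    finally have "zmult (1 * (n * m)) (zmult c x) = zmult (1 * (d * m)) (zmult l x)"
      by (simp only: zmult_zmult mult_1)
    then show ?thesis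
      using assms d by (subst rat_frac_eq_iff) (auto intro!: exI[where x = 1])
  qed
  finally show ?thesis .
qed

global_interpretation rat_ext: vector_space qscale
proof
  fix r s :: rat and v w :: "'a rat_ext"
  obtain a n where r: "r = Rat.Fract a n" "n \<noteq> 0"
    by (cases r) auto
  obtain a' n' where s: "s = Rat.Fract a' n'" "n' \<noteq> 0"
    by (cases s) auto
  obtain x m where v: "v = rat_frac x m" "m \<noteq> 0"
    by (cases v) auto
  obtain y m' where w: "w = rat_frac y m'" "m' \<noteq> 0"
    by (cases w) auto
  have "zmult (n * m') (zmult a x) + zmult (n * m) (zmult a y)
      = zmult n (zmult a (zmult m' x + zmult m y))"
    by (simp only: zmult_add_right zmult_zmult mult_ac)
  moreover have "n * m * (n * m') = n * (n * (m * m'))"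
    by (simp only: mult_ac)
  ultimately show "qscale r (v + w) = qscale r v + qscale r w"
    using r v w
    by (simp only: qscale_frac rat_frac_add rat_frac_cancel mult_eq_0_iff simp_thms
        not_False_eq_True)
  have "(n * m * (n' * m)) * (a * n' + a' * n) = (n * n' * m) * (n' * m * a + n * m * a')"
    by (simp only: distrib_left mult_ac)
  then have "zmult (1 * (n * m * (n' * m))) (zmult (a * n' + a' * n) x)
      = zmult (1 * (n * n' * m)) (zmult (n' * m * a + n * m * a') x)"
    by (simp only: zmult_zmult mult_1)
  then have "rat_frac (zmult (a * n' + a' * n) x) (n * n' * m)
      = rat_frac (zmult (n' * m * a + n * m * a') x) (n * m * (n' * m))"
    using r s v by (subst rat_frac_eq_iff) (auto intro!: exI[where x = 1])
  then show "qscale (r + s) v = qscale r v + qscale s v"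
    using r s v by (simp add: qscale_frac rat_frac_add zmult_zmult zmult_add_left)
  show "qscale r (qscale s v) = qscale (r * s) v"
    using r s v by (simp add: qscale_frac zmult_zmult mult_ac)
  show "qscale 1 v = v"
    using v by (simp add: One_rat_def qscale_frac)
qed

definition rat_incl :: "'a::ab_group_add \<Rightarrow> 'a rat_ext" where
  "rat_incl x = rat_frac x 1"

text \<open>
  The extensions of an additive map and of a biadditive form to \<open>L\<^sub>\<rat>\<close>, computed on chosen
  representatives; the lemmas below show that the choice is irrelevant.
\<close>

definition rat_map :: "('a::ab_group_add \<Rightarrow> 'a) \<Rightarrow> 'a rat_ext \<Rightarrow> 'a rat_ext" where
  "rat_map g v = rat_frac (g (fst (rep_rat_ext v))) (snd (rep_rat_ext v))"

definition rat_form :: "('a::ab_group_add \<Rightarrow> 'a \<Rightarrow> int) \<Rightarrow> 'a rat_ext \<Rightarrow> 'a rat_ext \<Rightarrow> rat" where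
  "rat_form b v w =
     of_int (b (fst (rep_rat_ext v)) (fst (rep_rat_ext w))) /
     of_int (snd (rep_rat_ext v) * snd (rep_rat_ext w))"

lemma rep_rat_ext_frac:
  assumes "m \<noteq> 0"
  shows "ratrel (rep_rat_ext (rat_frac x m)) (x, m)"
proof -
  have "ratrel (x, m) (x, m)"
    using assms by (auto simp: ratrel_def)
  then have "ratrel (rep_rat_ext (abs_rat_ext (x, m))) (x, m)"
    by (rule Quotient3_rep_abs[OF Quotient3_rat_ext])
  with assms show ?thesis
    by (simp add: rat_frac.abs_eq)
qed

lemma rat_map_frac:
  assumes "additive g" "m \<noteq> 0"
  shows "rat_map g (rat_frac x m) = rat_frac (g x) m"
proof -
  obtain y n where yn: "rep_rat_ext (rat_frac x m) = (y, n)"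
    by fastforce
  then obtain k where k: "n \<noteq> 0" "k \<noteq> 0" "zmult (k * m) y = zmult (k * n) x"
    using rep_rat_ext_frac[OF assms(2), of x] by (auto simp: ratrel_def)
  then have "zmult (k * m) (g y) = zmult (k * n) (g x)"
    by (metis zmult_additive[OF assms(1)])
  with k yn assms(2) show ?thesis
    by (auto simp: rat_map_def rat_frac_eq_iff)
qed

lemma rat_form_frac:
  assumes "\<And>x y. b x y = b y x" "\<And>x y z. b (x + y) z = b x z + b y z" "m \<noteq> 0" "n \<noteq> 0"
  shows "rat_form b (rat_frac x m) (rat_frac y n) = of_int (b x y) / of_int (m * n)"
proof -
  have scale: "b (zmult k u) w = k * b u w" for k u w
    using zmult_additive[of "\<lambda>u. b u w" k u] assms(2) by (simp add: additive_def zmult_int)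
  obtain x' m' where x': "rep_rat_ext (rat_frac x m) = (x', m')"
    by fastforce
  then obtain j where j: "m' \<noteq> 0" "j \<noteq> 0" "zmult (j * m) x' = zmult (j * m') x"
    using rep_rat_ext_frac[OF assms(3), of x] by (auto simp: ratrel_def)
  obtain y' n' where y': "rep_rat_ext (rat_frac y n) = (y', n')"
    by fastforce
  then obtain k where k: "n' \<noteq> 0" "k \<noteq> 0" "zmult (k * n) y' = zmult (k * n') y"
    using rep_rat_ext_frac[OF assms(4), of y] by (auto simp: ratrel_def)
  have 1: "m * b x' w = m' * b x w" for w
    using arg_cong[OF j(3), of "\<lambda>u. b u w"] j(2) by (simp add: scale)
  have 2: "n * b w y' = n' * b w y" for w
  proof -
    have "k * n * b y' w = k * n' * b y w"
      using arg_cong[OF k(3), of "\<lambda>u. b u w"] by (simp only: scale)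
    then show ?thesis
      using k(2) by (simp add: assms(1)[of w])
  qed
  have "b x' y' * (m * n) = n * (m * b x' y')"
    by simp
  also have "\<dots> = m' * (n * b x y')"
    by (simp add: 1)
  also have "\<dots> = b x y * (m' * n')"
    by (simp add: 2)
  finally have "(of_int (b x' y' * (m * n)) :: rat) = of_int (b x y * (m' * n'))"
    by (rule arg_cong)
  then show ?thesis
    using j(1) k(1) assms(3,4) unfolding rat_form_def x' y' fst_conv snd_conv
    by (subst frac_eq_eq) (simp_all only: of_int_mult of_int_eq_0_iff mult_eq_0_iff simp_thms)
qed


section \<open>The discriminant group\<close>

definition dual_lattice :: "('a::ab_group_add \<Rightarrow> 'a \<Rightarrow> int) \<Rightarrow> 'a rat_ext set" where
  "dual_lattice b = {v. \<forall>y. rat_form b v (rat_incl y) \<in> \<int>}"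

definition disc_group :: "('a::ab_group_add \<Rightarrow> 'a \<Rightarrow> int) \<Rightarrow> 'a rat_ext set monoid" where
  "disc_group b = \<lparr>carrier = dual_lattice b, monoid.mult = (+), one = 0\<rparr> Mod range rat_incl"

text \<open>An isometry acts on \<open>A(L)\<close> by sending a coset to its image.\<close>

definition disc_trivial ::
    "('a::ab_group_add \<Rightarrow> 'a \<Rightarrow> int) \<Rightarrow> ('a \<Rightarrow> 'a) set \<Rightarrow> ('a \<Rightarrow> 'a) set" where
  "disc_trivial b G = {g \<in> G. \<forall>c \<in> carrier (disc_group b). rat_map g ` c = c}"


section \<open>The spinor norm\<close>

definition rat_O :: "('a::ab_group_add \<Rightarrow> 'a \<Rightarrow> int) \<Rightarrow> ('a rat_ext \<Rightarrow> 'a rat_ext) set" where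
  "rat_O b = {g. Vector_Spaces.linear qscale qscale g \<and> bij g \<and>
     (\<forall>v w. rat_form b (g v) (g w) = rat_form b v w)}"

definition rat_reflection ::
    "('a::ab_group_add \<Rightarrow> 'a \<Rightarrow> int) \<Rightarrow> 'a rat_ext \<Rightarrow> 'a rat_ext \<Rightarrow> 'a rat_ext" where
  "rat_reflection b r v = v - qscale (2 * rat_form b v r / rat_form b r r) r"

definition rat_units :: "rat monoid" where
  "rat_units = \<lparr>carrier = UNIV - {0}, monoid.mult = (*), one = 1\<rparr>"

definition rat_squares :: "rat set" where
  "rat_squares = {x\<^sup>2 | x. x \<noteq> 0}"

definition spinor_norm ::
    "('a::ab_group_add \<Rightarrow> 'a \<Rightarrow> int) \<Rightarrow> ('a rat_ext \<Rightarrow> 'a rat_ext) \<Rightarrow> rat set" where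
  "spinor_norm b = (THE \<theta>.
     \<theta> \<in> hom (comp_group (rat_O b)) (rat_units Mod rat_squares) \<and>
     \<theta> \<in> extensional (rat_O b) \<and>
     (\<forall>r. rat_form b r r \<noteq> 0 \<longrightarrow>
        \<theta> (rat_reflection b r) = rat_squares #>\<^bsub>rat_units\<^esub> (rat_form b r r / 2)))"

definition lattice_SO_plus :: "('a::ab_group_add \<Rightarrow> 'a \<Rightarrow> int) \<Rightarrow> ('a \<Rightarrow> 'a) set" where
  "lattice_SO_plus b = {g \<in> lattice_SO b. \<forall>q \<in> spinor_norm b (rat_map g). 0 < q}"


section \<open>The tensor algebra\<close>

text \<open>The free monoid on a type, written additively so that \<open>'a word \<Rightarrow>\<^sub>0 int\<close> is the free
  (noncommutative) ring on it.\<close>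

datatype 'a word = Word (letters: "'a list")

instantiation word :: (type) monoid_add
begin

definition zero_word :: "'a word" where
  "zero_word = Word []"

definition plus_word :: "'a word \<Rightarrow> 'a word \<Rightarrow> 'a word" where
  "plus_word u v = Word (letters u @ letters v)"

instance
  by standard (simp_all add: zero_word_def plus_word_def)

end

definition word_rev :: "'a word \<Rightarrow> 'a word" where
  "word_rev w = Word (rev (letters w))"

type_synonym 'a free_ring = "'a word \<Rightarrow>\<^sub>0 int"

definition free_gen :: "'a \<Rightarrow> 'a free_ring" where
  "free_gen v = Poly_Mapping.single (Word [v]) 1"

text \<open>
  \<open>T(L)\<close> is the free ring on the set \<open>L\<close> modulo additivity in each tensor factor; compatibility
  with integer scalars follows from additivity.
\<close>

definition tensor_ideal :: "'a::ab_group_add free_ring set" where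
  "tensor_ideal = Idl\<^bsub>ring_of_type_algebra\<^esub>
     {free_gen (v + w) - (free_gen v + free_gen w) | v w. True}"

definition tensor_algebra :: "'a::ab_group_add free_ring set ring" where
  "tensor_algebra = ring_of_type_algebra Quot tensor_ideal"

definition tensor_incl :: "'a::ab_group_add \<Rightarrow> 'a free_ring set" where
  "tensor_incl v = tensor_ideal +>\<^bsub>ring_of_type_algebra\<^esub> free_gen v"


section \<open>The Clifford algebra\<close>

type_synonym 'a clifford = "'a free_ring set set"

text \<open>Only used for even forms, where \<open>b v v div 2\<close> is exact.\<close>

definition clifford_ideal ::
    "('a::ab_group_add \<Rightarrow> 'a \<Rightarrow> int) \<Rightarrow> 'a free_ring set set" where
  "clifford_ideal b = Idl\<^bsub>tensor_algebra\<^esub>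
     {tensor_incl v \<otimes>\<^bsub>tensor_algebra\<^esub> tensor_incl v
        \<ominus>\<^bsub>tensor_algebra\<^esub> add_pow tensor_algebra (b v v div 2) \<one>\<^bsub>tensor_algebra\<^esub> | v. True}"

definition clifford_algebra :: "('a::ab_group_add \<Rightarrow> 'a \<Rightarrow> int) \<Rightarrow> 'a clifford ring" where
  "clifford_algebra b = tensor_algebra Quot clifford_ideal b"

definition cl_incl :: "('a::ab_group_add \<Rightarrow> 'a \<Rightarrow> int) \<Rightarrow> 'a \<Rightarrow> 'a clifford" where
  "cl_incl b v = clifford_ideal b +>\<^bsub>tensor_algebra\<^esub> tensor_incl v"

definition cl_prod :: "('a::ab_group_add \<Rightarrow> 'a \<Rightarrow> int) \<Rightarrow> 'a list \<Rightarrow> 'a clifford" where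
  "cl_prod b vs =
     foldr (\<lambda>v x. cl_incl b v \<otimes>\<^bsub>clifford_algebra b\<^esub> x) vs \<one>\<^bsub>clifford_algebra b\<^esub>"

definition cl_even :: "('a::ab_group_add \<Rightarrow> 'a \<Rightarrow> int) \<Rightarrow> 'a clifford set" where
  "cl_even b = generate (add_monoid (clifford_algebra b)) {cl_prod b vs | vs. even (length vs)}"

definition cl_odd :: "('a::ab_group_add \<Rightarrow> 'a \<Rightarrow> int) \<Rightarrow> 'a clifford set" where
  "cl_odd b = generate (add_monoid (clifford_algebra b)) {cl_prod b vs | vs. odd (length vs)}"

text \<open>
  Reversing words is an anti-automorphism of the free ring that preserves both ideals.  An element
  of \<open>Cl(L)\<close> is a coset of cosets, so the induced map on \<open>Cl(L)\<close> is the image at both levels.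
\<close>

definition free_rev :: "'a free_ring \<Rightarrow> 'a free_ring" where
  "free_rev = Poly_Mapping.map_key word_rev"

definition cl_star :: "'a clifford \<Rightarrow> 'a clifford" where
  "cl_star \<alpha> = (\<lambda>t. free_rev ` t) ` \<alpha>"

definition cl_norm :: "('a::ab_group_add \<Rightarrow> 'a \<Rightarrow> int) \<Rightarrow> 'a clifford \<Rightarrow> 'a clifford" where
  "cl_norm b \<alpha> = \<alpha> \<otimes>\<^bsub>clifford_algebra b\<^esub> cl_star \<alpha>"

definition cl_pm1 :: "('a::ab_group_add \<Rightarrow> 'a \<Rightarrow> int) \<Rightarrow> 'a clifford set" where
  "cl_pm1 b = {\<one>\<^bsub>clifford_algebra b\<^esub>, \<ominus>\<^bsub>clifford_algebra b\<^esub> \<one>\<^bsub>clifford_algebra b\<^esub>}"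

definition cl_pm_units :: "('a::ab_group_add \<Rightarrow> 'a \<Rightarrow> int) \<Rightarrow> 'a clifford set" where
  "cl_pm_units b = {\<alpha> \<in> cl_even b \<union> cl_odd b. cl_norm b \<alpha> \<in> cl_pm1 b}"

definition cl_even_units :: "('a::ab_group_add \<Rightarrow> 'a \<Rightarrow> int) \<Rightarrow> 'a clifford set" where
  "cl_even_units b = {\<alpha> \<in> cl_even b. cl_norm b \<alpha> \<in> cl_pm1 b}"

definition cl_even_norm1 :: "('a::ab_group_add \<Rightarrow> 'a \<Rightarrow> int) \<Rightarrow> 'a clifford set" where
  "cl_even_norm1 b = {\<alpha> \<in> cl_even b. cl_norm b \<alpha> = \<one>\<^bsub>clifford_algebra b\<^esub>}"

definition cl_group ::
    "('a::ab_group_add \<Rightarrow> 'a \<Rightarrow> int) \<Rightarrow> 'a clifford set \<Rightarrow> 'a clifford monoid" where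
  "cl_group b S = (units_of (clifford_algebra b))\<lparr>carrier := S\<rparr>"

definition cl_twisted_conj ::
    "('a::ab_group_add \<Rightarrow> 'a \<Rightarrow> int) \<Rightarrow> 'a clifford \<Rightarrow> 'a \<Rightarrow> 'a clifford" where
  "cl_twisted_conj b \<alpha> v =
     (let C = clifford_algebra b;
          x = \<alpha> \<otimes>\<^bsub>C\<^esub> cl_incl b v \<otimes>\<^bsub>C\<^esub> inv\<^bsub>C\<^esub> \<alpha>
      in if \<alpha> \<in> cl_even b then x else \<ominus>\<^bsub>C\<^esub> x)"

end

theory Submission
  imports Defs
begin

text \<open>
  Left multiplication by \<open>L\<close> on the Clifford algebra becomes, in a basis \<open>e1, e2, e3\<close> of \<open>L\<close>, a family of
  explicit operators on \<open>\<int>\<^sup>8\<close> satisfying the Clifford relation.  As the eight ordered monomials span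
  \<open>Cl(L)\<close> and act independently on \<open>1\<close>, the Clifford algebra is isomorphic to the ring generated by
  these operators.

  In rank 3 an odd (even) element fixed by \<open>*\<close> is a vector (an integer), so \<open>\<alpha> v \<alpha>\<^sup>*\<close> lies in \<open>L\<close> and
  \<open>N \<alpha>\<close> in \<open>\<int>\<close>.  For \<open>v\<close> in the dual lattice the (super)commutator of \<open>\<alpha>\<close> with \<open>v\<close> is the contraction
  of \<open>\<alpha>\<close> by an integral linear form, hence integral; this gives the trivial action on \<open>A(L)\<close>.

  Conversely, an isometry \<open>g\<close> is a product of reflections over \<open>\<rat>\<close>, so it is induced by a product of
  vectors of \<open>L\<close>, and dividing by its content by a primitive homogeneous element \<open>\<alpha>\<close>.  If \<open>g\<close> is trivial
  on \<open>A(L)\<close>, then every contraction of \<open>\<alpha>\<close> has the form \<open>y \<alpha>\<close> with \<open>y\<close> in \<open>L\<close>; taking determinants, a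
  prime dividing \<open>N \<alpha>\<close> would divide \<open>\<alpha>\<close>, so \<open>N \<alpha> = \<plusminus>1\<close>.  The parity of \<open>\<alpha>\<close> is the determinant of \<open>g\<close>
  and \<open>N \<alpha>\<close> represents its spinor norm.
\<close>

section \<open>Additive endomorphisms of the exterior algebra of \<open>\<int>\<^sup>3\<close>\<close>

text \<open>The Clifford algebra of the definitions consists of cosets of cosets, and the dual
  lattice consists of fractions. In the model of operators, associativity is inherited from
  composition and every identity becomes a polynomial identity between eight integer coefficients.
  No rational Clifford algebra is built: a dual vector is written y / m, an isometry g is
  implemented through the inverse-free relation x y = s g(y) x, and denominators are cancelled
  because the model has no torsion.

  The determinants of the converse work as follows. Every integral linear form is the pairing with
  some z / \<open>disc\<close>, where \<open>disc\<close> is the Gram determinant. For even \<alpha>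
  the contractions by the coordinate forms have the squares of the bivector coefficients as minors,
  while the minors of y \<alpha> are multiples of N \<alpha>; so N \<alpha> divides these squares.
  For odd \<alpha> with top coefficient t, a determinant of order three shows that N \<alpha>
  divides t^2, and the vector part is reached through the quadratic form modulo p.

  The determinant of an isometry is taken in a chosen basis, which forces a proof that the rank is
  an invariant.\<close>

text \<open>\<open>Ext\<close> lists the coefficients of \<open>1, e1, e2, e3, e1 e2, e1 e3, e2 e3, e1 e2 e3\<close>.\<close>

datatype ext = Ext int int int int int int int int

instantiation ext :: ab_group_add
begin

definition zero_ext :: ext where
  "zero_ext = Ext 0 0 0 0 0 0 0 0"

fun plus_ext :: "ext \<Rightarrow> ext \<Rightarrow> ext" where
  "Ext c0 c1 c2 c3 c12 c13 c23 c123 + Ext d0 d1 d2 d3 d12 d13 d23 d123 =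
     Ext (c0 + d0) (c1 + d1) (c2 + d2) (c3 + d3) (c12 + d12) (c13 + d13) (c23 + d23) (c123 + d123)"

fun uminus_ext :: "ext \<Rightarrow> ext" where
  "- Ext c0 c1 c2 c3 c12 c13 c23 c123 =
     Ext (- c0) (- c1) (- c2) (- c3) (- c12) (- c13) (- c23) (- c123)"

fun minus_ext :: "ext \<Rightarrow> ext \<Rightarrow> ext" where
  "Ext c0 c1 c2 c3 c12 c13 c23 c123 - Ext d0 d1 d2 d3 d12 d13 d23 d123 =
     Ext (c0 - d0) (c1 - d1) (c2 - d2) (c3 - d3) (c12 - d12) (c13 - d13) (c23 - d23) (c123 - d123)"

instance
proof
  fix x y z :: ext
  show "x + y + z = x + (y + z)" by (cases x; cases y; cases z) simp
  show "x + y = y + x" by (cases x; cases y) simp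
  show "0 + x = x" by (cases x) (simp add: zero_ext_def)
  show "- x + x = 0" by (cases x) (simp add: zero_ext_def)
  show "x - y = x + - y" by (cases x; cases y) simp
qed

end

text \<open>Operators, rather than a product on coefficient vectors, make associativity a matter of
  composition; as an instance of \<open>ring_1\<close> the type can receive evaluations of the free
  ring.\<close>

typedef ext_endo = "{f :: ext \<Rightarrow> ext. additive f}"
  morphisms app Ext_Endo
  by (auto intro!: exI[where x = "\<lambda>_. 0"] simp: additive_def)

setup_lifting type_definition_ext_endo

lemma app_add [simp]: "app f (x + y) = app f x + app f y"
  using app[of f] by (simp add: additive_def)

instantiation ext_endo :: ring_1
begin

lift_definition zero_ext_endo :: ext_endo is "\<lambda>_. 0" by (simp add: additive_def)
lift_definition one_ext_endo :: ext_endo is "\<lambda>x. x" by (simp add: additive_def)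
lift_definition plus_ext_endo :: "ext_endo \<Rightarrow> ext_endo \<Rightarrow> ext_endo" is "\<lambda>f g x. f x + g x"
  by (simp add: additive_def add_ac)
lift_definition uminus_ext_endo :: "ext_endo \<Rightarrow> ext_endo" is "\<lambda>f x. - f x"
  by (simp add: additive_def)
lift_definition minus_ext_endo :: "ext_endo \<Rightarrow> ext_endo \<Rightarrow> ext_endo" is "\<lambda>f g x. f x - g x"
  by (simp add: additive_def)
lift_definition times_ext_endo :: "ext_endo \<Rightarrow> ext_endo \<Rightarrow> ext_endo" is "\<lambda>f g x. f (g x)"
  by (simp add: additive_def)

instance
proof
  show "(0 :: ext_endo) \<noteq> 1"
    by transfer (auto simp: fun_eq_iff zero_ext_def intro!: exI[where x = "Ext 1 0 0 0 0 0 0 0"])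
qed (transfer; simp add: fun_eq_iff additive_def add_ac)+

end

lemma app_simps [simp]:
  "app 0 x = 0" "app 1 x = x" "app (f + g) x = app f x + app g x" "app (- f) x = - app f x"
  "app (f - g) x = app f x - app g x" "app (f * g) x = app f (app g x)"
  by (transfer; simp)+

lemma ext_endo_eqI: "(\<And>x. app f x = app g x) \<Longrightarrow> f = g"
  by transfer auto

fun ext_scale :: "int \<Rightarrow> ext \<Rightarrow> ext" where
  "ext_scale n (Ext c0 c1 c2 c3 c12 c13 c23 c123) =
     Ext (n * c0) (n * c1) (n * c2) (n * c3) (n * c12) (n * c13) (n * c23) (n * c123)"

lemma app_of_int [simp]: "app (of_int n) x = ext_scale n x"
proof (induction n rule: int_induct[where k = 0])
  case base
  show ?case by (cases x) (simp add: zero_ext_def)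
next
  case (step1 i)
  then show ?case
    by (cases x) (simp add: algebra_simps)
next
  case (step2 i)
  then show ?case
    by (cases x) (simp add: algebra_simps)
qed

lemma app_numeral [simp]: "app (numeral n) x = ext_scale (numeral n) x"
  using app_of_int[of "numeral n" x] by simp

section \<open>Left multiplication operators of a ternary quadratic form\<close>

locale ternary_form =
  fixes q1 q2 q3 u v w :: int
begin

text \<open>
  The quadratic form is \<open>q1 x1\<^sup>2 + q2 x2\<^sup>2 + q3 x3\<^sup>2 + u x2 x3 + v x1 x3 + w x1 x2\<close>; the formula for left
  multiplication results from bringing \<open>(x1 e1 + x2 e2 + x3 e3) c\<close> into normal form.
\<close>

fun left_mult :: "int \<Rightarrow> int \<Rightarrow> int \<Rightarrow> ext \<Rightarrow> ext" where
  "left_mult x1 x2 x3 (Ext c0 c1 c2 c3 c12 c13 c23 c123) =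
    Ext (x1 * q1 * c1 + x2 * (w * c1 + q2 * c2) + x3 * (v * c1 + u * c2 + q3 * c3))
        (x1 * c0 - x2 * q2 * c12 - x3 * (u * c12 + q3 * c13))
        (x1 * q1 * c12 + x2 * (c0 + w * c12) + x3 * (v * c12 - q3 * c23))
        (x1 * q1 * c13 + x2 * (w * c13 + q2 * c23) + x3 * (c0 + v * c13 + u * c23))
        (x1 * c2 - x2 * c1 + x3 * q3 * c123)
        (x1 * c3 - x2 * q2 * c123 - x3 * (c1 + u * c123))
        (x1 * q1 * c123 + x2 * (c3 + w * c123) + x3 * (v * c123 - c2))
        (x1 * c23 - x2 * c13 + x3 * c12)"

lift_definition vec :: "int \<Rightarrow> int \<Rightarrow> int \<Rightarrow> ext_endo" is left_mult
proof (simp add: additive_def, intro allI)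
  fix x1 x2 x3 c d
  show "left_mult x1 x2 x3 (c + d) = left_mult x1 x2 x3 c + left_mult x1 x2 x3 d"
    by (cases c; cases d) (simp add: algebra_simps)
qed

lemma app_vec [simp]: "app (vec x1 x2 x3) = left_mult x1 x2 x3"
  by transfer simp

definition Q :: "int \<Rightarrow> int \<Rightarrow> int \<Rightarrow> int" where
  "Q x1 x2 x3 = q1 * x1\<^sup>2 + q2 * x2\<^sup>2 + q3 * x3\<^sup>2 + u * x2 * x3 + v * x1 * x3 + w * x1 * x2"

text \<open>The Clifford relation in the model, checked coefficientwise; because of it, evaluation
  of the free ring vanishes on the Clifford ideal.\<close>

lemma vec_square: "vec x1 x2 x3 * vec x1 x2 x3 = of_int (Q x1 x2 x3)"
proof (rule ext_endo_eqI)
  fix c show "app (vec x1 x2 x3 * vec x1 x2 x3) c = app (of_int (Q x1 x2 x3)) c"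
    by (cases c) (simp add: Q_def algebra_simps power2_eq_square)
qed

lemma vec_add: "vec x1 x2 x3 + vec y1 y2 y3 = vec (x1 + y1) (x2 + y2) (x3 + y3)"
proof (rule ext_endo_eqI)
  fix c show "app (vec x1 x2 x3 + vec y1 y2 y3) c = app (vec (x1 + y1) (x2 + y2) (x3 + y3)) c"
    by (cases c) (simp add: algebra_simps)
qed

lemma vec_scale: "of_int n * vec x1 x2 x3 = vec (n * x1) (n * x2) (n * x3)"
proof (rule ext_endo_eqI)
  fix c show "app (of_int n * vec x1 x2 x3) c = app (vec (n * x1) (n * x2) (n * x3)) c"
    by (cases c) (simp add: algebra_simps)
qed

fun cl :: "ext \<Rightarrow> ext_endo" where
  "cl (Ext c0 c1 c2 c3 c12 c13 c23 c123) =
     of_int c0 + vec c1 c2 c3 + of_int c12 * (vec 1 0 0 * vec 0 1 0)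
     + of_int c13 * (vec 1 0 0 * vec 0 0 1) + of_int c23 * (vec 0 1 0 * vec 0 0 1)
     + of_int c123 * (vec 1 0 0 * (vec 0 1 0 * vec 0 0 1))"

definition unit :: ext where "unit = Ext 1 0 0 0 0 0 0 0"

text \<open>Linear independence of the eight ordered monomials: an operator \<open>cl c\<close> is
  recovered from its value at 1.\<close>

lemma app_cl_unit [simp]: "app (cl c) unit = c"
  by (cases c) (simp add: unit_def)

lemma cl_inject [simp]: "cl c = cl d \<longleftrightarrow> c = d"
  by (metis app_cl_unit)

text \<open>Closure of \<open>range cl\<close> under left multiplication is checked on the three
  basis vectors; \<open>vec_mult_cl\<close> follows by linearity, which keeps the polynomial
  identities small.\<close>

lemma vec_cl1: "vec 1 0 0 * cl c = cl (left_mult 1 0 0 c)"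
proof (rule ext_endo_eqI)
  fix d show "app (vec 1 0 0 * cl c) d = app (cl (left_mult 1 0 0 c)) d"
    by (cases c; cases d) (simp add: algebra_simps)
qed

lemma vec_cl2: "vec 0 1 0 * cl c = cl (left_mult 0 1 0 c)"
proof (rule ext_endo_eqI)
  fix d show "app (vec 0 1 0 * cl c) d = app (cl (left_mult 0 1 0 c)) d"
    by (cases c; cases d) (simp add: algebra_simps)
qed

lemma vec_cl3: "vec 0 0 1 * cl c = cl (left_mult 0 0 1 c)"
proof (rule ext_endo_eqI)
  fix d show "app (vec 0 0 1 * cl c) d = app (cl (left_mult 0 0 1 c)) d"
    by (cases c; cases d) (simp add: algebra_simps)
qed

text \<open>The constants come from bringing reversed monomials into normal order:
  \<open>e2 e1 = w - e1 e2\<close>, and likewise with \<open>v\<close> and \<open>u\<close>, and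
  \<open>e3 e2 e1 = u e1 - v e2 + w e3 - e1 e2 e3\<close>.\<close>

fun ext_star :: "ext \<Rightarrow> ext" where
  "ext_star (Ext c0 c1 c2 c3 c12 c13 c23 c123) =
    Ext (c0 + w * c12 + v * c13 + u * c23) (c1 + u * c123) (c2 - v * c123) (c3 + w * c123)
        (- c12) (- c13) (- c23) (- c123)"

lemma ext_star_mult: "ext_star (app (cl c) d) = app (cl (ext_star d)) (ext_star c)"
    by (cases c; cases d) (simp add: algebra_simps)

end

section \<open>The model of the Clifford algebra\<close>

context ternary_form
begin

lemma cl_add: "cl c + cl d = cl (c + d)"
  by (cases c; cases d) (simp add: vec_add[symmetric] algebra_simps)

lemma cl_scale: "of_int n * cl c = cl (ext_scale n c)"
proof (cases c)
  case (Ext c0 c1 c2 c3 c12 c13 c23 c123)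
  show ?thesis
    unfolding Ext ext_scale.simps cl.simps distrib_left of_int_mult mult.assoc
    by (simp add: vec_scale)
qed

lemma cl_uminus: "- cl c = cl (- c)"
  using cl_scale[of "-1" c] by (cases c) simp

lemma cl_diff: "cl c - cl d = cl (c - d)"
  using cl_add[of c "- d"] by (simp only: cl_uminus[symmetric] diff_conv_add_uminus)

lemma of_int_cl: "of_int n = cl (Ext n 0 0 0 0 0 0 0)"
  using vec_scale[of 0 0 0 0] by simp

lemma vec_cl: "vec x1 x2 x3 = cl (Ext 0 x1 x2 x3 0 0 0 0)"
  by simp

lemma vec_mult_cl: "vec x1 x2 x3 * cl c = cl (left_mult x1 x2 x3 c)"
proof -
  have "vec x1 x2 x3 = of_int x1 * vec 1 0 0 + of_int x2 * vec 0 1 0 + of_int x3 * vec 0 0 1"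
    by (simp add: vec_scale vec_add)
  then have "vec x1 x2 x3 * cl c = cl (ext_scale x1 (left_mult 1 0 0 c)
      + ext_scale x2 (left_mult 0 1 0 c) + ext_scale x3 (left_mult 0 0 1 c))"
    by (simp only: distrib_right mult.assoc vec_cl1 vec_cl2 vec_cl3 cl_scale cl_add)
  also have "ext_scale x1 (left_mult 1 0 0 c)
      + ext_scale x2 (left_mult 0 1 0 c) + ext_scale x3 (left_mult 0 0 1 c) = left_mult x1 x2 x3 c"
    by (cases c) (simp add: algebra_simps)
  finally show ?thesis .
qed

text \<open>Each monomial of \<open>cl c\<close> moves into the coefficients by
  \<open>vec_mult_cl\<close>. So \<open>range cl\<close> is a ring, and identities in it reduce to
  eight coefficients.\<close>

lemma cl_mult: "cl c * cl d = cl (app (cl c) d)"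
proof (cases c)
  case (Ext c0 c1 c2 c3 c12 c13 c23 c123)
  show ?thesis
    unfolding Ext cl.simps distrib_right mult.assoc vec_mult_cl cl_scale cl_add
    by simp
qed

lemma range_cl_closed [intro]:
  "x \<in> range cl \<Longrightarrow> y \<in> range cl \<Longrightarrow> x + y \<in> range cl"
  "x \<in> range cl \<Longrightarrow> y \<in> range cl \<Longrightarrow> x - y \<in> range cl"
  "x \<in> range cl \<Longrightarrow> y \<in> range cl \<Longrightarrow> x * y \<in> range cl"
  "x \<in> range cl \<Longrightarrow> - x \<in> range cl"
  "of_int n \<in> range cl" "0 \<in> range cl" "1 \<in> range cl" "vec x1 x2 x3 \<in> range cl"
  using of_int_cl[of n] of_int_cl[of 0] of_int_cl[of 1] vec_cl[of x1 x2 x3]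
  by (auto simp: cl_add cl_diff cl_mult cl_uminus simp del: cl.simps)

lemma range_cl_eqI: "x \<in> range cl \<Longrightarrow> y \<in> range cl \<Longrightarrow> app x unit = app y unit \<Longrightarrow> x = y"
  by auto

lemma ext_scale_cancel: "n \<noteq> 0 \<Longrightarrow> ext_scale n c = ext_scale n d \<Longrightarrow> c = d"
  by (cases c; cases d) simp

text \<open>Absence of torsion in the model; this replaces extension of scalars to \<rat> whenever a
  denominator is cancelled.\<close>

lemma of_int_mult_cancel:
  assumes "x \<in> range cl" "y \<in> range cl" "n \<noteq> 0" "of_int n * x = of_int n * y"
  shows "x = y"
  using assms ext_scale_cancel[of n] by (auto simp: cl_scale)

text \<open>Defined on all operators through the value at 1, but an anti-involution only on
  \<open>range cl\<close>.\<close>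

definition star :: "ext_endo \<Rightarrow> ext_endo" where
  "star x = cl (ext_star (app x unit))"

lemma star_cl: "star (cl c) = cl (ext_star c)"
  by (simp only: star_def app_cl_unit)

lemma star_closed [intro, simp]: "star x \<in> range cl"
  by (simp add: star_def)

lemma star_mult: "x \<in> range cl \<Longrightarrow> y \<in> range cl \<Longrightarrow> star (x * y) = star y * star x"
  by (auto simp: star_cl cl_mult ext_star_mult simp del: cl.simps)

lemma ext_star_add: "ext_star (c + d) = ext_star c + ext_star d"
  by (cases c; cases d) (simp add: algebra_simps)

lemma star_add: "star (x + y) = star x + star y"
  by (simp add: star_def cl_add ext_star_add)

lemma star_star: "x \<in> range cl \<Longrightarrow> star (star x) = x"
proof -
  have "ext_star (ext_star c) = c" for c
    by (cases c) (simp add: algebra_simps)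
  then show "x \<in> range cl \<Longrightarrow> star (star x) = x"
    by (auto simp: star_cl simp del: cl.simps)
qed

lemma star_of_int [simp]: "star (of_int n) = of_int n"
  by (simp only: of_int_cl star_cl) simp

lemma star_vec [simp]: "star (vec x1 x2 x3) = vec x1 x2 x3"
  by (simp only: vec_cl star_cl) simp

lemma star_1 [simp]: "star 1 = 1"
  using star_of_int[of 1] by simp

lemma star_uminus: "star (- x) = - star x"
  using star_add[of x "- x"] star_of_int[of 0] by (simp add: eq_neg_iff_add_eq_0 add.commute)

section \<open>Even and odd elements\<close>

definition ev :: "int \<Rightarrow> int \<Rightarrow> int \<Rightarrow> int \<Rightarrow> ext_endo" where
  "ev a a12 a13 a23 = cl (Ext a 0 0 0 a12 a13 a23 0)"

definition od :: "int \<Rightarrow> int \<Rightarrow> int \<Rightarrow> int \<Rightarrow> ext_endo" where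
  "od x1 x2 x3 t = cl (Ext 0 x1 x2 x3 0 0 0 t)"

definition Even :: "ext_endo set" where
  "Even = {ev a a12 a13 a23 | a a12 a13 a23. True}"

definition Odd :: "ext_endo set" where
  "Odd = {od x1 x2 x3 t | x1 x2 x3 t. True}"

lemma ev_in_Even [intro, simp]: "ev a a12 a13 a23 \<in> Even"
  by (auto simp: Even_def)

lemma od_in_Odd [intro, simp]: "od x1 x2 x3 t \<in> Odd"
  by (auto simp: Odd_def)

lemma EvenE: assumes "x \<in> Even" obtains a a12 a13 a23 where "x = ev a a12 a13 a23"
  using assms by (auto simp: Even_def)

lemma OddE: assumes "x \<in> Odd" obtains x1 x2 x3 t where "x = od x1 x2 x3 t"
  using assms by (auto simp: Odd_def)

lemma ev_of_int: "of_int n = ev n 0 0 0"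
  unfolding ev_def by (rule of_int_cl)

lemma od_vec: "vec x1 x2 x3 = od x1 x2 x3 0"
  unfolding od_def by (rule vec_cl)

lemma of_int_in_Even [intro, simp]: "of_int n \<in> Even"
  by (simp add: ev_of_int)

lemma one_in_Even [intro, simp]: "1 \<in> Even"
  using of_int_in_Even[of 1] by simp

lemma vec_in_Odd [intro, simp]: "vec x1 x2 x3 \<in> Odd"
  by (simp add: od_vec)

lemma Even_Odd_in_range: "x \<in> Even \<union> Odd \<Longrightarrow> x \<in> range cl"
  by (auto simp: Even_def Odd_def ev_def od_def simp del: cl.simps)

lemma Even_in_range [intro]: "x \<in> Even \<Longrightarrow> x \<in> range cl"
  and Odd_in_range [intro]: "x \<in> Odd \<Longrightarrow> x \<in> range cl"
  by (simp_all add: Even_Odd_in_range)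

lemma Even_Int_Odd: "x \<in> Even \<Longrightarrow> x \<in> Odd \<Longrightarrow> x = 0"
  using of_int_cl[of 0] by (auto simp: Even_def Odd_def ev_def od_def simp del: cl.simps)

lemma Even_add [intro]: "x \<in> Even \<Longrightarrow> y \<in> Even \<Longrightarrow> x + y \<in> Even"
  by (auto simp: Even_def ev_def cl_add simp del: cl.simps)

lemma Odd_add [intro]: "x \<in> Odd \<Longrightarrow> y \<in> Odd \<Longrightarrow> x + y \<in> Odd"
  by (auto simp: Odd_def od_def cl_add simp del: cl.simps)

lemma Even_uminus [intro]: "x \<in> Even \<Longrightarrow> - x \<in> Even"
  by (auto simp: Even_def ev_def cl_uminus simp del: cl.simps)

lemma Odd_uminus [intro]: "x \<in> Odd \<Longrightarrow> - x \<in> Odd"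
  by (auto simp: Odd_def od_def cl_uminus simp del: cl.simps)

lemma Even_mult_Even [intro]: "x \<in> Even \<Longrightarrow> y \<in> Even \<Longrightarrow> x * y \<in> Even"
  by (elim EvenE, simp only: ev_def cl_mult, simp add: Even_def ev_def del: cl.simps)
    (simp add: cl_inject)

lemma Even_mult_Odd [intro]: "x \<in> Even \<Longrightarrow> y \<in> Odd \<Longrightarrow> x * y \<in> Odd"
  by (elim EvenE OddE, simp only: ev_def od_def cl_mult, simp add: Odd_def od_def del: cl.simps)
    (simp add: cl_inject)

lemma Odd_mult_Even [intro]: "x \<in> Odd \<Longrightarrow> y \<in> Even \<Longrightarrow> x * y \<in> Odd"
  by (elim EvenE OddE, simp only: ev_def od_def cl_mult, simp add: Odd_def od_def del: cl.simps)
    (simp add: cl_inject)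

lemma Odd_mult_Odd [intro]: "x \<in> Odd \<Longrightarrow> y \<in> Odd \<Longrightarrow> x * y \<in> Even"
  by (elim OddE, simp only: od_def cl_mult, simp add: Even_def ev_def del: cl.simps)
    (simp add: cl_inject)

lemma Even_star [intro]: "x \<in> Even \<Longrightarrow> star x \<in> Even"
  by (auto simp: Even_def ev_def star_cl simp del: cl.simps)

lemma Odd_star [intro]: "x \<in> Odd \<Longrightarrow> star x \<in> Odd"
  by (auto simp: Odd_def od_def star_cl simp del: cl.simps)

text \<open>Reversal changes the sign of the coefficient of \<open>e1 e2 e3\<close>, so that
  coefficient vanishes. This is what puts a conjugated vector back into L in rank 3.\<close>

lemma star_fixed_Odd:
  assumes "x \<in> Odd" "star x = x" obtains x1 x2 x3 where "x = vec x1 x2 x3"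
  using assms by (auto simp: Odd_def od_def star_cl vec_cl simp del: cl.simps)

section \<open>The Clifford norm as a quadratic form in the coefficients\<close>

definition norm_ev :: "int \<Rightarrow> int \<Rightarrow> int \<Rightarrow> int \<Rightarrow> int" where
  "norm_ev a a12 a13 a23 = a\<^sup>2 + a * (w * a12 + v * a13 + u * a23)
     + q1 * q2 * a12\<^sup>2 + q1 * q3 * a13\<^sup>2 + q2 * q3 * a23\<^sup>2
     + q1 * u * a12 * a13 + (u * w - v * q2) * a12 * a23 + q3 * w * a13 * a23"

definition norm_od :: "int \<Rightarrow> int \<Rightarrow> int \<Rightarrow> int \<Rightarrow> int" where
  "norm_od x1 x2 x3 t = Q x1 x2 x3 + t * (q1 * u * x1 + (u * w - q2 * v) * x2 + q3 * w * x3)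
     + q1 * q2 * q3 * t\<^sup>2"

lemma ev_mult_star: "ev a a12 a13 a23 * star (ev a a12 a13 a23) = of_int (norm_ev a a12 a13 a23)"
  unfolding ev_def star_cl of_int_cl cl_mult cl_inject
  by (simp add: norm_ev_def algebra_simps power2_eq_square)

lemma od_mult_star: "od x1 x2 x3 t * star (od x1 x2 x3 t) = of_int (norm_od x1 x2 x3 t)"
  unfolding od_def star_cl of_int_cl cl_mult cl_inject
  by (simp add: norm_od_def Q_def algebra_simps power2_eq_square)

lemma mult_star_int:
  assumes "x \<in> Even \<union> Odd" obtains n where "x * star x = of_int n"
  using assms ev_mult_star od_mult_star by (auto elim!: EvenE OddE)

text \<open>The pairings of y with \<open>e1\<close>, \<open>e2\<close>, \<open>e3\<close>: the rows
  of the Gram matrix, whose diagonal is \<open>2 * q1\<close>, \<open>2 * q2\<close>,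
  \<open>2 * q3\<close>.\<close>

definition dual1 :: "int \<Rightarrow> int \<Rightarrow> int \<Rightarrow> int" where "dual1 y1 y2 y3 = 2 * q1 * y1 + w * y2 + v * y3"
definition dual2 :: "int \<Rightarrow> int \<Rightarrow> int \<Rightarrow> int" where "dual2 y1 y2 y3 = w * y1 + 2 * q2 * y2 + u * y3"
definition dual3 :: "int \<Rightarrow> int \<Rightarrow> int \<Rightarrow> int" where "dual3 y1 y2 y3 = v * y1 + u * y2 + 2 * q3 * y3"

text \<open>By \<open>e_i y = l_i - y e_i\<close>, moving y through a monomial leaves only
  contraction terms. The result involves y solely through its pairings, so it is divisible by m as
  soon as they are.\<close>

lemma ev_commutator:
  fixes y1 y2 y3
  defines "l1 \<equiv> dual1 y1 y2 y3" and "l2 \<equiv> dual2 y1 y2 y3" and "l3 \<equiv> dual3 y1 y2 y3"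
  shows "ev a a12 a13 a23 * vec y1 y2 y3 - vec y1 y2 y3 * ev a a12 a13 a23 =
    vec (a12 * l2 + a13 * l3) (a23 * l3 - a12 * l1) (- a13 * l1 - a23 * l2)"
  unfolding ev_def vec_cl cl_mult cl_diff cl_inject l1_def l2_def l3_def dual1_def dual2_def dual3_def
  by (simp add: algebra_simps)

text \<open>The sign attached to odd elements turns the commutator into an anticommutator. The
  scalar part pairs the form with the vector part; the bivector part is \<open>t\<close> times the
  dual of the form.\<close>

lemma od_anticommutator:
  fixes y1 y2 y3
  defines "l1 \<equiv> dual1 y1 y2 y3" and "l2 \<equiv> dual2 y1 y2 y3" and "l3 \<equiv> dual3 y1 y2 y3"
  shows "od x1 x2 x3 t * vec y1 y2 y3 + vec y1 y2 y3 * od x1 x2 x3 t =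
    ev (l1 * x1 + l2 * x2 + l3 * x3) (t * l3) (- t * l2) (t * l1)"
  unfolding od_def ev_def vec_cl cl_mult cl_add cl_inject l1_def l2_def l3_def dual1_def dual2_def dual3_def
  by (simp add: algebra_simps)

text \<open>The determinant of the Gram matrix.\<close>

definition disc :: int where
  "disc = 8 * q1 * q2 * q3 + 2 * u * v * w - 2 * q1 * u\<^sup>2 - 2 * q2 * v\<^sup>2 - 2 * q3 * w\<^sup>2"

text \<open>Cramer's rule: the witnesses are the adjugate of the Gram matrix applied to the form.
  Every integral linear form is thus the pairing with the dual vector y /
  \<open>disc\<close>.\<close>

lemma dual_vector_exists:
  obtains y1 y2 y3 where "dual1 y1 y2 y3 = disc * l1" "dual2 y1 y2 y3 = disc * l2"
    "dual3 y1 y2 y3 = disc * l3"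
proof
  let ?y1 = "(4 * q2 * q3 - u\<^sup>2) * l1 + (u * v - 2 * q3 * w) * l2 + (u * w - 2 * q2 * v) * l3"
  let ?y2 = "(u * v - 2 * q3 * w) * l1 + (4 * q1 * q3 - v\<^sup>2) * l2 + (v * w - 2 * q1 * u) * l3"
  let ?y3 = "(u * w - 2 * q2 * v) * l1 + (v * w - 2 * q1 * u) * l2 + (4 * q1 * q2 - w\<^sup>2) * l3"
  show "dual1 ?y1 ?y2 ?y3 = disc * l1" "dual2 ?y1 ?y2 ?y3 = disc * l2" "dual3 ?y1 ?y2 ?y3 = disc * l3"
    by (simp_all add: dual1_def dual2_def dual3_def disc_def algebra_simps power2_eq_square)
qed

text \<open>Commuting with L kills every contraction, and every linear form occurs up to the nonzero
  factor \<open>disc\<close>; among even elements only scalars have no contraction.\<close>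

lemma Even_central:
  assumes "x \<in> Even" "disc \<noteq> 0" "\<And>y1 y2 y3. x * vec y1 y2 y3 = vec y1 y2 y3 * x"
  obtains n where "x = of_int n"
proof -
  obtain a a12 a13 a23 where x: "x = ev a a12 a13 a23"
    using assms(1) by (rule EvenE)
  have *: "a12 * l2 + a13 * l3 = 0 \<and> a23 * l3 - a12 * l1 = 0" for l1 l2 l3
  proof -
    obtain y1 y2 y3 where y: "dual1 y1 y2 y3 = disc * l1" "dual2 y1 y2 y3 = disc * l2"
      "dual3 y1 y2 y3 = disc * l3" by (rule dual_vector_exists)
    have "vec (a12 * (disc * l2) + a13 * (disc * l3)) (a23 * (disc * l3) - a12 * (disc * l1))
       (- a13 * (disc * l1) - a23 * (disc * l2)) = of_int 0"
      using ev_commutator[of a a12 a13 a23 y1 y2 y3] assms(3)[of y1 y2 y3] by (simp add: x y)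
    then have "a12 * (disc * l2) + a13 * (disc * l3) = 0" "a23 * (disc * l3) - a12 * (disc * l1) = 0"
      unfolding vec_cl of_int_cl cl_inject by simp_all
    moreover have "a12 * (disc * l2) + a13 * (disc * l3) = disc * (a12 * l2 + a13 * l3)"
      "a23 * (disc * l3) - a12 * (disc * l1) = disc * (a23 * l3 - a12 * l1)"
      by (simp_all add: algebra_simps)
    ultimately show ?thesis using assms(2) by simp
  qed
  have "a12 = 0" "a13 = 0" "a23 = 0"
    using *[of 0 1 0] *[of 0 0 1] by simp_all
  then show thesis
    using that[of a] by (simp add: x ev_of_int)
qed

text \<open>The same argument for odd elements. The sign is essential: the odd element of
  \<open>pseudoscalar_central\<close> commutes with L, but no nonzero odd element anticommutes with
  L.\<close>

lemma Odd_anticentral: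
  assumes "x \<in> Odd" "disc \<noteq> 0" "\<And>y1 y2 y3. x * vec y1 y2 y3 = - (vec y1 y2 y3 * x)"
  shows "x = 0"
proof -
  obtain x1 x2 x3 t where x: "x = od x1 x2 x3 t"
    using assms(1) by (rule OddE)
  have *: "l1 * x1 + l2 * x2 + l3 * x3 = 0 \<and> t * l1 = 0" for l1 l2 l3
  proof -
    obtain y1 y2 y3 where y: "dual1 y1 y2 y3 = disc * l1" "dual2 y1 y2 y3 = disc * l2"
      "dual3 y1 y2 y3 = disc * l3" by (rule dual_vector_exists)
    have "ev (disc * l1 * x1 + disc * l2 * x2 + disc * l3 * x3) (t * (disc * l3))
       (- t * (disc * l2)) (t * (disc * l1)) = of_int 0"
      using od_anticommutator[of x1 x2 x3 t y1 y2 y3] assms(3)[of y1 y2 y3] by (simp add: x y)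
    then have "disc * l1 * x1 + disc * l2 * x2 + disc * l3 * x3 = 0" "t * (disc * l1) = 0"
      unfolding ev_def of_int_cl cl_inject by simp_all
    moreover have "disc * l1 * x1 + disc * l2 * x2 + disc * l3 * x3 = disc * (l1 * x1 + l2 * x2 + l3 * x3)"
      by (simp add: algebra_simps)
    ultimately show ?thesis using assms(2) by simp
  qed
  have "x1 = 0" "x2 = 0" "x3 = 0" "t = 0"
    using *[of 1 0 0] *[of 0 1 0] *[of 0 0 1] by simp_all
  then show "x = 0"
    using of_int_cl[of 0] by (simp add: x od_def del: cl.simps)
qed

section \<open>Determinants and the norms of primitive elements\<close>

definition det3 :: "int \<Rightarrow> int \<Rightarrow> int \<Rightarrow> int \<Rightarrow> int \<Rightarrow> int \<Rightarrow> int \<Rightarrow> int \<Rightarrow> int \<Rightarrow> int" where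
  "det3 x1 x2 x3 y1 y2 y3 z1 z2 z3 =
     x1 * (y2 * z3 - y3 * z2) - x2 * (y1 * z3 - y3 * z1) + x3 * (y1 * z2 - y2 * z1)"

fun top_coeff :: "ext \<Rightarrow> int" where "top_coeff (Ext c0 c1 c2 c3 c12 c13 c23 c123) = c123"

text \<open>Reordering vectors by the Clifford relation only adds terms of degree one, so the top
  coefficient is the same as in the exterior algebra.\<close>

lemma top_vec3: "top_coeff (app (vec x1 x2 x3 * (vec y1 y2 y3 * vec z1 z2 z3)) unit) =
    det3 x1 x2 x3 y1 y2 y3 z1 z2 z3"
  by (simp add: unit_def det3_def algebra_simps)

text \<open>The constants are those of \<open>e1 e2 e3 - e3 e2 e1\<close>. Over \<rat> this is a
  multiple of the product of an orthogonal basis, which commutes with all vectors in odd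
  rank.\<close>

lemma pseudoscalar_central: "cl c * od (- u) v (- w) 2 = od (- u) v (- w) 2 * cl c"
  unfolding od_def cl_mult cl_inject by (cases c) (simp add: algebra_simps)


text \<open>
  Right multiplication by an even \<open>\<alpha>\<close> maps the plane of all \<open>y\<close> with \<open>y \<alpha> \<in> L\<close> to itself, with determinant
  \<open>N \<alpha>\<close>; here this is expressed by minors.
\<close>

lemma norm_ev_minor:
  assumes "y1 * a23 - y2 * a13 + y3 * a12 = 0" "z1 * a23 - z2 * a13 + z3 * a12 = 0"
  shows
    "(y1 * a - y2 * q2 * a12 - y3 * (u * a12 + q3 * a13)) *
     (z1 * q1 * a12 + z2 * (a + w * a12) + z3 * (v * a12 - q3 * a23))
   - (y1 * q1 * a12 + y2 * (a + w * a12) + y3 * (v * a12 - q3 * a23)) *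
     (z1 * a - z2 * q2 * a12 - z3 * (u * a12 + q3 * a13))
   = norm_ev a a12 a13 a23 * (y1 * z2 - y2 * z1)" (is ?A)
    "(y1 * a - y2 * q2 * a12 - y3 * (u * a12 + q3 * a13)) *
     (z1 * q1 * a13 + z2 * (w * a13 + q2 * a23) + z3 * (a + v * a13 + u * a23))
   - (y1 * q1 * a13 + y2 * (w * a13 + q2 * a23) + y3 * (a + v * a13 + u * a23)) *
     (z1 * a - z2 * q2 * a12 - z3 * (u * a12 + q3 * a13))
   = norm_ev a a12 a13 a23 * (y1 * z3 - y3 * z1)" (is ?B)
    "(y1 * q1 * a12 + y2 * (a + w * a12) + y3 * (v * a12 - q3 * a23)) *
     (z1 * q1 * a13 + z2 * (w * a13 + q2 * a23) + z3 * (a + v * a13 + u * a23))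
   - (y1 * q1 * a13 + y2 * (w * a13 + q2 * a23) + y3 * (a + v * a13 + u * a23)) *
     (z1 * q1 * a12 + z2 * (a + w * a12) + z3 * (v * a12 - q3 * a23))
   = norm_ev a a12 a13 a23 * (y2 * z3 - y3 * z2)" (is ?C)
proof -
  \<comment> \<open>\<open>?t\<close> is the coefficient of \<open>e1 e2 e3\<close> in the product y
    \<alpha>. The two sides differ by a combination of its values at y and z, and each
    \<open>?P\<close> is the cofactor that exhibits this.\<close>
  let ?t = "\<lambda>z1 z2 z3. z1 * a23 - z2 * a13 + z3 * a12"
  let ?P = "\<lambda>z1 z2 z3. z2 * (a12 * (q2 * v - u * w) - a * u - a13 * q3 * w - a23 * q2 * q3) - z1 * (a * v + a12 * q1 * u + a13 * q1 * q3) - z3 * a * q3"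
  have "(y1 * a - y2 * q2 * a12 - y3 * (u * a12 + q3 * a13)) * (z1 * q1 * a12 + z2 * (a + w * a12) + z3 * (v * a12 - q3 * a23))
   - (y1 * q1 * a12 + y2 * (a + w * a12) + y3 * (v * a12 - q3 * a23)) * (z1 * a - z2 * q2 * a12 - z3 * (u * a12 + q3 * a13))
   = norm_ev a a12 a13 a23 * (y1 * z2 - y2 * z1)
     + ?t y1 y2 y3 * ?P z1 z2 z3 - ?t z1 z2 z3 * ?P y1 y2 y3"
    by (simp add: norm_ev_def algebra_simps power2_eq_square)
  then show ?A by (simp add: assms)
  let ?P = "\<lambda>z1 z2 z3. z1 * (a * w + a12 * q1 * q2 - a23 * (q2 * v - u * w)) + z2 * (a * q2 + a13 * (q2 * v - u * w)) - z3 * (a13 * q3 * w + a23 * q2 * q3)"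
  have "(y1 * a - y2 * q2 * a12 - y3 * (u * a12 + q3 * a13)) * (z1 * q1 * a13 + z2 * (w * a13 + q2 * a23) + z3 * (a + v * a13 + u * a23))
   - (y1 * q1 * a13 + y2 * (w * a13 + q2 * a23) + y3 * (a + v * a13 + u * a23)) * (z1 * a - z2 * q2 * a12 - z3 * (u * a12 + q3 * a13))
   = norm_ev a a12 a13 a23 * (y1 * z3 - y3 * z1)
     + ?t y1 y2 y3 * ?P z1 z2 z3 - ?t z1 z2 z3 * ?P y1 y2 y3"
    by (simp add: norm_ev_def algebra_simps power2_eq_square)
  then show ?B by (simp add: assms)
  let ?P = "\<lambda>z1 z2 z3. z2 * a12 * q1 * q2 + z3 * (a12 * q1 * u + a13 * q1 * q3) - z1 * a * q1"
  have "(y1 * q1 * a12 + y2 * (a + w * a12) + y3 * (v * a12 - q3 * a23)) * (z1 * q1 * a13 + z2 * (w * a13 + q2 * a23) + z3 * (a + v * a13 + u * a23))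
   - (y1 * q1 * a13 + y2 * (w * a13 + q2 * a23) + y3 * (a + v * a13 + u * a23)) * (z1 * q1 * a12 + z2 * (a + w * a12) + z3 * (v * a12 - q3 * a23))
   = norm_ev a a12 a13 a23 * (y2 * z3 - y3 * z2)
     + ?t y1 y2 y3 * ?P z1 z2 z3 - ?t z1 z2 z3 * ?P y1 y2 y3"
    by (simp add: norm_ev_def algebra_simps power2_eq_square)
  then show ?C by (simp add: assms)
qed

text \<open>As linear forms in y, the rows are the coefficient of \<open>e2 e3\<close>, minus that
  of \<open>e1 e3\<close>, and that of \<open>e1 e2\<close> in \<open>y * od x1 x2 x3 t\<close>: the
  determinant of the bivector part of right multiplication.\<close>

lemma norm_od_det:
  "det3 (q1 * t) (x3 + w * t) (v * t - x2) (- x3) (q2 * t) (x1 + u * t) x2 (- x1) (q3 * t)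
     = t * norm_od x1 x2 x3 t"
  by (simp add: det3_def norm_od_def Q_def algebra_simps power2_eq_square)

text \<open>By \<open>norm_ev_minor\<close> the norm divides the minors of the contractions, among
  which are the squares of \<open>a12\<close>, \<open>a13\<close>, \<open>a23\<close>. A prime
  dividing the norm then divides these coefficients and, by the formula for the norm, also
  \<open>a\<close>, against primitivity.\<close>

lemma primitive_norm_ev:
  assumes prim: "\<And>p. Factorial_Ring.prime p \<Longrightarrow> \<not> (p dvd a \<and> p dvd a12 \<and> p dvd a13 \<and> p dvd a23)"
    and quot: "\<And>l1 l2 l3. \<exists>y1 y2 y3. vec y1 y2 y3 * ev a a12 a13 a23 =
      vec (a12 * l2 + a13 * l3) (a23 * l3 - a12 * l1) (- a13 * l1 - a23 * l2)"
  shows "\<bar>norm_ev a a12 a13 a23\<bar> = 1"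
proof -
  let ?N = "norm_ev a a12 a13 a23"
  \<comment> \<open>Instantiation follows the order of occurrence \<open>l2\<close>,
    \<open>l3\<close>, \<open>l1\<close>; so r, s and t belong to the coordinate forms
    \<open>l1\<close>, \<open>l2\<close> and \<open>l3\<close>.\<close>
  obtain r1 r2 r3 where "vec r1 r2 r3 * ev a a12 a13 a23 = vec 0 (- a12) (- a13)"
    using quot[of 0 0 1] by auto
  then have r: "r1 * a23 - r2 * a13 + r3 * a12 = 0"
     "r1 * a - r2 * q2 * a12 - r3 * (u * a12 + q3 * a13) = 0"
     "r1 * q1 * a12 + r2 * (a + w * a12) + r3 * (v * a12 - q3 * a23) = - a12"
     "r1 * q1 * a13 + r2 * (w * a13 + q2 * a23) + r3 * (a + v * a13 + u * a23) = - a13"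
    unfolding ev_def vec_mult_cl unfolding vec_cl cl_inject by simp_all
  obtain s1 s2 s3 where "vec s1 s2 s3 * ev a a12 a13 a23 = vec a12 0 (- a23)"
    using quot[of 1 0 0] by auto
  then have s: "s1 * a23 - s2 * a13 + s3 * a12 = 0"
     "s1 * a - s2 * q2 * a12 - s3 * (u * a12 + q3 * a13) = a12"
     "s1 * q1 * a12 + s2 * (a + w * a12) + s3 * (v * a12 - q3 * a23) = 0"
     "s1 * q1 * a13 + s2 * (w * a13 + q2 * a23) + s3 * (a + v * a13 + u * a23) = - a23"
    unfolding ev_def vec_mult_cl unfolding vec_cl cl_inject by simp_all
  obtain t1 t2 t3 where "vec t1 t2 t3 * ev a a12 a13 a23 = vec a13 a23 0"
    using quot[of 0 1 0] by auto
  then have t: "t1 * a23 - t2 * a13 + t3 * a12 = 0"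
     "t1 * a - t2 * q2 * a12 - t3 * (u * a12 + q3 * a13) = a13"
     "t1 * q1 * a12 + t2 * (a + w * a12) + t3 * (v * a12 - q3 * a23) = a23"
     "t1 * q1 * a13 + t2 * (w * a13 + q2 * a23) + t3 * (a + v * a13 + u * a23) = 0"
    unfolding ev_def vec_mult_cl unfolding vec_cl cl_inject by simp_all
  have "?N * (r1 * s2 - r2 * s1) = a12\<^sup>2"
    using norm_ev_minor(1)[OF r(1) s(1), of a, unfolded r s] by (simp add: power2_eq_square)
  then have d12: "?N dvd a12\<^sup>2" by (metis dvd_triv_left)
  have "?N * (r1 * t3 - r3 * t1) = a13\<^sup>2"
    using norm_ev_minor(2)[OF r(1) t(1), of a, unfolded r t] by (simp add: power2_eq_square)
  then have d13: "?N dvd a13\<^sup>2" by (metis dvd_triv_left)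
  have "?N * (s2 * t3 - s3 * t2) = a23\<^sup>2"
    using norm_ev_minor(3)[OF s(1) t(1), of a, unfolded s t] by (simp add: power2_eq_square)
  then have d23: "?N dvd a23\<^sup>2" by (metis dvd_triv_left)
  show ?thesis
  proof (rule ccontr)
    assume "\<bar>?N\<bar> \<noteq> 1"
    then obtain p where p: "Factorial_Ring.prime p" "p dvd ?N"
      using prime_factor_int by blast
    with d12 d13 d23 have d: "p dvd a12" "p dvd a13" "p dvd a23"
      by (meson dvd_trans prime_dvd_power)+
    moreover have "p dvd a"
    proof -
      have "a\<^sup>2 = ?N - (a12 * (a * w + q1 * q2 * a12 + q1 * u * a13 + (u * w - v * q2) * a23)
          + a13 * (a * v + q1 * q3 * a13 + q3 * w * a23) + a23 * (a * u + q2 * q3 * a23))"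
        by (simp add: norm_ev_def algebra_simps power2_eq_square)
      then have "p dvd a\<^sup>2"
        using p(2) d by (simp add: dvd_diff dvd_add)
      then show ?thesis
        using p(1) prime_dvd_power by blast
    qed
    ultimately show False
      using prim p(1) by blast
  qed
qed

lemma det3_mult:
  "det3 x1 x2 x3 y1 y2 y3 z1 z2 z3 * det3 a1 a2 a3 b1 b2 b3 c1 c2 c3 =
   det3 (x1 * a1 + x2 * b1 + x3 * c1) (x1 * a2 + x2 * b2 + x3 * c2) (x1 * a3 + x2 * b3 + x3 * c3)
        (y1 * a1 + y2 * b1 + y3 * c1) (y1 * a2 + y2 * b2 + y3 * c2) (y1 * a3 + y2 * b3 + y3 * c3)
        (z1 * a1 + z2 * b1 + z3 * c1) (z1 * a2 + z2 * b2 + z3 * c2) (z1 * a3 + z2 * b3 + z3 * c3)"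
  by (simp add: det3_def algebra_simps)

text \<open>The bivector parts of the three coordinate contractions are \<open>t\<close> times a
  basis, so \<open>norm_od_det\<close> gives N | t^2. A prime p dividing N then divides
  \<open>t\<close> and Q(x). Modulo p the bivector part of y \<alpha> is that of y x, so y is
  parallel to x; the scalar part then gives x_i^2 = y_i Q(x) = 0 modulo p for the i-th coordinate
  form.\<close>

lemma primitive_norm_od:
  assumes prim: "\<And>p. Factorial_Ring.prime p \<Longrightarrow> \<not> (p dvd x1 \<and> p dvd x2 \<and> p dvd x3 \<and> p dvd t)"
    and quot: "\<And>l1 l2 l3. \<exists>y1 y2 y3. vec y1 y2 y3 * od x1 x2 x3 t =
      ev (l1 * x1 + l2 * x2 + l3 * x3) (t * l3) (- t * l2) (t * l1)"
  shows "\<bar>norm_od x1 x2 x3 t\<bar> = 1"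
proof -
  let ?N = "norm_od x1 x2 x3 t"
  have rel: "y1 * q1 * x1 + y2 * (w * x1 + q2 * x2) + y3 * (v * x1 + u * x2 + q3 * x3) = c"
    "y1 * x2 - y2 * x1 + y3 * q3 * t = c12"
    "y1 * x3 - y2 * q2 * t - y3 * (x1 + u * t) = c13"
    "y1 * q1 * t + y2 * (x3 + w * t) + y3 * (v * t - x2) = c23"
    if "vec y1 y2 y3 * od x1 x2 x3 t = ev c c12 c13 c23" for y1 y2 y3 c c12 c13 c23
    using that unfolding od_def ev_def vec_mult_cl cl_inject by simp_all
  obtain r1 r2 r3 where "vec r1 r2 r3 * od x1 x2 x3 t = ev x1 0 0 t"
    using quot[of 1 0 0] by auto
  note r = rel[OF this]
  obtain s1 s2 s3 where "vec s1 s2 s3 * od x1 x2 x3 t = ev x2 0 (- t) 0"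
    using quot[of 0 1 0] by auto
  note s = rel[OF this]
  obtain z1 z2 z3 where "vec z1 z2 z3 * od x1 x2 x3 t = ev x3 t 0 0"
    using quot[of 0 0 1] by auto
  note z = rel[OF this]
  have e: "(q1 * t) * y1 + (x3 + w * t) * y2 + (v * t - x2) * y3 = y1 * q1 * t + y2 * (x3 + w * t) + y3 * (v * t - x2)"
    "(- x3) * y1 + (q2 * t) * y2 + (x1 + u * t) * y3 = - (y1 * x3 - y2 * q2 * t - y3 * (x1 + u * t))"
    "x2 * y1 + (- x1) * y2 + (q3 * t) * y3 = y1 * x2 - y2 * x1 + y3 * q3 * t" for y1 y2 y3
    by (simp_all add: algebra_simps)
  have "t * ?N * det3 r1 s1 z1 r2 s2 z2 r3 s3 z3 = det3 t 0 0 0 t 0 0 0 t"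
    unfolding norm_od_det[symmetric] det3_mult e r s z by simp
  also have "\<dots> = t * t\<^sup>2"
    by (simp add: det3_def power2_eq_square)
  finally have "t = 0 \<or> ?N * det3 r1 s1 z1 r2 s2 z2 r3 s3 z3 = t\<^sup>2"
    by (auto simp: mult.assoc)
  then have dt: "?N dvd t\<^sup>2" by (metis dvd_0_right dvd_triv_left zero_power2)
  show ?thesis
  proof (rule ccontr)
    assume "\<bar>?N\<bar> \<noteq> 1"
    then obtain p where p: "Factorial_Ring.prime p" "p dvd ?N"
      using prime_factor_int by blast
    with dt have pt: "p dvd t"
      by (meson dvd_trans prime_dvd_power)
    have "Q x1 x2 x3 = ?N - t * (q1 * u * x1 + (u * w - q2 * v) * x2 + q3 * w * x3 + q1 * q2 * q3 * t)"
      by (simp add: norm_od_def algebra_simps power2_eq_square)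
    then have pQ: "p dvd Q x1 x2 x3"
      using p(2) pt by (metis dvd_diff dvd_mult2)
    \<comment> \<open>Modulo \<open>t\<close> the product is one of two vectors, whose bivector part
      consists of the minors of y and x.\<close>
    have minor: "p dvd y1 * x2 - y2 * x1" "p dvd y1 * x3 - y3 * x1" "p dvd y2 * x3 - y3 * x2"
      if "vec y1 y2 y3 * od x1 x2 x3 t = ev c (t * c12) (t * c13) (t * c23)" for y1 y2 y3 c c12 c13 c23
    proof -
      note y = rel[OF that]
      have "y1 * x2 - y2 * x1 = t * (c12 - y3 * q3)"
        "y1 * x3 - y3 * x1 = t * (c13 + y2 * q2 + y3 * u)"
        "y2 * x3 - y3 * x2 = t * (c23 - y1 * q1 - y2 * w - y3 * v)"
        using y by (simp_all add: algebra_simps)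
      with pt show "p dvd y1 * x2 - y2 * x1" "p dvd y1 * x3 - y3 * x1" "p dvd y2 * x3 - y3 * x2"
        by simp_all
    qed
    have "p dvd x1"
    proof -
      have "p dvd r1 * x2 - r2 * x1" "p dvd r1 * x3 - r3 * x1" "p dvd r2 * x3 - r3 * x2"
        using minor[of r1 r2 r3 x1 0 0 1] \<open>vec r1 r2 r3 * _ = _\<close> by simp_all
      moreover have "x1 * (r1 * q1 * x1 + r2 * (w * x1 + q2 * x2) + r3 * (v * x1 + u * x2 + q3 * x3)) = r1 * Q x1 x2 x3 - (r1 * x2 - r2 * x1) * (w * x1 + q2 * x2)
          - (r1 * x3 - r3 * x1) * (v * x1 + u * x2 + q3 * x3)"
        by (simp add: Q_def algebra_simps power2_eq_square)
      ultimately have "p dvd x1\<^sup>2" using pQ unfolding r(1) by (simp add: power2_eq_square)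
      then show ?thesis using p(1) prime_dvd_power by blast
    qed
    moreover have "p dvd x2"
    proof -
      have "p dvd s1 * x2 - s2 * x1" "p dvd s1 * x3 - s3 * x1" "p dvd s2 * x3 - s3 * x2"
        using minor[of s1 s2 s3 x2 0 "-1" 0] \<open>vec s1 s2 s3 * _ = _\<close> by simp_all
      moreover have "x2 * (s1 * q1 * x1 + s2 * (w * x1 + q2 * x2) + s3 * (v * x1 + u * x2 + q3 * x3)) = s2 * Q x1 x2 x3 + (s1 * x2 - s2 * x1) * (q1 * x1)
          - (s2 * x3 - s3 * x2) * (v * x1 + u * x2 + q3 * x3)"
        by (simp add: Q_def algebra_simps power2_eq_square)
      ultimately have "p dvd x2\<^sup>2" using pQ unfolding s(1) by (simp add: power2_eq_square)
      then show ?thesis using p(1) prime_dvd_power by blast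
    qed
    moreover have "p dvd x3"
    proof -
      have "p dvd z1 * x2 - z2 * x1" "p dvd z1 * x3 - z3 * x1" "p dvd z2 * x3 - z3 * x2"
        using minor[of z1 z2 z3 x3 1 0 0] \<open>vec z1 z2 z3 * _ = _\<close> by simp_all
      moreover have "x3 * (z1 * q1 * x1 + z2 * (w * x1 + q2 * x2) + z3 * (v * x1 + u * x2 + q3 * x3)) = z3 * Q x1 x2 x3 + (z1 * x3 - z3 * x1) * (q1 * x1)
          + (z2 * x3 - z3 * x2) * (w * x1 + q2 * x2)"
        by (simp add: Q_def algebra_simps power2_eq_square)
      ultimately have "p dvd x3\<^sup>2" using pQ unfolding z(1) by (simp add: power2_eq_square)
      then show ?thesis using p(1) prime_dvd_power by blast
    qed
    ultimately show False
      using prim p(1) pt by blast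
  qed
qed

end

section \<open>Coordinates on a ternary lattice\<close>

text \<open>\<open>basis_choice\<close> ties the coordinates to the very basis used by
  \<open>lattice_det\<close>, so that determinants can be computed in them.\<close>

locale ternary_lattice = ternary_form q1 q2 q3 u v w for q1 q2 q3 u v w +
  fixes b :: "'a::ab_group_add \<Rightarrow> 'a \<Rightarrow> int" and e1 e2 e3 :: 'a
  assumes sym: "b x y = b y x"
    and add_left: "b (x + y) z = b x z + b y z"
    and even_square: "even (b x x)"
    and nondegenerate: "(\<And>y. b x y = 0) \<Longrightarrow> x = 0"
    and basis: "zbasis {e1, e2, e3}" "distinct [e1, e2, e3]"
    and basis_choice: "(SOME B :: 'a set. zbasis B) = {e1, e2, e3}"
    and gram: "b e1 e1 = 2 * q1" "b e2 e2 = 2 * q2" "b e3 e3 = 2 * q3"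
      "b e2 e3 = u" "b e1 e3 = v" "b e1 e2 = w"
begin

abbreviation B :: "'a set" where "B \<equiv> {e1, e2, e3}"

definition "X1 x = zmod.representation B x e1"
definition "X2 x = zmod.representation B x e2"
definition "X3 x = zmod.representation B x e3"

definition comb :: "int \<Rightarrow> int \<Rightarrow> int \<Rightarrow> 'a" where
  "comb x1 x2 x3 = zmult x1 e1 + zmult x2 e2 + zmult x3 e3"

lemma independent: "zmod.independent B" and span: "zmod.span B = UNIV"
  using basis(1) by (simp_all add: zbasis_def)

lemma distinct_basis [simp]: "e1 \<noteq> e2" "e1 \<noteq> e3" "e2 \<noteq> e3" "e2 \<noteq> e1" "e3 \<noteq> e1" "e3 \<noteq> e2"
  using basis(2) by auto

lemma comb_coords [simp]: "comb (X1 x) (X2 x) (X3 x) = x"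
proof -
  have "(\<Sum>y\<in>B. zmult (zmod.representation B x y) y) = x"
    by (rule zmod.sum_representation_eq) (simp_all add: independent span)
  then show ?thesis by (simp add: comb_def X1_def X2_def X3_def add.assoc)
qed

lemma coords_add [simp]: "X1 (x + y) = X1 x + X1 y" "X2 (x + y) = X2 x + X2 y" "X3 (x + y) = X3 x + X3 y"
  by (simp_all add: X1_def X2_def X3_def zmod.representation_add independent span)

lemma coords_zmult [simp]:
  "X1 (zmult n x) = n * X1 x" "X2 (zmult n x) = n * X2 x" "X3 (zmult n x) = n * X3 x"
  by (simp_all add: X1_def X2_def X3_def zmod.representation_scale independent span)

lemma coords_basis [simp]:
  "X1 e1 = 1" "X2 e1 = 0" "X3 e1 = 0" "X1 e2 = 0" "X2 e2 = 1" "X3 e2 = 0" "X1 e3 = 0" "X2 e3 = 0" "X3 e3 = 1"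
  by (simp_all add: X1_def X2_def X3_def zmod.representation_basis independent)

lemma coords_comb [simp]: "X1 (comb x1 x2 x3) = x1" "X2 (comb x1 x2 x3) = x2" "X3 (comb x1 x2 x3) = x3"
  by (simp_all add: comb_def)

lemma coords_0 [simp]: "X1 0 = 0" "X2 0 = 0" "X3 0 = 0"
  using coords_add[of 0 0] by simp_all

lemma coords_eqI: "X1 x = X1 y \<Longrightarrow> X2 x = X2 y \<Longrightarrow> X3 x = X3 y \<Longrightarrow> x = y"
  by (metis comb_coords)

lemma zmult_cancel: "n \<noteq> 0 \<Longrightarrow> zmult n x = zmult n y \<longleftrightarrow> x = (y :: 'a)"
  by (metis coords_eqI coords_zmult mult_cancel_left)

lemma add_right: "b x (y + z) = b x y + b x z"
  by (metis add_left sym)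

lemma zmult_left: "b (zmult n x) y = n * b x y"
  using zmult_additive[of "\<lambda>x. b x y" n x] by (simp add: additive_def add_left zmult_int)

lemma zmult_right: "b x (zmult n y) = n * b x y"
  by (metis sym zmult_left)

abbreviation "D1 y \<equiv> dual1 (X1 y) (X2 y) (X3 y)"
abbreviation "D2 y \<equiv> dual2 (X1 y) (X2 y) (X3 y)"
abbreviation "D3 y \<equiv> dual3 (X1 y) (X2 y) (X3 y)"

lemma dual_basis: "D1 y = b e1 y" "D2 y = b e2 y" "D3 y = b e3 y"
proof -
  have "b x y = X1 y * b x e1 + X2 y * b x e2 + X3 y * b x e3" for x
    by (subst comb_coords[of y, symmetric], unfold comb_def) (simp add: add_right zmult_right)
  then show "D1 y = b e1 y" "D2 y = b e2 y" "D3 y = b e3 y"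
    using gram sym[of e2 e1] sym[of e3 e1] sym[of e3 e2]
    by (simp_all add: dual1_def dual2_def dual3_def)
qed

lemma form_coords: "b x y = X1 x * b e1 y + X2 x * b e2 y + X3 x * b e3 y"
  by (subst comb_coords[of x, symmetric], unfold comb_def) (simp add: add_left zmult_left)

lemma form_square: "b x x = 2 * Q (X1 x) (X2 x) (X3 x)"
  unfolding form_coords[of x x] dual_basis[symmetric]
  by (simp add: Q_def dual1_def dual2_def dual3_def algebra_simps power2_eq_square)

definition \<gamma> :: "'a \<Rightarrow> ext_endo" where "\<gamma> x = vec (X1 x) (X2 x) (X3 x)"

lemma gamma_add: "\<gamma> (x + y) = \<gamma> x + \<gamma> y"
  by (simp add: \<gamma>_def vec_add)

lemma gamma_zmult: "\<gamma> (zmult n x) = of_int n * \<gamma> x"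
  by (simp add: \<gamma>_def vec_scale)

lemma gamma_diff: "\<gamma> (x - y) = \<gamma> x - \<gamma> y"
  using gamma_add[of "x - y" y] by simp

lemma gamma_0 [simp]: "\<gamma> 0 = 0"
  using gamma_add[of 0 0] by simp

lemma gamma_square: "\<gamma> x * \<gamma> x = of_int (b x x div 2)"
  by (simp add: \<gamma>_def vec_square form_square)

lemma gamma_anticommutator: "\<gamma> x * \<gamma> y + \<gamma> y * \<gamma> x = of_int (b x y)"
proof -
  have "b (x + y) (x + y) div 2 = b x x div 2 + b y y div 2 + b x y"
    using even_square[of x] even_square[of y] sym[of y x] by (simp add: add_left add_right)
  then have "\<gamma> (x + y) * \<gamma> (x + y) = \<gamma> x * \<gamma> x + \<gamma> y * \<gamma> y + of_int (b x y)"
    by (simp add: gamma_square)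
  then show ?thesis
    by (simp add: gamma_add algebra_simps)
qed

lemma vec_gamma: "vec x1 x2 x3 = \<gamma> (comb x1 x2 x3)"
  by (simp add: \<gamma>_def)

lemma gamma_inject [simp]: "\<gamma> x = \<gamma> y \<longleftrightarrow> x = y"
  unfolding \<gamma>_def vec_cl cl_inject by (auto intro: coords_eqI)

lemma gamma_in_Odd [intro, simp]: "\<gamma> x \<in> Odd"
  by (simp add: \<gamma>_def)

lemma gamma_in_range [intro, simp]: "\<gamma> x \<in> range cl"
  by (rule Odd_in_range) simp

lemma star_gamma [simp]: "star (\<gamma> x) = \<gamma> x"
  by (simp add: \<gamma>_def)

text \<open>The adjugate replaces a rank argument over \<rat>: if the determinant vanishes, its
  first column pairs to zero with everything and so is zero, which makes two rows of the Gram matrix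
  proportional.\<close>

lemma disc_nonzero: "disc \<noteq> 0"
proof
  assume "disc = 0"
  define y where "y = comb (4 * q2 * q3 - u\<^sup>2) (u * v - 2 * q3 * w) (u * w - 2 * q2 * v)"
  have "D1 y = disc" "D2 y = 0" "D3 y = 0"
    by (simp_all add: y_def dual1_def dual2_def dual3_def disc_def algebra_simps power2_eq_square)
  then have "b y z = 0" for z
    using form_coords[of z y] dual_basis[of y] \<open>disc = 0\<close> sym[of y z] by simp
  then have "y = 0"
    by (rule nondegenerate)
  then have z: "4 * q2 * q3 - u\<^sup>2 = 0" "u * v - 2 * q3 * w = 0" "u * w - 2 * q2 * v = 0"
    unfolding y_def by (metis coords_comb coords_0)+
  \<comment> \<open>the rows of the Gram matrix belonging to \<open>e2\<close> and \<open>e3\<close> are proportional\<close>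
  have *: "k = 0 \<and> l = 0" if "k * w = l * v" "k * (2 * q2) = l * u" "k * u = l * (2 * q3)" for k l
  proof -
    have "b (comb 0 k (- l)) z = 0" for z
    proof -
      have "b (comb 0 k (- l)) z = (k * w - l * v) * X1 z + (k * (2 * q2) - l * u) * X2 z
          + (k * u - l * (2 * q3)) * X3 z"
        unfolding form_coords[of "comb 0 k (- l)"] dual_basis[symmetric] coords_comb
        by (simp add: dual1_def dual2_def dual3_def algebra_simps)
      then show ?thesis by (simp add: that)
    qed
    then have "comb 0 k (- l) = 0"
      by (rule nondegenerate)
    then have "k = 0" "- l = 0"
      by (metis coords_comb coords_0)+
    then show ?thesis by simp
  qed
  \<comment> \<open>The pairs (k, l) are the columns of the two proportional rows, with k from the
    row of \<open>e3\<close>. They show that this row vanishes, which contradicts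
    nondegeneracy.\<close>
  have "v = 0" using *[of v w] z by (simp add: algebra_simps)
  moreover have "u = 0" using *[of u "2 * q2"] z by (simp add: algebra_simps power2_eq_square)
  moreover have "2 * q3 = 0" using *[of "2 * q3" u] z by (simp add: algebra_simps power2_eq_square)
  ultimately show False
    using *[of 0 1] by simp
qed

lemma dual_vector:
  obtains y where "b e1 y = disc * l1" "b e2 y = disc * l2" "b e3 y = disc * l3"
proof -
  obtain y1 y2 y3 where "dual1 y1 y2 y3 = disc * l1" "dual2 y1 y2 y3 = disc * l2" "dual3 y1 y2 y3 = disc * l3"
    by (rule dual_vector_exists)
  then show thesis
    using that[of "comb y1 y2 y3"] by (simp add: dual_basis[symmetric])
qed

end

section \<open>The free ring and its quotients\<close>

lemma ring_of_type_algebra_simps [simp]: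
  "carrier (ring_of_type_algebra :: 'r::ring_1 ring) = UNIV"
  "monoid.mult (ring_of_type_algebra :: 'r ring) x y = x * y"
  "one (ring_of_type_algebra :: 'r ring) = 1"
  "ring.zero (ring_of_type_algebra :: 'r ring) = 0"
  "add (ring_of_type_algebra :: 'r ring) x y = x + y"
  by (simp_all add: ring_of_type_algebra_def)

lemma ring_ring_of_type_algebra [intro, simp]: "ring (ring_of_type_algebra :: 'r::ring_1 ring)"
proof -
  have "\<exists>y. y + x = 0" for x :: 'r
    using add.left_inverse by blast
  then show ?thesis
    by (intro ringI abelian_groupI monoidI) (auto simp: algebra_simps)
qed

lemma a_minus_ring_of_type_algebra [simp]:
  "a_inv (ring_of_type_algebra :: 'r::ring_1 ring) x = - x"
  "a_minus (ring_of_type_algebra :: 'r ring) x y = x - y"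
proof -
  interpret R: ring "ring_of_type_algebra :: 'r ring" by simp
  show "a_inv (ring_of_type_algebra :: 'r ring) x = - x" for x
    using R.minus_equality[of "- x" x] by simp
  then show "a_minus (ring_of_type_algebra :: 'r ring) x y = x - y"
    by (simp add: a_minus_def)
qed

lemma add_pow_ring_of_type_algebra:
  "add_pow (ring_of_type_algebra :: 'r::ring_1 ring) (n :: int) 1 = of_int n"
proof -
  interpret R: ring "ring_of_type_algebra :: 'r ring" by simp
  have nat: "add_pow (ring_of_type_algebra :: 'r ring) (k :: nat) 1 = of_nat k" for k
    by (induction k) (simp_all add: add.commute)
  show ?thesis
  proof (cases "0 \<le> n")
    case True
    then show ?thesis by (simp add: add_pow_int_ge nat)
  next
    case False
    then show ?thesis by (simp add: add_pow_int_lt nat)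
  qed
qed

lemma (in ring_hom_ring) hom_add_pow_int:
  assumes "x \<in> carrier R"
  shows "h (add_pow R (n :: int) x) = add_pow S n (h x)"
  using group_hom.hom_int_pow[OF a_group_hom, of x n] assms by (simp add: add_pow_def)

lemma (in ring_hom_ring) hom_a_minus:
  assumes "x \<in> carrier R" "y \<in> carrier R"
  shows "h (x \<ominus> y) = h x \<ominus>\<^bsub>S\<^esub> h y"
  using assms by (simp add: a_minus_def)

text \<open>The universal property of the quotient. The lift picks a representative of each coset;
  two choices differ by an element of the ideal, on which \<open>f\<close> vanishes.\<close>

lemma (in ideal) quotient_hom_lift:
  assumes "ring S" "f \<in> ring_hom R S" "\<And>x. x \<in> I \<Longrightarrow> f x = \<zero>\<^bsub>S\<^esub>"
  obtains g where "g \<in> ring_hom (R Quot I) S" "\<And>x. x \<in> carrier R \<Longrightarrow> g (I +> x) = f x"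
proof -
  interpret f: ring_hom_ring R S f
    using assms(1,2) by (simp add: ring_hom_ringI2 ring_axioms)
  define g where "g A = f (SOME x. x \<in> A)" for A
  have g: "g (I +> x) = f x" if x: "x \<in> carrier R" for x
  proof -
    have "x \<in> I +> x"
      using x by (rule a_rcos_self)
    then have "(SOME y. y \<in> I +> x) \<in> I +> x"
      by (rule someI)
    then obtain i where i: "i \<in> I" "(SOME y. y \<in> I +> x) = i \<oplus> x"
      unfolding a_r_coset_def' by blast
    have "f (i \<oplus> x) = f i \<oplus>\<^bsub>S\<^esub> f x"
      by (rule f.hom_add[OF Icarr[OF i(1)] x])
    then show ?thesis
      using x assms(3)[OF i(1)] by (simp add: g_def i(2))
  qed
  have car: "\<exists>x\<in>carrier R. A = I +> x" if "A \<in> carrier (R Quot I)" for A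
    using that unfolding FactRing_def A_RCOSETS_def' by auto
  have "g \<in> ring_hom (R Quot I) S"
  proof (rule ring_hom_memI)
    fix A assume "A \<in> carrier (R Quot I)"
    then show "g A \<in> carrier S" using car g f.hom_closed by metis
  next
    fix A A' assume "A \<in> carrier (R Quot I)" "A' \<in> carrier (R Quot I)"
    then obtain x y where xy: "x \<in> carrier R" "y \<in> carrier R" "A = I +> x" "A' = I +> y"
      using car by meson
    have "A \<otimes>\<^bsub>R Quot I\<^esub> A' = I +> (x \<otimes> y)" "A \<oplus>\<^bsub>R Quot I\<^esub> A' = I +> (x \<oplus> y)"
      using xy ring_hom_mult[OF rcos_ring_hom, of x y] ring_hom_add[OF rcos_ring_hom, of x y] by metis+
    then show "g (A \<otimes>\<^bsub>R Quot I\<^esub> A') = g A \<otimes>\<^bsub>S\<^esub> g A'" "g (A \<oplus>\<^bsub>R Quot I\<^esub> A') = g A \<oplus>\<^bsub>S\<^esub> g A'"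
      using xy g f.hom_mult f.hom_add m_closed a_closed by metis+
  next
    show "g \<one>\<^bsub>R Quot I\<^esub> = \<one>\<^bsub>S\<^esub>"
      using g[OF one_closed] ring_hom_one[OF rcos_ring_hom] f.hom_one by metis
  qed
  with g that show thesis by blast
qed

section \<open>Induction, evaluation and reversal on the free ring\<close>

lemma free_ring_induct [case_names word diff]:
  assumes "\<And>w. P (Poly_Mapping.single w 1)" "\<And>p q. P p \<Longrightarrow> P q \<Longrightarrow> P (p - q)"
  shows "P (p :: 'a free_ring)"
proof (rule frag_induction[where S = UNIV and P = P])
  show "P 0" using assms(2)[OF assms(1) assms(1), of undefined undefined] by simp
  show "P (Poly_Mapping.single w 1)" for w by (rule assms(1))
  show "P (p - q)" if "P p" "P q" for p q using that by (rule assms(2))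
qed simp

lemma single_Nil: "Poly_Mapping.single (Word []) 1 = (1 :: 'a free_ring)"
  by (simp flip: zero_word_def)

lemma single_Cons: "Poly_Mapping.single (Word (x # xs)) 1 = free_gen x * (Poly_Mapping.single (Word xs) 1 :: 'a free_ring)"
  by (simp add: free_gen_def mult_single plus_word_def)

definition free_eval :: "('a \<Rightarrow> 'r::ring_1) \<Rightarrow> 'a free_ring \<Rightarrow> 'r" where
  "free_eval f p = (\<Sum>w\<in>Poly_Mapping.keys p. of_int (Poly_Mapping.lookup p w) * prod_list (map f (letters w)))"

lemma free_eval_add: "free_eval f (p + q) = free_eval f p + free_eval f q"
  unfolding free_eval_def
  by (rule setsum_keys_plus_distrib[of "\<lambda>w c. of_int c * prod_list (map f (letters w))"])
    (simp_all add: distrib_right)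

lemma free_eval_diff: "free_eval f (p - q) = free_eval f p - free_eval f q"
  using free_eval_add[of f "p - q" q] by simp

lemma free_eval_word: "free_eval f (Poly_Mapping.single w 1) = prod_list (map f (letters w))"
  by (simp add: free_eval_def)

lemma free_eval_1: "free_eval f 1 = 1"
  using free_eval_word[of f "Word []"] by (simp add: single_Nil)

lemma free_eval_gen: "free_eval f (free_gen x) = f x"
  by (simp add: free_gen_def free_eval_word)

lemma free_eval_mult: "free_eval f (p * q) = free_eval f p * free_eval f q"
proof (induction p rule: free_ring_induct)
  case (word v)
  show ?case
    by (induction q rule: free_ring_induct)
      (simp_all add: mult_single free_eval_word plus_word_def right_diff_distrib free_eval_diff)
qed (simp add: left_diff_distrib free_eval_diff)

lemma free_eval_of_int: "free_eval f (of_int n) = of_int n"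
proof (induction n rule: int_induct[where k = 0])
  case base
  show ?case using free_eval_diff[of f 0 0] by simp
qed (simp_all add: free_eval_add free_eval_diff free_eval_1)

lemma word_rev_word_rev [simp]: "word_rev (word_rev w) = w"
  by (cases w) (simp add: word_rev_def)

lemma inj_word_rev: "inj word_rev"
  by (metis injI word_rev_word_rev)

lemma word_rev_plus: "word_rev (v + w) = word_rev w + word_rev v"
  by (simp add: word_rev_def plus_word_def)

text \<open>\<open>Poly_Mapping.map_key\<close> pulls coefficients back along
  \<open>word_rev\<close>; since this is an involution, pulling back agrees with pushing words
  forward.\<close>

lemma free_rev_word: "free_rev (Poly_Mapping.single w c) = Poly_Mapping.single (word_rev w) c"
  using map_key_single[OF inj_word_rev, of "word_rev w" c] by (simp add: free_rev_def)

lemma free_rev_add: "free_rev (p + q) = free_rev p + free_rev q"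
  by (simp add: free_rev_def map_key_plus[OF inj_word_rev])

lemma free_rev_diff: "free_rev (p - q) = free_rev p - free_rev q"
  using free_rev_add[of "p - q" q] by simp

lemma free_rev_free_rev [simp]: "free_rev (free_rev p) = p"
  by (induction p rule: free_ring_induct) (simp_all add: free_rev_word free_rev_diff)

lemma free_rev_mult: "free_rev (p * q) = free_rev q * (free_rev p :: 'a free_ring)"
proof (induction p rule: free_ring_induct)
  case (word v)
  show ?case
    by (induction q rule: free_ring_induct)
      (simp_all add: mult_single free_rev_word word_rev_plus right_diff_distrib left_diff_distrib free_rev_diff)
qed (simp add: left_diff_distrib right_diff_distrib free_rev_diff)

lemma free_rev_gen [simp]: "free_rev (free_gen x) = free_gen x"
  by (simp add: free_gen_def free_rev_word word_rev_def)

section \<open>The tensor algebra and the Clifford algebra as quotients\<close>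

lemma ideal_tensor_ideal: "ideal tensor_ideal (ring_of_type_algebra :: 'a::ab_group_add free_ring ring)"
  unfolding tensor_ideal_def by (rule ring.genideal_ideal) simp_all

lemma tensor_ideal_gen: "free_gen (v + w) - (free_gen v + free_gen w) \<in> tensor_ideal"
  unfolding tensor_ideal_def
  by (rule subsetD[OF ring.genideal_self]) auto

lemma ring_tensor_algebra: "ring tensor_algebra"
  unfolding tensor_algebra_def using ideal_tensor_ideal by (rule ideal.quotient_is_ring)

definition tensor_class :: "'a::ab_group_add free_ring \<Rightarrow> 'a free_ring set" where
  "tensor_class p = tensor_ideal +>\<^bsub>ring_of_type_algebra\<^esub> p"

lemma tensor_class_hom: "ring_hom_ring ring_of_type_algebra tensor_algebra tensor_class"
  using ideal.rcos_ring_hom_ring[OF ideal_tensor_ideal]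
  by (simp add: tensor_algebra_def tensor_class_def[abs_def])

lemma carrier_tensor_algebra: "carrier tensor_algebra = range tensor_class"
  by (auto simp: tensor_algebra_def FactRing_def A_RCOSETS_def' tensor_class_def)

lemma tensor_class_eq: "tensor_class p = {q. q - p \<in> tensor_ideal}"
proof -
  have "q \<in> tensor_class p \<longleftrightarrow> q - p \<in> tensor_ideal" for q
  proof
    assume "q - p \<in> tensor_ideal"
    moreover have "q = (q - p) + p" by simp
    ultimately show "q \<in> tensor_class p"
      unfolding tensor_class_def a_r_coset_def' ring_of_type_algebra_simps by blast
  qed (auto simp: tensor_class_def a_r_coset_def')
  then show ?thesis by blast
qed

text \<open>Reversal swaps left and right multiplication and fixes the defining generators, so the
  preimage of the two-sided ideal is again an ideal containing them.\<close>

lemma free_rev_tensor_ideal: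
  assumes "p \<in> tensor_ideal"
  shows "free_rev p \<in> (tensor_ideal :: 'a::ab_group_add free_ring set)"
proof -
  let ?R = "ring_of_type_algebra :: 'a free_ring ring"
  interpret I: ideal tensor_ideal ?R
    by (rule ideal_tensor_ideal)
  define K where "K = {p. free_rev p \<in> (tensor_ideal :: 'a free_ring set)}"
  have rev0: "free_rev (0 :: 'a free_ring) = 0"
    using free_rev_diff[of 0 0] by simp
  have zero: "0 \<in> (tensor_ideal :: 'a free_ring set)"
    using additive_subgroup.zero_closed[OF I.additive_subgroup_axioms] by simp
  have add: "p + q \<in> tensor_ideal" if "p \<in> tensor_ideal" "q \<in> tensor_ideal" for p q :: "'a free_ring"
    using additive_subgroup.a_closed[OF I.additive_subgroup_axioms that] by simp
  have neg: "- p \<in> tensor_ideal" if "p \<in> tensor_ideal" for p :: "'a free_ring"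
    using I.I_l_closed[OF that, of "- 1"] by simp
  have "ideal K ?R"
  proof (rule idealI)
    show "subgroup K (add_monoid ?R)"
    proof
      show "inv\<^bsub>add_monoid ?R\<^esub> p \<in> K" if "p \<in> K" for p
        using that neg[of "free_rev p"] free_rev_diff[of 0 p]
        unfolding a_minus_ring_of_type_algebra(1)[unfolded a_inv_def] by (simp add: K_def rev0)
    qed (simp_all add: K_def free_rev_add add rev0 zero)
    show "p \<otimes>\<^bsub>?R\<^esub> q \<in> K" if "q \<in> K" "p \<in> carrier ?R" for p q
      using I.I_r_closed[of "free_rev q" "free_rev p"] that by (simp add: K_def free_rev_mult)
    show "q \<otimes>\<^bsub>?R\<^esub> p \<in> K" if "q \<in> K" "p \<in> carrier ?R" for p q
      using I.I_l_closed[of "free_rev q" "free_rev p"] that by (simp add: K_def free_rev_mult)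
  qed simp
  then have "tensor_ideal \<subseteq> K"
    unfolding tensor_ideal_def
    by (rule I.genideal_minimal) (auto simp: K_def free_rev_diff free_rev_add tensor_ideal_gen)
  with assms show ?thesis by (auto simp: K_def)
qed

text \<open>One inclusion, applied also to the reversed coset, suffices because reversal is an
  involution.\<close>

lemma free_rev_tensor_class: "free_rev ` tensor_class p = tensor_class (free_rev p)"
proof -
  have "free_rev q \<in> tensor_class (free_rev p)" if "q \<in> tensor_class p" for p q :: "'a free_ring"
    using that free_rev_tensor_ideal[of "q - p"] by (simp add: tensor_class_eq free_rev_diff)
  note * = this
  show ?thesis
  proof (intro subset_antisym subsetI)
    fix q assume "q \<in> tensor_class (free_rev p)"
    then have "free_rev q \<in> tensor_class p"
      using *[of q "free_rev p"] by simp
    then have "free_rev (free_rev q) \<in> free_rev ` tensor_class p"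
      by (rule imageI)
    then show "q \<in> free_rev ` tensor_class p" by simp
  qed (use * in auto)
qed

text \<open>Recognises the generators of the Clifford ideal as classes of free ring elements: they
  lie in the carrier, and the relation can be handled with type-class operations.\<close>

lemma tensor_class_Clifford_relation:
  fixes v :: "'a::ab_group_add"
  shows "tensor_class (free_gen v * free_gen v - of_int n) =
    tensor_incl v \<otimes>\<^bsub>tensor_algebra\<^esub> tensor_incl v
        \<ominus>\<^bsub>tensor_algebra\<^esub> add_pow tensor_algebra n \<one>\<^bsub>tensor_algebra\<^esub>"
proof -
  interpret tensor_class: ring_hom_ring ring_of_type_algebra tensor_algebra
      "tensor_class :: 'a free_ring \<Rightarrow> _"
    by (rule tensor_class_hom)
  have "tensor_class (of_int n :: 'a free_ring) = add_pow tensor_algebra n \<one>\<^bsub>tensor_algebra\<^esub>"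
    using tensor_class.hom_add_pow_int[of 1 n] tensor_class.hom_one
    by (simp add: add_pow_ring_of_type_algebra)
  then show ?thesis
    using tensor_class.hom_a_minus[of "free_gen v * free_gen v" "of_int n"]
      tensor_class.hom_mult[of "free_gen v" "free_gen v"]
    by (simp add: tensor_incl_def flip: tensor_class_def)
qed

lemma ideal_clifford_ideal: "ideal (clifford_ideal b) tensor_algebra"
proof -
  interpret T: ring tensor_algebra by (rule ring_tensor_algebra)
  show ?thesis
    unfolding clifford_ideal_def
    by (rule T.genideal_ideal)
      (unfold tensor_class_Clifford_relation[symmetric] carrier_tensor_algebra, blast)
qed

lemma ring_clifford_algebra: "ring (clifford_algebra b)"
  unfolding clifford_algebra_def using ideal_clifford_ideal by (rule ideal.quotient_is_ring)

definition cl_class :: "('a::ab_group_add \<Rightarrow> 'a \<Rightarrow> int) \<Rightarrow> 'a free_ring \<Rightarrow> 'a clifford" where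
  "cl_class b p = clifford_ideal b +>\<^bsub>tensor_algebra\<^esub> tensor_class p"

lemma cl_class_hom: "ring_hom_ring ring_of_type_algebra (clifford_algebra b) (cl_class b)"
proof -
  have "(+>\<^bsub>tensor_algebra\<^esub>) (clifford_ideal b) \<in> ring_hom tensor_algebra (clifford_algebra b)"
    using ideal.rcos_ring_hom[OF ideal_clifford_ideal] by (simp add: clifford_algebra_def)
  then have "cl_class b \<in> ring_hom ring_of_type_algebra (clifford_algebra b)"
    using ring_hom_trans[OF ring_hom_ring.homh[OF tensor_class_hom]] by (simp add: comp_def cl_class_def[abs_def])
  then show ?thesis
    by (intro ring_hom_ringI2) (simp_all add: ring_clifford_algebra)
qed

lemma carrier_clifford_algebra: "carrier (clifford_algebra b) = range (cl_class b)"
  by (auto simp: clifford_algebra_def FactRing_def A_RCOSETS_def' cl_class_def carrier_tensor_algebra)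

lemma cl_class_gen: "cl_class b (free_gen x) = cl_incl b x"
  by (simp add: cl_class_def cl_incl_def tensor_incl_def tensor_class_def)

text \<open>\<open>cl_star\<close> is an image of sets on two levels, so computing it requires
  knowing which tensor cosets make up a Clifford element.\<close>

lemma in_cl_class_iff:
  fixes p :: "'a::ab_group_add free_ring"
  shows "t \<in> cl_class b p \<longleftrightarrow> (\<exists>q. t = tensor_class q \<and> cl_class b q = cl_class b p)"
proof -
  interpret I: ideal "clifford_ideal b" tensor_algebra
    by (rule ideal_clifford_ideal)
  have car: "tensor_class q \<in> carrier tensor_algebra" for q :: "'a free_ring"
    by (simp add: carrier_tensor_algebra)
  have "cl_class b p \<subseteq> carrier tensor_algebra"
    unfolding cl_class_def by (rule I.a_r_coset_subset_G[OF I.a_subset car])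
  then have 1: "\<exists>q. t = tensor_class q" if "t \<in> cl_class b p"
    using that carrier_tensor_algebra by blast
  have 2: "cl_class b q = cl_class b p" if "tensor_class q \<in> cl_class b p" for q
    using I.a_repr_independence'[OF that[unfolded cl_class_def] car]
    unfolding cl_class_def by (rule sym)
  have 3: "tensor_class q \<in> cl_class b q" for q
    unfolding cl_class_def by (rule I.a_rcos_self[OF car])
  show ?thesis
    using 1 2 3 by metis
qed

lemma cl_class_eq_zero:
  assumes "tensor_class p \<in> clifford_ideal b"
  shows "cl_class b p = \<zero>\<^bsub>clifford_algebra b\<^esub>"
proof -
  interpret T: ring tensor_algebra by (rule ring_tensor_algebra)
  show ?thesis
    using T.a_rcos_zero[OF ideal_clifford_ideal assms]
    by (simp add: cl_class_def clifford_algebra_def FactRing_def)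
qed

lemma cl_class_additive: "cl_class b (free_gen (x + y) - (free_gen x + free_gen y)) = \<zero>\<^bsub>clifford_algebra b\<^esub>"
proof (rule cl_class_eq_zero)
  interpret R: ring "ring_of_type_algebra :: 'a free_ring ring" by simp
  have "tensor_class (free_gen (x + y) - (free_gen x + free_gen y)) = \<zero>\<^bsub>tensor_algebra\<^esub>"
    using R.a_rcos_zero[OF ideal_tensor_ideal tensor_ideal_gen]
    by (simp add: tensor_class_def tensor_algebra_def FactRing_def)
  then show "tensor_class (free_gen (x + y) - (free_gen x + free_gen y)) \<in> clifford_ideal b"
    using additive_subgroup.zero_closed[OF ideal.axioms(1)[OF ideal_clifford_ideal[of b]]] by simp
qed

lemma Clifford_relation_in_ideal: "tensor_class (free_gen v * free_gen v - of_int (b v v div 2)) \<in> clifford_ideal b"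
proof -
  interpret T: ring tensor_algebra by (rule ring_tensor_algebra)
  have "{tensor_incl v \<otimes>\<^bsub>tensor_algebra\<^esub> tensor_incl v
        \<ominus>\<^bsub>tensor_algebra\<^esub> add_pow tensor_algebra (b v v div 2) \<one>\<^bsub>tensor_algebra\<^esub> | v. True}
      \<subseteq> clifford_ideal b"
    unfolding clifford_ideal_def
    by (rule T.genideal_self)
      (unfold tensor_class_Clifford_relation[symmetric] carrier_tensor_algebra, blast)
  then show ?thesis
    unfolding tensor_class_Clifford_relation by blast
qed

lemma cl_class_relation: "cl_class b (free_gen v * free_gen v - of_int (b v v div 2)) = \<zero>\<^bsub>clifford_algebra b\<^esub>"
  by (rule cl_class_eq_zero) (rule Clifford_relation_in_ideal)

section \<open>The Clifford algebra is isomorphic to the model\<close>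

context ternary_lattice
begin

abbreviation "C \<equiv> clifford_algebra b"
abbreviation "\<Phi> \<equiv> free_eval \<gamma>"

sublocale C: ring C
  by (rule ring_clifford_algebra)

lemma class_hom:
  "cl_class b (p + q) = cl_class b p \<oplus>\<^bsub>C\<^esub> cl_class b q"
  "cl_class b (p * q) = cl_class b p \<otimes>\<^bsub>C\<^esub> cl_class b q"
  "cl_class b 1 = \<one>\<^bsub>C\<^esub>"
  "cl_class b 0 = \<zero>\<^bsub>C\<^esub>"
  "cl_class b (- p) = \<ominus>\<^bsub>C\<^esub> cl_class b p"
proof -
  interpret h: ring_hom_ring ring_of_type_algebra C "cl_class b"
    by (rule cl_class_hom)
  show "cl_class b (p + q) = cl_class b p \<oplus>\<^bsub>C\<^esub> cl_class b q"
    using h.hom_add[of p q] by simp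
  show "cl_class b (p * q) = cl_class b p \<otimes>\<^bsub>C\<^esub> cl_class b q"
    using h.hom_mult[of p q] by simp
  show "cl_class b 1 = \<one>\<^bsub>C\<^esub>"
    using h.hom_one by simp
  show "cl_class b 0 = \<zero>\<^bsub>C\<^esub>"
    using h.hom_zero by simp
  show "cl_class b (- p) = \<ominus>\<^bsub>C\<^esub> cl_class b p"
    using h.hom_a_inv[of p] by simp
qed

lemma class_closed [simp]: "cl_class b p \<in> carrier C"
  by (simp add: carrier_clifford_algebra)

text \<open>The kernel of the composite projection. It merges the two quotient steps, so that
  reductions take place in the free ring modulo J.\<close>

definition J :: "'a free_ring set" where
  "J = {p. cl_class b p = \<zero>\<^bsub>C\<^esub>}"

lemma J_closed:
  "p \<in> J \<Longrightarrow> q \<in> J \<Longrightarrow> p + q \<in> J"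
  "p \<in> J \<Longrightarrow> - p \<in> J"
  "p \<in> J \<Longrightarrow> r * p \<in> J"
  "p \<in> J \<Longrightarrow> p * r \<in> J"
  "0 \<in> J"
  by (simp_all add: J_def class_hom)

lemma J_diff: "p \<in> J \<Longrightarrow> q \<in> J \<Longrightarrow> p - q \<in> J"
  using J_closed(1)[of p "- q"] J_closed(2) by simp

lemma class_eq_iff_diff: "cl_class b p = cl_class b q \<longleftrightarrow> p - q \<in> J"
proof -
  have "cl_class b p = cl_class b (p - q) \<oplus>\<^bsub>C\<^esub> cl_class b q"
    by (simp flip: class_hom)
  moreover have "cl_class b (p - q) = cl_class b p \<oplus>\<^bsub>C\<^esub> \<ominus>\<^bsub>C\<^esub> cl_class b q"
    using class_hom(1)[of p "- q"] by (simp add: class_hom)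
  ultimately show ?thesis
    by (auto simp: J_def C.r_neg)
qed

text \<open>Evaluation factors through the tensor algebra because \<gamma> is additive, and then
  through the Clifford algebra because \<gamma> satisfies the Clifford relation.\<close>

lemma J_eval: assumes "p \<in> J" shows "\<Phi> p = 0"
proof -
  let ?E = "ring_of_type_algebra :: ext_endo ring"
  have hom: "\<Phi> \<in> ring_hom ring_of_type_algebra ?E"
    by (rule ring_hom_memI) (simp_all add: free_eval_mult free_eval_add free_eval_1)
  have eval0: "\<Phi> 0 = 0" using free_eval_diff[of \<gamma> 0 0] by simp
  have ker: "\<Phi> p = \<zero>\<^bsub>?E\<^esub>" if "p \<in> tensor_ideal" for p
  proof -
    define K where "K = {p. \<Phi> p = 0}"
    have "ideal K ring_of_type_algebra"
    proof (rule idealI)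
      show "subgroup K (add_monoid ring_of_type_algebra)"
      proof
        show "inv\<^bsub>add_monoid ring_of_type_algebra\<^esub> p \<in> K" if "p \<in> K" for p
          using that free_eval_diff[of \<gamma> 0 p]
          unfolding a_minus_ring_of_type_algebra(1)[unfolded a_inv_def] by (simp add: K_def eval0)
      qed (simp_all add: free_eval_add K_def eval0)
    qed (simp_all add: free_eval_mult K_def)
    then have "tensor_ideal \<subseteq> K"
      unfolding tensor_ideal_def
      by (rule ring.genideal_minimal[OF ring_ring_of_type_algebra])
        (auto simp: K_def free_eval_diff free_eval_add free_eval_gen gamma_add)
    with that show ?thesis by (auto simp: K_def)
  qed
  obtain g where g: "g \<in> ring_hom (ring_of_type_algebra Quot tensor_ideal) ?E"
    "\<And>p. p \<in> carrier ring_of_type_algebra \<Longrightarrow> g (tensor_ideal +>\<^bsub>ring_of_type_algebra\<^esub> p) = \<Phi> p"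
    using ideal.quotient_hom_lift[OF ideal_tensor_ideal ring_ring_of_type_algebra hom ker] by metis
  have g1: "g \<in> ring_hom tensor_algebra ?E"
    using g(1) by (simp only: tensor_algebra_def)
  have g2: "g (tensor_class p) = \<Phi> p" for p
    using g(2)[of p] by (simp add: tensor_class_def)
  have "ideal (a_kernel tensor_algebra ?E g) tensor_algebra"
    by (rule ring_hom_ring.kernel_is_ideal[OF ring_hom_ringI2[OF ring_tensor_algebra ring_ring_of_type_algebra g1]])
  then have "clifford_ideal b \<subseteq> a_kernel tensor_algebra ?E g"
    unfolding clifford_ideal_def
  proof (rule ring.genideal_minimal[OF ring_tensor_algebra], intro subsetI)
    fix t assume "t \<in> {tensor_incl v \<otimes>\<^bsub>tensor_algebra\<^esub> tensor_incl v \<ominus>\<^bsub>tensor_algebra\<^esub>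
        add_pow tensor_algebra (b v v div 2) \<one>\<^bsub>tensor_algebra\<^esub> | v. True}"
    then obtain x where "t = tensor_class (free_gen x * free_gen x - of_int (b x x div 2))"
      unfolding tensor_class_Clifford_relation by blast
    moreover have "\<Phi> (free_gen x * free_gen x - of_int (b x x div 2)) = 0"
      by (simp add: free_eval_diff free_eval_mult free_eval_gen free_eval_of_int gamma_square)
    ultimately show "t \<in> a_kernel tensor_algebra ?E g"
      by (simp add: a_kernel_def' carrier_tensor_algebra g2)
  qed
  then have ker2: "g t = \<zero>\<^bsub>?E\<^esub>" if "t \<in> clifford_ideal b" for t
    using that unfolding a_kernel_def' by blast
  obtain h where h: "h \<in> ring_hom (tensor_algebra Quot clifford_ideal b) ?E"
    "\<And>t. t \<in> carrier tensor_algebra \<Longrightarrow> h (clifford_ideal b +>\<^bsub>tensor_algebra\<^esub> t) = g t"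
    using ideal.quotient_hom_lift[OF ideal_clifford_ideal ring_ring_of_type_algebra g1 ker2] by metis
  have h1: "h \<in> ring_hom C ?E"
    using h(1) by (simp only: clifford_algebra_def)
  have h2: "h (cl_class b p) = \<Phi> p" for p
    using h(2)[of "tensor_class p"] by (simp add: cl_class_def carrier_tensor_algebra g2)
  have "h \<zero>\<^bsub>C\<^esub> = 0"
    using h2[of 0] by (simp add: class_hom eval0)
  then show ?thesis
    using assms h2[of p] by (simp add: J_def)
qed

lemma gen_square_J: "free_gen x * free_gen x - of_int (b x x div 2) \<in> J"
  by (simp add: J_def cl_class_relation)

lemma gen_add_J: "free_gen (x + y) - (free_gen x + free_gen y) \<in> J"
  by (simp add: J_def cl_class_additive)

text \<open>Polarisation of the Clifford relation; evenness makes the divisions by 2 exact.\<close>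

lemma gen_anticommutator_J: "free_gen x * free_gen y + free_gen y * free_gen x - of_int (b x y) \<in> J"
proof -
  have "b (x + y) (x + y) div 2 = b x x div 2 + b y y div 2 + b x y"
    using even_square[of x] even_square[of y] sym[of y x] by (simp add: add_left add_right)
  then have "free_gen x * free_gen y + free_gen y * free_gen x - of_int (b x y) =
      (free_gen (x + y) * free_gen (x + y) - of_int (b (x + y) (x + y) div 2))
      - (free_gen (x + y) - (free_gen x + free_gen y)) * free_gen (x + y)
      - (free_gen x + free_gen y) * (free_gen (x + y) - (free_gen x + free_gen y))
      - (free_gen x * free_gen x - of_int (b x x div 2))
      - (free_gen y * free_gen y - of_int (b y y div 2))"
    by (simp add: algebra_simps)
  also have "\<dots> \<in> J"
    by (intro J_diff J_closed(3,4) gen_square_J gen_add_J)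
  finally show ?thesis .
qed

lemma gen_zmult_J: "free_gen (zmult n x) - of_int n * free_gen x \<in> J"
proof (induction n rule: int_induct[where k = 0])
  case base
  show ?case
    using J_closed(2)[OF gen_add_J[of 0 0]] by simp
next
  case (step1 n)
  have "free_gen (zmult (n + 1) x) - of_int (n + 1) * free_gen x =
      (free_gen (zmult n x + x) - (free_gen (zmult n x) + free_gen x))
      + (free_gen (zmult n x) - of_int n * free_gen x)"
    by (simp add: zmult_add_1 algebra_simps)
  then show ?case
    using J_closed(1)[OF gen_add_J[of "zmult n x" x] step1(2)] by (simp only:)
next
  case (step2 n)
  have "free_gen (zmult (n - 1) x) - of_int (n - 1) * free_gen x =
      (free_gen (zmult n x) - of_int n * free_gen x)
      - (free_gen (zmult (n - 1) x + x) - (free_gen (zmult (n - 1) x) + free_gen x))"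
    by (simp add: zmult_diff_1 algebra_simps)
  then show ?case
    using J_diff[OF step2(2) gen_add_J[of "zmult (n - 1) x" x]] by (simp only:)
qed

section \<open>Normal forms modulo the kernel\<close>

definition left_stable :: "'a free_ring set \<Rightarrow> 'a set \<Rightarrow> bool" where
  "left_stable A U \<longleftrightarrow> J \<subseteq> A \<and> (\<forall>p\<in>A. \<forall>q\<in>A. p - q \<in> A) \<and> (\<forall>p\<in>A. \<forall>n. of_int n * p \<in> A)
     \<and> (\<forall>x\<in>U. \<forall>p\<in>A. free_gen x * p \<in> A)"

text \<open>Modulo J one has \<open>x e = b x e - e x\<close>, and \<open>e e\<close> is an integer;
  hence A + e A absorbs left multiplication by \<open>e\<close> and by U. Three steps starting from
  \<int> + J produce all ordered monomials.\<close>

lemma left_stable_step: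
  assumes "left_stable A U"
  shows "left_stable {p + free_gen e * q | p q. p \<in> A \<and> q \<in> A} (insert e U)"
proof -
  let ?A = "{p + free_gen e * q | p q. p \<in> A \<and> q \<in> A}"
  have JA: "p \<in> A" if "p \<in> J" for p
    using that assms by (auto simp: left_stable_def)
  have diff: "p - q \<in> A" if "p \<in> A" "q \<in> A" for p q
    using that assms by (auto simp: left_stable_def)
  have scale: "of_int n * p \<in> A" if "p \<in> A" for n p
    using that assms by (auto simp: left_stable_def)
  have stable: "free_gen x * p \<in> A" if "x \<in> U" "p \<in> A" for x p
    using that assms by (auto simp: left_stable_def)
  have zero: "0 \<in> A" using JA J_closed(5) .
  have neg: "- p \<in> A" if "p \<in> A" for p
    using diff[OF zero that] by simp
  have add: "p + q \<in> A" if "p \<in> A" "q \<in> A" for p q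
    using diff[OF that(1) neg[OF that(2)]] by simp
  have AI: "r \<in> ?A" if "r = p + free_gen e * q" "p \<in> A" "q \<in> A" for r p q
    using that by blast
  show ?thesis
    unfolding left_stable_def
  proof (intro conjI subsetI ballI allI)
    fix p assume "p \<in> J"
    then show "p \<in> ?A" by (intro AI[of p p 0] JA zero) simp_all
  next
    fix p q assume "p \<in> ?A" "q \<in> ?A"
    then obtain p1 p2 r1 r2 where *: "p = p1 + free_gen e * p2" "q = r1 + free_gen e * r2"
      and "p1 \<in> A" "p2 \<in> A" "r1 \<in> A" "r2 \<in> A" by blast
    then show "p - q \<in> ?A"
      by (intro AI[of _ "p1 - r1" "p2 - r2"] diff) (simp_all add: algebra_simps)
  next
    fix p n assume "p \<in> ?A"
    then obtain p1 p2 where *: "p = p1 + free_gen e * p2" "p1 \<in> A" "p2 \<in> A" by blast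
    have "of_int n * p = of_int n * p1 + free_gen e * (of_int n * p2)"
      unfolding *(1) distrib_left mult.assoc[symmetric] mult_of_int_commute[of n "free_gen e"] ..
    then show "of_int n * p \<in> ?A"
      using * by (intro AI[of _ "of_int n * p1" "of_int n * p2"] scale)
  next
    fix x p assume x: "x \<in> insert e U" and "p \<in> ?A"
    then obtain p1 p2 where p: "p = p1 + free_gen e * p2" "p1 \<in> A" "p2 \<in> A" by blast
    show "free_gen x * p \<in> ?A"
    proof (cases "x \<in> U")
      case True
      have eq: "free_gen x * p = (free_gen x * p1 + of_int (b x e) * p2
          + (free_gen x * free_gen e + free_gen e * free_gen x - of_int (b x e)) * p2)
          + free_gen e * - (free_gen x * p2)"
        by (simp add: p algebra_simps)
      show ?thesis
        by (rule AI[OF eq]) (intro add stable[OF True] scale neg p(2,3) JA[OF J_closed(4)[OF gen_anticommutator_J]])+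
    next
      case False
      with x have [simp]: "x = e" by simp
      have eq: "free_gen x * p = (of_int (b e e div 2) * p2
          + (free_gen e * free_gen e - of_int (b e e div 2)) * p2) + free_gen e * p1"
        by (simp add: p algebra_simps)
      show ?thesis
        by (rule AI[OF eq]) (intro add scale p(2,3) JA[OF J_closed(4)[OF gen_square_J]])+
    qed
  qed
qed

text \<open>The nesting records three applications of \<open>left_stable_step\<close> with
  \<open>e3\<close> innermost; expanded, it is the combination of ordered monomials listed by
  \<open>Ext\<close>.\<close>

definition normal :: "int \<Rightarrow> int \<Rightarrow> int \<Rightarrow> int \<Rightarrow> int \<Rightarrow> int \<Rightarrow> int \<Rightarrow> int \<Rightarrow> 'a free_ring" where
  "normal n0 n1 n2 n3 n12 n13 n23 n123 =
    (of_int n0 + free_gen e3 * of_int n3) + free_gen e2 * (of_int n2 + free_gen e3 * of_int n23)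
    + free_gen e1 * ((of_int n1 + free_gen e3 * of_int n13)
      + free_gen e2 * (of_int n12 + free_gen e3 * of_int n123))"

text \<open>Spanning: the subgroup built from \<int> + J contains 1 and is stable under left
  multiplication by L, hence contains every word.\<close>

lemma normal_form:
  "\<exists>n0 n1 n2 n3 n12 n13 n23 n123. p - normal n0 n1 n2 n3 n12 n13 n23 n123 \<in> J"
proof -
  let ?step = "\<lambda>e A. {p + free_gen e * q | p q. p \<in> A \<and> q \<in> A}"
  define A0 where "A0 = {of_int n + j | n j. j \<in> J}"
  define A1 where "A1 = ?step e3 A0"
  define A2 where "A2 = ?step e2 A1"
  define A where "A = ?step e1 A2"
  have "left_stable A0 {}"
    unfolding left_stable_def
  proof (intro conjI subsetI ballI allI)
    fix p assume "p \<in> J" then show "p \<in> A0"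
      unfolding A0_def by (intro CollectI exI[of _ 0] exI[of _ p]) simp
  next
    fix p q assume "p \<in> A0" "q \<in> A0"
    then obtain m n i j where "p = of_int m + i" "q = of_int n + j" "i \<in> J" "j \<in> J"
      by (auto simp: A0_def)
    then show "p - q \<in> A0"
      unfolding A0_def by (intro CollectI exI[of _ "m - n"] exI[of _ "i - j"]) (simp add: J_diff)
  next
    fix p n assume "p \<in> A0"
    then obtain m i where "p = of_int m + i" "i \<in> J"
      by (auto simp: A0_def)
    then show "of_int n * p \<in> A0"
      unfolding A0_def
      by (intro CollectI exI[of _ "n * m"] exI[of _ "of_int n * i"]) (simp add: J_closed distrib_left)
  qed auto
  then have A: "left_stable A {e1, e2, e3}"
    unfolding A_def A1_def A2_def by (intro left_stable_step)
  have JA: "p \<in> A" if "p \<in> J" for p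
    using that A by (auto simp: left_stable_def)
  have diff: "p - q \<in> A" if "p \<in> A" "q \<in> A" for p q
    using that A by (auto simp: left_stable_def)
  have scale: "of_int n * p \<in> A" if "p \<in> A" for n p
    using that A by (auto simp: left_stable_def)
  have add: "p + q \<in> A" if "p \<in> A" "q \<in> A" for p q
    using diff[OF that(1) diff[OF JA[OF J_closed(5)] that(2)]] by simp
  have stable: "free_gen x * p \<in> A" if p: "p \<in> A" for x p
  proof -
    define y z where "y = zmult (X1 x) e1 + zmult (X2 x) e2" and "z = zmult (X1 x) e1"
    have x: "x = y + zmult (X3 x) e3" "y = z + zmult (X2 x) e2"
      using comb_coords[of x] by (simp_all add: y_def z_def comb_def)
    \<comment> \<open>Expands x in the basis. \<open>free_gen\<close> is additive only modulo J, so
      each correction appears as an explicit element of J times p.\<close>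
    have "free_gen x * p = (free_gen x - (free_gen y + free_gen (zmult (X3 x) e3))) * p
        + (free_gen y - (free_gen z + free_gen (zmult (X2 x) e2))) * p
        + (free_gen z - of_int (X1 x) * free_gen e1) * p
        + (free_gen (zmult (X2 x) e2) - of_int (X2 x) * free_gen e2) * p
        + (free_gen (zmult (X3 x) e3) - of_int (X3 x) * free_gen e3) * p
        + of_int (X1 x) * (free_gen e1 * p) + of_int (X2 x) * (free_gen e2 * p)
        + of_int (X3 x) * (free_gen e3 * p)"
      by (simp add: algebra_simps)
    also have "\<dots> \<in> A"
    proof -
      have st: "free_gen e1 * p \<in> A" "free_gen e2 * p \<in> A" "free_gen e3 * p \<in> A"
        using p A by (auto simp: left_stable_def)
      note j = JA[OF J_closed(4)[OF gen_add_J[of y "zmult (X3 x) e3", folded x(1)], of p]]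
        JA[OF J_closed(4)[OF gen_add_J[of z "zmult (X2 x) e2", folded x(2)], of p]]
        JA[OF J_closed(4)[OF gen_zmult_J[of "X1 x" e1, folded z_def], of p]]
        JA[OF J_closed(4)[OF gen_zmult_J[of "X2 x" e2], of p]]
        JA[OF J_closed(4)[OF gen_zmult_J[of "X3 x" e3], of p]]
      show ?thesis
        by (intro add j scale st)
    qed
    finally show ?thesis .
  qed
  have words: "Poly_Mapping.single (Word xs) 1 \<in> A" for xs
  proof (induction xs)
    case Nil
    have one: "1 \<in> A0"
      unfolding A0_def by (intro CollectI exI[of _ 1] exI[of _ 0]) (simp add: J_closed)
    have zero: "0 \<in> A0"
      unfolding A0_def by (intro CollectI exI[of _ 0] exI[of _ 0]) (simp add: J_closed)
    have stepI: "r \<in> ?step e B" if "r \<in> B" "0 \<in> B" for r e and B :: "'a free_ring set"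
      using that by (intro CollectI exI[of _ r] exI[of _ 0]) simp
    note step3 = stepI[OF one zero, of e3, folded A1_def] stepI[OF zero zero, of e3, folded A1_def]
    note step2 = stepI[OF step3, of e2, folded A2_def] stepI[OF step3(2,2), of e2, folded A2_def]
    have "1 \<in> A"
      unfolding A_def by (rule stepI[OF step2])
    then show ?case by (simp only: single_Nil)
  next
    case (Cons x xs)
    then show ?case unfolding single_Cons by (rule stable)
  qed
  have "p \<in> A"
  proof (induction p rule: free_ring_induct)
    case (word v)
    show ?case using words by (cases v) simp
  qed (rule diff)
  then obtain r1 r2 where r: "r1 \<in> A2" "r2 \<in> A2"
    "p = r1 + free_gen e1 * r2"
    unfolding A_def by blast
  obtain s1 s2 where s: "s1 \<in> A1" "s2 \<in> A1" "r1 = s1 + free_gen e2 * s2"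
    using r(1) unfolding A2_def by blast
  obtain s3 s4 where s': "s3 \<in> A1" "s4 \<in> A1" "r2 = s3 + free_gen e2 * s4"
    using r(2) unfolding A2_def by blast
  have form: "\<exists>m i n j. r = (of_int m + i) + free_gen e3 * (of_int n + j) \<and> i \<in> J \<and> j \<in> J"
    if rA: "r \<in> A1" for r
  proof -
    obtain r1 r2 where r: "r1 \<in> A0" "r2 \<in> A0" "r = r1 + free_gen e3 * r2"
      using rA unfolding A1_def by blast
    obtain m i where "r1 = of_int m + i" "i \<in> J"
      using r(1) unfolding A0_def by blast
    moreover obtain n j where "r2 = of_int n + j" "j \<in> J"
      using r(2) unfolding A0_def by blast
    ultimately show ?thesis
      using r(3) by blast
  qed
  obtain n0 j0 n3 j3 where 1: "s1 = (of_int n0 + j0) + free_gen e3 * (of_int n3 + j3)" "j0 \<in> J" "j3 \<in> J"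
    using form[OF s(1)] by blast
  obtain n2 j2 n23 j23 where 2: "s2 = (of_int n2 + j2) + free_gen e3 * (of_int n23 + j23)" "j2 \<in> J" "j23 \<in> J"
    using form[OF s(2)] by blast
  obtain n1 j1 n13 j13 where 3: "s3 = (of_int n1 + j1) + free_gen e3 * (of_int n13 + j13)" "j1 \<in> J" "j13 \<in> J"
    using form[OF s'(1)] by blast
  obtain n12 j12 n123 j123 where 4: "s4 = (of_int n12 + j12) + free_gen e3 * (of_int n123 + j123)"
    "j12 \<in> J" "j123 \<in> J"
    using form[OF s'(2)] by blast
  have "p - normal n0 n1 n2 n3 n12 n13 n23 n123 = (j0 + free_gen e3 * j3)
      + free_gen e2 * (j2 + free_gen e3 * j23)
      + free_gen e1 * ((j1 + free_gen e3 * j13) + free_gen e2 * (j12 + free_gen e3 * j123))"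
    unfolding r(3) s(3) s'(3) 1 2 3 4 normal_def distrib_left by simp
  also have "\<dots> \<in> J"
    by (intro J_closed(1,3) 1 2 3 4)
  finally show ?thesis by blast
qed

lemma eval_normal: "\<Phi> (normal n0 n1 n2 n3 n12 n13 n23 n123) = cl (Ext n0 n1 n2 n3 n12 n13 n23 n123)"
proof (rule range_cl_eqI)
  have "\<Phi> (normal n0 n1 n2 n3 n12 n13 n23 n123) = (of_int n0 + \<gamma> e3 * of_int n3)
    + \<gamma> e2 * (of_int n2 + \<gamma> e3 * of_int n23)
    + \<gamma> e1 * ((of_int n1 + \<gamma> e3 * of_int n13) + \<gamma> e2 * (of_int n12 + \<gamma> e3 * of_int n123))"
    by (simp add: normal_def free_eval_add free_eval_mult free_eval_gen free_eval_of_int)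
  note eq = this
  show "\<Phi> (normal n0 n1 n2 n3 n12 n13 n23 n123) \<in> range cl"
    unfolding eq by (intro range_cl_closed gamma_in_range)
  show "app (\<Phi> (normal n0 n1 n2 n3 n12 n13 n23 n123)) unit = app (cl (Ext n0 n1 n2 n3 n12 n13 n23 n123)) unit"
    unfolding eq app_cl_unit by (simp add: \<gamma>_def unit_def)
qed (rule rangeI)

text \<open>\<open>normal_form\<close> reduces a difference to eight coefficients, and these are
  read off in the model; so evaluation is faithful on Cl(L).\<close>

lemma class_eq_iff: "cl_class b p = cl_class b q \<longleftrightarrow> \<Phi> p = \<Phi> q"
proof
  assume "cl_class b p = cl_class b q"
  then show "\<Phi> p = \<Phi> q"
    using J_eval[of "p - q"] by (simp add: class_eq_iff_diff free_eval_diff)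
next
  assume eq: "\<Phi> p = \<Phi> q"
  obtain n0 n1 n2 n3 n12 n13 n23 n123 where n: "p - q - normal n0 n1 n2 n3 n12 n13 n23 n123 \<in> J"
    using normal_form[of "p - q"] by blast
  then have "cl (Ext n0 n1 n2 n3 n12 n13 n23 n123) = of_int 0"
    using J_eval[OF n] eq by (simp add: free_eval_diff eval_normal del: cl.simps)
  then have "n0 = 0" "n1 = 0" "n2 = 0" "n3 = 0" "n12 = 0" "n13 = 0" "n23 = 0" "n123 = 0"
    unfolding of_int_cl cl_inject by simp_all
  with n have "p - q \<in> J"
    by (simp add: normal_def)
  then show "cl_class b p = cl_class b q"
    by (simp add: class_eq_iff_diff)
qed

lemma eval_in_range: "\<Phi> p \<in> range cl"
proof (induction p rule: free_ring_induct)
  case (word v)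
  have "prod_list (map \<gamma> xs) \<in> range cl" for xs
    by (induction xs) (simp_all only: list.map prod_list.Nil prod_list.Cons range_cl_closed gamma_in_range)
  then show ?case by (simp only: free_eval_word)
qed (simp only: free_eval_diff range_cl_closed)

lemma range_eval: "range \<Phi> = range cl"
proof (intro subset_antisym subsetI)
  fix x assume "x \<in> range cl"
  then obtain c where "x = cl c" by blast
  then show "x \<in> range \<Phi>"
    by (cases c) (metis eval_normal rangeI)
next
  fix x assume "x \<in> range \<Phi>"
  then show "x \<in> range cl"
    using eval_in_range by (elim rangeE) (simp only:)
qed

lemma star_eval: "star (\<Phi> p) = \<Phi> (free_rev p)"
proof (induction p rule: free_ring_induct)
  case (word v)
  have r: "prod_list (map \<gamma> xs) \<in> range cl" for xs
    by (induction xs) (simp_all only: list.map prod_list.Nil prod_list.Cons range_cl_closed gamma_in_range)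
  have "star (prod_list (map \<gamma> xs)) = prod_list (map \<gamma> (rev xs))" for xs
    by (induction xs) (simp_all add: star_mult r)
  then show ?case by (simp add: free_eval_word free_rev_word word_rev_def)
next
  case (diff p q)
  then show ?case
    using star_add[of "\<Phi> p" "- \<Phi> q"] by (simp add: free_eval_diff free_rev_diff star_uminus)
qed

text \<open>Faithfulness and \<open>star_eval\<close> show that reversal respects equality of
  classes, so its compatibility with the Clifford ideal is obtained from the model.\<close>

lemma cl_star_class: "cl_star (cl_class b p) = cl_class b (free_rev p)"
proof -
  have *: "cl_class b (free_rev q) = cl_class b (free_rev p)" if "cl_class b q = cl_class b p" for p q
    using that unfolding class_eq_iff star_eval[symmetric] by (rule arg_cong)
  have "t \<in> cl_star (cl_class b p) \<longleftrightarrow> t \<in> cl_class b (free_rev p)" for t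
  proof
    assume "t \<in> cl_star (cl_class b p)"
    then obtain s where s: "s \<in> cl_class b p" "t = free_rev ` s"
      unfolding cl_star_def by blast
    then obtain q where "s = tensor_class q" "cl_class b q = cl_class b p"
      unfolding in_cl_class_iff by blast
    then show "t \<in> cl_class b (free_rev p)"
      using *[of q p] unfolding in_cl_class_iff s(2) by (metis free_rev_tensor_class)
  next
    assume "t \<in> cl_class b (free_rev p)"
    then obtain q where q: "t = tensor_class q" "cl_class b q = cl_class b (free_rev p)"
      unfolding in_cl_class_iff by blast
    then have "tensor_class (free_rev q) \<in> cl_class b p"
      using *[OF q(2)] unfolding in_cl_class_iff free_rev_free_rev by blast
    then have "free_rev ` tensor_class (free_rev q) \<in> cl_star (cl_class b p)"
      unfolding cl_star_def by (rule imageI)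
    then show "t \<in> cl_star (cl_class b p)"
      by (simp only: free_rev_tensor_class q free_rev_free_rev)
  qed
  then show ?thesis by blast
qed

text \<open>The isomorphism of Cl(L) onto \<open>range cl\<close>; by \<open>class_eq_iff\<close>
  the chosen representative is irrelevant.\<close>

definition \<kappa> :: "'a clifford \<Rightarrow> ext_endo" where
  "\<kappa> \<alpha> = \<Phi> (SOME p. cl_class b p = \<alpha>)"

lemma kappa_class [simp]: "\<kappa> (cl_class b p) = \<Phi> p"
proof -
  have "cl_class b (SOME q. cl_class b q = cl_class b p) = cl_class b p"
    by (rule someI) simp
  then show ?thesis by (simp add: \<kappa>_def class_eq_iff)
qed

lemma carrier_cases: assumes "\<alpha> \<in> carrier C" obtains p where "\<alpha> = cl_class b p"
  using assms by (auto simp: carrier_clifford_algebra)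

lemma kappa_inject: "\<alpha> \<in> carrier C \<Longrightarrow> \<beta> \<in> carrier C \<Longrightarrow> \<kappa> \<alpha> = \<kappa> \<beta> \<longleftrightarrow> \<alpha> = \<beta>"
  by (elim carrier_cases) (simp add: class_eq_iff)

lemma kappa_surj: assumes "x \<in> range cl" obtains \<alpha> where "\<alpha> \<in> carrier C" "\<kappa> \<alpha> = x"
proof -
  obtain p where "x = \<Phi> p" using assms range_eval by blast
  then show thesis using that[of "cl_class b p"] by simp
qed

lemma kappa_hom:
  "\<alpha> \<in> carrier C \<Longrightarrow> \<beta> \<in> carrier C \<Longrightarrow> \<kappa> (\<alpha> \<oplus>\<^bsub>C\<^esub> \<beta>) = \<kappa> \<alpha> + \<kappa> \<beta>"
  "\<alpha> \<in> carrier C \<Longrightarrow> \<beta> \<in> carrier C \<Longrightarrow> \<kappa> (\<alpha> \<otimes>\<^bsub>C\<^esub> \<beta>) = \<kappa> \<alpha> * \<kappa> \<beta>"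
  "\<kappa> \<one>\<^bsub>C\<^esub> = 1" "\<kappa> \<zero>\<^bsub>C\<^esub> = 0"
  "\<alpha> \<in> carrier C \<Longrightarrow> \<kappa> (\<ominus>\<^bsub>C\<^esub> \<alpha>) = - \<kappa> \<alpha>"
proof -
  have eval0: "\<Phi> 0 = 0" using free_eval_diff[of \<gamma> 0 0] by simp
  show "\<kappa> (\<alpha> \<oplus>\<^bsub>C\<^esub> \<beta>) = \<kappa> \<alpha> + \<kappa> \<beta>" if "\<alpha> \<in> carrier C" "\<beta> \<in> carrier C"
    using that by (elim carrier_cases) (simp only: class_hom(1)[symmetric] kappa_class free_eval_add)
  show "\<kappa> (\<alpha> \<otimes>\<^bsub>C\<^esub> \<beta>) = \<kappa> \<alpha> * \<kappa> \<beta>" if "\<alpha> \<in> carrier C" "\<beta> \<in> carrier C"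
    using that by (elim carrier_cases) (simp only: class_hom(2)[symmetric] kappa_class free_eval_mult)
  show "\<kappa> \<one>\<^bsub>C\<^esub> = 1"
    by (simp only: class_hom(3)[symmetric] kappa_class free_eval_1)
  show "\<kappa> \<zero>\<^bsub>C\<^esub> = 0"
    by (simp only: class_hom(4)[symmetric] kappa_class eval0)
  show "\<kappa> (\<ominus>\<^bsub>C\<^esub> \<alpha>) = - \<kappa> \<alpha>" if "\<alpha> \<in> carrier C"
    using that free_eval_diff[of \<gamma> 0] eval0
    by (elim carrier_cases) (simp add: class_hom(5)[symmetric])
qed

lemma cl_incl_closed [simp]: "cl_incl b x \<in> carrier C"
  by (simp add: cl_class_gen[symmetric])

lemma kappa_incl [simp]: "\<kappa> (cl_incl b x) = \<gamma> x"
  by (simp add: free_eval_gen cl_class_gen[symmetric])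

lemma cl_star_closed: "\<alpha> \<in> carrier C \<Longrightarrow> cl_star \<alpha> \<in> carrier C"
  by (elim carrier_cases) (simp add: cl_star_class)

lemma kappa_star: "\<alpha> \<in> carrier C \<Longrightarrow> \<kappa> (cl_star \<alpha>) = star (\<kappa> \<alpha>)"
  by (elim carrier_cases) (simp add: cl_star_class star_eval)

lemma mult_of_int_left: "x * (of_int n * y) = of_int n * (x * (y :: 'r::ring_1))"
  unfolding mult.assoc[symmetric] mult_of_int_commute[of n x] ..

lemma cl_prod_Cons: "cl_prod b (y # vs) = cl_incl b y \<otimes>\<^bsub>C\<^esub> cl_prod b vs"
  by (simp add: cl_prod_def)

lemma cl_prod_closed: "cl_prod b vs \<in> carrier C"
proof (induction vs)
  case Nil
  show ?case by (simp add: cl_prod_def)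
next
  case (Cons y vs)
  then show ?case by (simp add: cl_prod_Cons)
qed

lemma kappa_prod: "\<kappa> (cl_prod b vs) = prod_list (map \<gamma> vs)"
proof (induction vs)
  case Nil
  show ?case by (simp add: cl_prod_def kappa_hom)
next
  case (Cons y vs)
  then show ?case by (simp add: cl_prod_Cons kappa_hom cl_prod_closed)
qed

lemma prod_gamma_parity:
  "prod_list (map \<gamma> vs) \<in> (if even (length vs) then Even else Odd)"
proof (induction vs)
  case (Cons y vs)
  then show ?case
    using Odd_mult_Odd[OF gamma_in_Odd[of y]] Odd_mult_Even[OF gamma_in_Odd[of y]]
    by (simp split: if_splits)
qed simp

section \<open>The even part, the odd part and the unit groups in the model\<close>

lemma a_inv_add_monoid: "inv\<^bsub>add_monoid C\<^esub> x = \<ominus>\<^bsub>C\<^esub> x"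
  by (simp add: a_inv_def)

lemma generate_closed:
  assumes "S \<subseteq> carrier C"
  shows "\<alpha> \<in> generate (add_monoid C) S \<Longrightarrow> \<alpha> \<in> carrier C"
proof (induction rule: generate.induct)
  case (inv h)
  then show ?case using assms unfolding a_inv_add_monoid by auto
qed (use assms in auto)

lemma generate_kappa:
  assumes "S \<subseteq> carrier C" "\<And>\<alpha>. \<alpha> \<in> S \<Longrightarrow> \<kappa> \<alpha> \<in> P"
    and "0 \<in> P" "\<And>x y. x \<in> P \<Longrightarrow> y \<in> P \<Longrightarrow> x + y \<in> P" "\<And>x. x \<in> P \<Longrightarrow> - x \<in> P"
  shows "\<alpha> \<in> generate (add_monoid C) S \<Longrightarrow> \<kappa> \<alpha> \<in> P"
proof (induction rule: generate.induct)
  case one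
  then show ?case using assms(3) by (simp add: kappa_hom)
next
  case (incl h)
  then show ?case by (rule assms(2))
next
  case (inv h)
  then have "h \<in> carrier C" using assms(1) by blast
  with inv show ?case
    unfolding a_inv_add_monoid using assms(2,5) by (simp add: kappa_hom)
next
  case (eng h1 h2)
  then have "h1 \<in> carrier C" "h2 \<in> carrier C"
    using generate_closed[OF assms(1)] by blast+
  with eng show ?case using assms(4) by (simp add: kappa_hom)
qed

lemma generate_scale:
  assumes "S \<subseteq> carrier C" "\<alpha> \<in> S"
  shows "\<exists>\<beta>\<in>generate (add_monoid C) S. \<kappa> \<beta> = of_int n * \<kappa> \<alpha>"
proof (induction n rule: int_induct[where k = 0])
  case base
  show ?case
    using generate.one[of "add_monoid C" S] by (intro bexI[of _ "\<zero>\<^bsub>C\<^esub>"]) (simp_all add: kappa_hom)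
next
  case (step1 n)
  then obtain \<beta> where \<beta>: "\<beta> \<in> generate (add_monoid C) S" "\<kappa> \<beta> = of_int n * \<kappa> \<alpha>" by blast
  have "\<beta> \<oplus>\<^bsub>C\<^esub> \<alpha> \<in> generate (add_monoid C) S"
    using generate.eng[OF \<beta>(1) generate.incl[OF assms(2)]] by simp
  moreover have "\<kappa> (\<beta> \<oplus>\<^bsub>C\<^esub> \<alpha>) = of_int (n + 1) * \<kappa> \<alpha>"
    using assms generate_closed[OF assms(1) \<beta>(1)] by (subst kappa_hom) (auto simp: \<beta> distrib_right)
  ultimately show ?case by blast
next
  case (step2 n)
  then obtain \<beta> where \<beta>: "\<beta> \<in> generate (add_monoid C) S" "\<kappa> \<beta> = of_int n * \<kappa> \<alpha>" by blast
  have "\<beta> \<oplus>\<^bsub>C\<^esub> \<ominus>\<^bsub>C\<^esub> \<alpha> \<in> generate (add_monoid C) S"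
    using generate.eng[OF \<beta>(1) generate.inv[OF assms(2)]] unfolding a_inv_add_monoid by simp
  moreover have "\<alpha> \<in> carrier C" using assms by blast
  then have "\<kappa> (\<beta> \<oplus>\<^bsub>C\<^esub> \<ominus>\<^bsub>C\<^esub> \<alpha>) = of_int (n - 1) * \<kappa> \<alpha>"
    using generate_closed[OF assms(1) \<beta>(1)] by (simp add: kappa_hom \<beta> left_diff_distrib)
  ultimately show ?case by blast
qed

lemma generate_combination:
  assumes S: "S \<subseteq> carrier C" and "\<alpha>1 \<in> S" "\<alpha>2 \<in> S" "\<alpha>3 \<in> S" "\<alpha>4 \<in> S" and \<alpha>: "\<alpha> \<in> carrier C"
    and eq: "\<kappa> \<alpha> = of_int n1 * \<kappa> \<alpha>1 + of_int n2 * \<kappa> \<alpha>2 + of_int n3 * \<kappa> \<alpha>3 + of_int n4 * \<kappa> \<alpha>4"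
  shows "\<alpha> \<in> generate (add_monoid C) S"
proof -
  let ?G = "generate (add_monoid C) S"
  obtain \<beta>1 where 1: "\<beta>1 \<in> ?G" "\<kappa> \<beta>1 = of_int n1 * \<kappa> \<alpha>1"
    using generate_scale[OF S assms(2)] by blast
  obtain \<beta>2 where 2: "\<beta>2 \<in> ?G" "\<kappa> \<beta>2 = of_int n2 * \<kappa> \<alpha>2"
    using generate_scale[OF S assms(3)] by blast
  obtain \<beta>3 where 3: "\<beta>3 \<in> ?G" "\<kappa> \<beta>3 = of_int n3 * \<kappa> \<alpha>3"
    using generate_scale[OF S assms(4)] by blast
  obtain \<beta>4 where 4: "\<beta>4 \<in> ?G" "\<kappa> \<beta>4 = of_int n4 * \<kappa> \<alpha>4"
    using generate_scale[OF S assms(5)] by blast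
  note car = 1(1)[THEN generate_closed[OF S]] 2(1)[THEN generate_closed[OF S]]
    3(1)[THEN generate_closed[OF S]] 4(1)[THEN generate_closed[OF S]]
  have "\<beta>1 \<oplus>\<^bsub>C\<^esub> \<beta>2 \<oplus>\<^bsub>C\<^esub> \<beta>3 \<oplus>\<^bsub>C\<^esub> \<beta>4 \<in> ?G"
    using generate.eng[OF generate.eng[OF generate.eng[OF 1(1) 2(1)] 3(1)] 4(1)] by simp
  moreover have "\<kappa> (\<beta>1 \<oplus>\<^bsub>C\<^esub> \<beta>2 \<oplus>\<^bsub>C\<^esub> \<beta>3 \<oplus>\<^bsub>C\<^esub> \<beta>4) = \<kappa> \<alpha>"
    using car by (simp add: kappa_hom eq 1 2 3 4)
  ultimately show ?thesis
    using kappa_inject[of "\<beta>1 \<oplus>\<^bsub>C\<^esub> \<beta>2 \<oplus>\<^bsub>C\<^esub> \<beta>3 \<oplus>\<^bsub>C\<^esub> \<beta>4" \<alpha>] \<alpha> car by simp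
qed

lemma gamma_basis: "\<gamma> e1 = vec 1 0 0" "\<gamma> e2 = vec 0 1 0" "\<gamma> e3 = vec 0 0 1"
  by (simp_all add: \<gamma>_def)

lemma ev_combination: "ev a a12 a13 a23 =
    of_int a * 1 + of_int a12 * (\<gamma> e1 * \<gamma> e2) + of_int a13 * (\<gamma> e1 * \<gamma> e3) + of_int a23 * (\<gamma> e2 * \<gamma> e3)"
  using vec_scale[of 0 0 0 0] by (simp add: ev_def gamma_basis)

lemma od_combination: "od x1 x2 x3 t =
    of_int x1 * \<gamma> e1 + of_int x2 * \<gamma> e2 + of_int x3 * \<gamma> e3 + of_int t * (\<gamma> e1 * (\<gamma> e2 * \<gamma> e3))"
  by (simp add: od_def gamma_basis vec_scale vec_add)

text \<open>The generators have arbitrary even length, but the four ordered monomials of even degree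
  are among them and already span \<open>Even\<close>.\<close>

lemma mem_cl_even: "\<alpha> \<in> cl_even b \<longleftrightarrow> \<alpha> \<in> carrier C \<and> \<kappa> \<alpha> \<in> Even"
proof
  let ?S = "{cl_prod b vs | vs. even (length vs)}"
  have S: "?S \<subseteq> carrier C" using cl_prod_closed by blast
  {
    assume "\<alpha> \<in> cl_even b"
    then have \<alpha>: "\<alpha> \<in> generate (add_monoid C) ?S" by (simp add: cl_even_def)
    have "\<kappa> \<beta> \<in> Even" if "\<beta> \<in> ?S" for \<beta>
    proof -
      obtain vs where "\<beta> = cl_prod b vs" "even (length vs)" using \<open>\<beta> \<in> ?S\<close> by blast
      then show ?thesis using prod_gamma_parity[of vs] by (simp add: kappa_prod)
    qed
    moreover have "0 \<in> Even" using of_int_in_Even[of 0] by simp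
    ultimately have "\<kappa> \<alpha> \<in> Even"
      by (rule generate_kappa[OF S _ _ Even_add Even_uminus \<alpha>])
    with generate_closed[OF S \<alpha>] show "\<alpha> \<in> carrier C \<and> \<kappa> \<alpha> \<in> Even" by blast
  next
    assume *: "\<alpha> \<in> carrier C \<and> \<kappa> \<alpha> \<in> Even"
    then obtain a a12 a13 a23 where "\<kappa> \<alpha> = ev a a12 a13 a23" by (auto elim: EvenE)
    then have eq: "\<kappa> \<alpha> = of_int a * \<kappa> (cl_prod b []) + of_int a12 * \<kappa> (cl_prod b [e1, e2])
        + of_int a13 * \<kappa> (cl_prod b [e1, e3]) + of_int a23 * \<kappa> (cl_prod b [e2, e3])"
      by (simp add: ev_combination kappa_prod)
    have mem: "cl_prod b [] \<in> ?S" "cl_prod b [e1, e2] \<in> ?S" "cl_prod b [e1, e3] \<in> ?S" "cl_prod b [e2, e3] \<in> ?S"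
      by (intro CollectI exI conjI, rule refl, simp)+
    show "\<alpha> \<in> cl_even b"
      unfolding cl_even_def using * by (intro generate_combination[OF S mem _ eq]) simp
  }
qed

lemma mem_cl_odd: "\<alpha> \<in> cl_odd b \<longleftrightarrow> \<alpha> \<in> carrier C \<and> \<kappa> \<alpha> \<in> Odd"
proof
  let ?S = "{cl_prod b vs | vs. odd (length vs)}"
  have S: "?S \<subseteq> carrier C" using cl_prod_closed by blast
  {
    assume "\<alpha> \<in> cl_odd b"
    then have \<alpha>: "\<alpha> \<in> generate (add_monoid C) ?S" by (simp add: cl_odd_def)
    have "\<kappa> \<beta> \<in> Odd" if "\<beta> \<in> ?S" for \<beta>
    proof -
      obtain vs where "\<beta> = cl_prod b vs" "odd (length vs)" using \<open>\<beta> \<in> ?S\<close> by blast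
      then show ?thesis using prod_gamma_parity[of vs] by (simp add: kappa_prod)
    qed
    moreover have "0 \<in> Odd" using gamma_in_Odd[of 0] unfolding gamma_0 .
    ultimately have "\<kappa> \<alpha> \<in> Odd"
      by (rule generate_kappa[OF S _ _ Odd_add Odd_uminus \<alpha>])
    with generate_closed[OF S \<alpha>] show "\<alpha> \<in> carrier C \<and> \<kappa> \<alpha> \<in> Odd" by blast
  next
    assume *: "\<alpha> \<in> carrier C \<and> \<kappa> \<alpha> \<in> Odd"
    then obtain x1 x2 x3 t where "\<kappa> \<alpha> = od x1 x2 x3 t" by (auto elim: OddE)
    then have eq: "\<kappa> \<alpha> = of_int x1 * \<kappa> (cl_prod b [e1]) + of_int x2 * \<kappa> (cl_prod b [e2])
        + of_int x3 * \<kappa> (cl_prod b [e3]) + of_int t * \<kappa> (cl_prod b [e1, e2, e3])"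
      by (simp add: od_combination kappa_prod)
    have mem: "cl_prod b [e1] \<in> ?S" "cl_prod b [e2] \<in> ?S" "cl_prod b [e3] \<in> ?S" "cl_prod b [e1, e2, e3] \<in> ?S"
      by (intro CollectI exI conjI, rule refl, simp)+
    show "\<alpha> \<in> cl_odd b"
      unfolding cl_odd_def using * by (intro generate_combination[OF S mem _ eq]) simp
  }
qed

lemma kappa_norm: "\<alpha> \<in> carrier C \<Longrightarrow> \<kappa> (cl_norm b \<alpha>) = \<kappa> \<alpha> * star (\<kappa> \<alpha>)"
  by (simp add: cl_norm_def kappa_hom kappa_star cl_star_closed)

lemma norm_closed: "\<alpha> \<in> carrier C \<Longrightarrow> cl_norm b \<alpha> \<in> carrier C"
  by (simp add: cl_norm_def cl_star_closed)

lemma kappa_eq_one: "\<alpha> \<in> carrier C \<Longrightarrow> \<alpha> = \<one>\<^bsub>C\<^esub> \<longleftrightarrow> \<kappa> \<alpha> = 1"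
  using kappa_inject[of \<alpha> "\<one>\<^bsub>C\<^esub>"] by (simp add: kappa_hom)

lemma kappa_eq_minus_one: "\<alpha> \<in> carrier C \<Longrightarrow> \<alpha> = \<ominus>\<^bsub>C\<^esub> \<one>\<^bsub>C\<^esub> \<longleftrightarrow> \<kappa> \<alpha> = - 1"
  using kappa_inject[of \<alpha> "\<ominus>\<^bsub>C\<^esub> \<one>\<^bsub>C\<^esub>"] by (simp add: kappa_hom)

lemma mem_pm1: "\<alpha> \<in> cl_pm1 b \<longleftrightarrow> \<alpha> \<in> carrier C \<and> \<kappa> \<alpha> \<in> {1, - 1}"
  using kappa_eq_one[of \<alpha>] kappa_eq_minus_one[of \<alpha>] by (auto simp: cl_pm1_def)

definition PM :: "ext_endo set" where
  "PM = {x \<in> Even \<union> Odd. x * star x = 1 \<or> x * star x = - 1}"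

lemma mem_pm_units: "\<alpha> \<in> cl_pm_units b \<longleftrightarrow> \<alpha> \<in> carrier C \<and> \<kappa> \<alpha> \<in> PM"
  using kappa_norm[of \<alpha>] norm_closed[of \<alpha>]
  by (auto simp: cl_pm_units_def PM_def mem_cl_even mem_cl_odd mem_pm1)

lemma mem_even_units: "\<alpha> \<in> cl_even_units b \<longleftrightarrow> \<alpha> \<in> carrier C \<and> \<kappa> \<alpha> \<in> PM \<and> \<kappa> \<alpha> \<in> Even"
  using kappa_norm[of \<alpha>] norm_closed[of \<alpha>]
  by (auto simp: cl_even_units_def PM_def mem_cl_even mem_pm1)

lemma mem_even_norm1: "\<alpha> \<in> cl_even_norm1 b \<longleftrightarrow> \<alpha> \<in> carrier C \<and> \<kappa> \<alpha> \<in> Even \<and> \<kappa> \<alpha> * star (\<kappa> \<alpha>) = 1"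
  using kappa_norm[of \<alpha>] norm_closed[of \<alpha>] kappa_eq_one[of "cl_norm b \<alpha>"]
  by (auto simp: cl_even_norm1_def mem_cl_even)

end

section \<open>Twisted conjugation\<close>

lemma sum_permutes_3:
  fixes F :: "'a \<Rightarrow> 'a \<Rightarrow> int"
  assumes "a \<noteq> b" "a \<noteq> c" "b \<noteq> c"
  shows "(\<Sum>p | p permutes {a, b, c}. sign p * (\<Prod>x\<in>{a, b, c}. F x (p x))) =
    F a a * (F b b * F c c - F b c * F c b) - F a b * (F b a * F c c - F b c * F c a)
    + F a c * (F b a * F c b - F b b * F c a)"
proof -
  have f1: "finite {b, c}" "a \<notin> {b, c}" and f2: "finite {c}" "b \<notin> {c}" using assms by simp_all
  have P: "(\<Prod>x\<in>{a, b, c}. F x (p x)) = F a (p a) * (F b (p b) * F c (p c))" for p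
    using assms by simp
  show ?thesis
    unfolding P sum_over_permutations_insert[OF f1] sum_over_permutations_insert[OF f2] permutes_sing
    using assms by (simp add: sign_swap_id permutation_swap_id sign_compose, simp add: algebra_simps)
qed

context ternary_lattice
begin

lemma of_int_mult_eq_0: "x \<in> range cl \<Longrightarrow> of_int n * x = 0 \<Longrightarrow> n = 0 \<or> x = 0"
  using of_int_mult_cancel[OF _ range_cl_closed(6), of x n] by force

lemma of_int_eq_of_int: "(of_int m :: ext_endo) = of_int n \<longleftrightarrow> m = n"
  unfolding of_int_cl cl_inject by simp

text \<open>If \<open>star x * x\<close> is the integer m, then m x and n x both equal
  \<open>x * star x * x\<close>, and absence of torsion gives m = n.\<close>

lemma star_mult_self:
  assumes "x \<in> Even \<union> Odd" "x * star x = of_int n" "n \<noteq> 0"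
  shows "star x * x = of_int n"
proof -
  have x: "x \<in> range cl" using assms(1) by (rule Even_Odd_in_range)
  have "star x \<in> Even \<union> Odd" using assms(1) Even_star Odd_star by blast
  then obtain m where m: "star x * star (star x) = of_int m" by (rule mult_star_int)
  have "of_int n * x = x * (star x * x)" by (simp only: assms(2)[symmetric] mult.assoc)
  also have "\<dots> = of_int m * x"
    using m x by (simp add: star_star mult_of_int_commute)
  finally have "of_int (n - m) * x = 0" by (simp add: left_diff_distrib)
  then have "n - m = 0 \<or> x = 0" by (rule of_int_mult_eq_0[OF x])
  moreover have "x \<noteq> 0"
    using assms(2,3) of_int_eq_of_int[of n 0] by auto
  ultimately show ?thesis using m x by (simp add: star_star)
qed

lemma right_cancel:
  assumes "x \<in> Even \<union> Odd" "x * star x = of_int n" "n \<noteq> 0"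
    and "y \<in> range cl" "z \<in> range cl" "y * x = z * x"
  shows "y = z"
proof -
  have "y * (x * star x) = z * (x * star x)"
    using assms(6) by (simp only: mult.assoc[symmetric])
  then have "of_int n * y = of_int n * z"
    by (simp only: assms(2) mult_of_int_commute)
  then show ?thesis using assms(3-5) of_int_mult_cancel by blast
qed

definition homogeneous :: "ext_endo \<Rightarrow> int \<Rightarrow> bool" where
  "homogeneous x s \<longleftrightarrow> s = 1 \<and> x \<in> Even \<or> s = - 1 \<and> x \<in> Odd"

text \<open>Twisted conjugation without inverses: the relation makes sense for every x of nonzero
  norm, such as the products of reflection vectors before division by their content.\<close>

definition implements :: "ext_endo \<Rightarrow> int \<Rightarrow> ('a \<Rightarrow> 'a) \<Rightarrow> bool" where
  "implements x s g \<longleftrightarrow> homogeneous x s \<and> (\<forall>y. x * \<gamma> y = of_int s * (\<gamma> (g y) * x))"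

lemma homogeneousD: "homogeneous x s \<Longrightarrow> x \<in> Even \<union> Odd" "homogeneous x s \<Longrightarrow> s * s = 1"
  by (auto simp: homogeneous_def)

lemma homogeneous_mult: "homogeneous x s \<Longrightarrow> homogeneous y t \<Longrightarrow> homogeneous (x * y) (s * t)"
  by (auto simp: homogeneous_def)

lemma homogeneous_star: "homogeneous x s \<Longrightarrow> homogeneous (star x) s"
  by (auto simp: homogeneous_def)

lemma PM_cases:
  assumes "x \<in> PM"
  obtains s n where "homogeneous x s" "x * star x = of_int n" "n = 1 \<or> n = - 1"
    "star x * x = of_int n" "s = 1 \<or> s = - 1"
proof -
  have x: "x \<in> Even \<union> Odd" using assms by (auto simp: PM_def)
  then obtain s where s: "homogeneous x s" "s = 1 \<or> s = - 1" by (auto simp: homogeneous_def)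
  have "x * star x = of_int 1 \<or> x * star x = of_int (- 1)" using assms by (auto simp: PM_def)
  then obtain n where n: "x * star x = of_int n" "n = 1 \<or> n = - 1" by blast
  then have "star x * x = of_int n" using star_mult_self[OF x n(1)] by auto
  then show thesis using that s n by blast
qed

lemma PM_I: "homogeneous x s \<Longrightarrow> x * star x = of_int n \<Longrightarrow> n = 1 \<or> n = - 1 \<Longrightarrow> x \<in> PM"
  by (auto simp: PM_def homogeneous_def)

lemma PM_range: "x \<in> PM \<Longrightarrow> x \<in> range cl"
  using Even_Odd_in_range by (auto simp: PM_def simp del: cl.simps)

text \<open>As n is 1 or -1, \<open>of_int n * star x\<close> is the inverse of x. The conjugate of
  a vector is therefore, up to sign, the odd and star-fixed element
  \<open>x * (\<gamma> y * star x)\<close>, which is a vector of L.\<close>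

lemma implements_exists:
  assumes "x \<in> PM" "homogeneous x s"
  shows "\<exists>z. x * \<gamma> y = of_int s * (\<gamma> z * x)"
proof -
  obtain n where n: "x * star x = of_int n" "n = 1 \<or> n = - 1" "star x * x = of_int n"
    using assms(1) by (rule PM_cases)
  have x: "x \<in> range cl" using assms(1) by (rule PM_range)
  have "star (x * (\<gamma> y * star x)) = x * (\<gamma> y * star x)"
    using x by (simp add: star_mult range_cl_closed star_star mult.assoc del: cl.simps)
  moreover have "x * (\<gamma> y * star x) \<in> Odd"
    using assms(2) by (auto simp: homogeneous_def)
  ultimately obtain y1 y2 y3 where "x * (\<gamma> y * star x) = vec y1 y2 y3"
    using star_fixed_Odd by metis
  then have eq: "x * (\<gamma> y * star x) = \<gamma> (comb y1 y2 y3)" by (simp add: vec_gamma)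
  have "of_int n * (x * \<gamma> y) = x * (\<gamma> y * (star x * x))"
    by (simp add: n(3) mult_of_int_commute mult.assoc)
  also have "\<dots> = \<gamma> (comb y1 y2 y3) * x"
    by (simp only: eq[symmetric] mult.assoc)
  finally have "of_int (n * n) * (x * \<gamma> y) = of_int n * (\<gamma> (comb y1 y2 y3) * x)"
    by (simp add: mult.assoc)
  moreover have "n * n = 1" using n(2) by auto
  ultimately have "x * \<gamma> y = of_int n * (\<gamma> (comb y1 y2 y3) * x)" by simp
  \<comment> \<open>Inserting \<open>s * s = 1\<close> brings the parity sign to the front; the
    remaining sign \<open>s * n\<close> is absorbed into the vector.\<close>
  also have "\<dots> = of_int (s * (s * n)) * (\<gamma> (comb y1 y2 y3) * x)"
    using homogeneousD(2)[OF assms(2)] by (simp add: mult.assoc[symmetric] del: of_int_mult)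
  also have "\<dots> = of_int s * (\<gamma> (zmult (s * n) (comb y1 y2 y3)) * x)"
    by (simp add: gamma_zmult mult.assoc)
  finally show ?thesis by blast
qed

definition sgn_of :: "ext_endo \<Rightarrow> int" where
  "sgn_of x = (if x \<in> Even then 1 else - 1)"

definition act :: "ext_endo \<Rightarrow> 'a \<Rightarrow> 'a" where
  "act x y = (SOME z. x * \<gamma> y = of_int (sgn_of x) * (\<gamma> z * x))"

lemma homogeneous_sgn_of: assumes "x \<in> PM" shows "homogeneous x (sgn_of x)"
  using assms by (auto simp: PM_def homogeneous_def sgn_of_def)

lemma homogeneous_unique:
  assumes "homogeneous x s" "homogeneous x t" "x \<noteq> 0" shows "s = t"
  using assms Even_Int_Odd by (auto simp: homogeneous_def)

lemma PM_nonzero: assumes "x \<in> PM" shows "x \<noteq> 0"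
  using assms by (auto simp: PM_def)

lemma sgn_of_eq: "x \<in> PM \<Longrightarrow> homogeneous x s \<Longrightarrow> sgn_of x = s"
  using homogeneous_unique homogeneous_sgn_of PM_nonzero by blast

lemma implements_act: assumes "x \<in> PM" shows "implements x (sgn_of x) (act x)"
  unfolding implements_def act_def
  using someI_ex[OF implements_exists[OF assms homogeneous_sgn_of[OF assms]]]
    homogeneous_sgn_of[OF assms] by blast

lemma implements_unique:
  assumes "implements x s g" "implements x t h" "x * star x = of_int n" "n \<noteq> 0"
  shows "g = h"
proof
  fix y
  have hs: "homogeneous x s" "homogeneous x t" using assms by (simp_all add: implements_def)
  have "x \<noteq> 0" using assms(3,4) of_int_eq_of_int[of n 0] by auto
  with hs have st: "t = s" using homogeneous_unique by blast
  have "of_int s * (\<gamma> (g y) * x) = of_int s * (\<gamma> (h y) * x)"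
    using assms(1,2) unfolding implements_def st by metis
  then have "of_int (s * s) * (\<gamma> (g y) * x) = of_int (s * s) * (\<gamma> (h y) * x)"
    by (simp add: mult.assoc)
  then have "\<gamma> (g y) * x = \<gamma> (h y) * x" using homogeneousD(2)[OF hs(1)] by simp
  then have "\<gamma> (g y) = \<gamma> (h y)"
    by (rule right_cancel[OF homogeneousD(1)[OF hs(1)] assms(3,4) gamma_in_range gamma_in_range])
  then show "g y = h y" by simp
qed

lemma act_eqI: assumes "x \<in> PM" "implements x s g" shows "act x = g"
proof -
  obtain n where n: "x * star x = of_int n" "n = 1 \<or> n = - 1"
    using assms(1) by (rule PM_cases)
  then have "n \<noteq> 0" by auto
  then show ?thesis using implements_unique[OF implements_act[OF assms(1)] assms(2) n(1)] by blast
qed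

lemma implements_mult:
  assumes "implements x s g" "implements y t h"
  shows "implements (x * y) (s * t) (g \<circ> h)"
proof -
  have "x * y * \<gamma> z = of_int (s * t) * (\<gamma> (g (h z)) * (x * y))" for z
  proof -
    have "x * y * \<gamma> z = x * (of_int t * (\<gamma> (h z) * y))"
      using assms(2) by (simp add: implements_def mult.assoc)
    also have "\<dots> = of_int t * ((x * \<gamma> (h z)) * y)"
      by (simp only: mult_of_int_left mult.assoc)
    also have "\<dots> = of_int t * (of_int s * (\<gamma> (g (h z)) * (x * y)))"
      using assms(1) by (simp add: implements_def mult.assoc)
    also have "\<dots> = of_int (s * t) * (\<gamma> (g (h z)) * (x * y))"
      by (simp only: of_int_mult mult.assoc[symmetric] mult_of_int_commute[of s "of_int t"])
    finally show ?thesis .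
  qed
  then show ?thesis
    using assms homogeneous_mult by (simp add: implements_def)
qed

lemma norm_mult:
  assumes "x \<in> Even \<union> Odd" "y \<in> Even \<union> Odd" "x * star x = of_int m" "y * star y = of_int n"
  shows "(x * y) * star (x * y) = of_int (m * n)"
proof -
  have "(x * y) * star (x * y) = x * ((y * star y) * star x)"
    using assms(1,2)[THEN Even_Odd_in_range] by (simp add: star_mult mult.assoc)
  also have "\<dots> = of_int n * (x * star x)"
    by (simp only: assms mult_of_int_left)
  also have "\<dots> = of_int (m * n)"
    by (simp only: assms of_int_mult[symmetric] mult.commute)
  finally show ?thesis .
qed

lemma PM_mult: assumes "x \<in> PM" "y \<in> PM" shows "x * y \<in> PM"
proof -
  obtain s m where 1: "homogeneous x s" "x * star x = of_int m" "m = 1 \<or> m = - 1"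
    using assms(1) by (rule PM_cases)
  obtain t n where 2: "homogeneous y t" "y * star y = of_int n" "n = 1 \<or> n = - 1"
    using assms(2) by (rule PM_cases)
  have "(x * y) * star (x * y) = of_int (m * n)"
    using norm_mult homogeneousD(1) 1 2 by blast
  moreover have "m * n = 1 \<or> m * n = - 1" using 1 2 by auto
  ultimately show ?thesis using PM_I homogeneous_mult 1 2 by blast
qed

lemma act_mult: assumes "x \<in> PM" "y \<in> PM" shows "act (x * y) = act x \<circ> act y"
  using act_eqI[OF PM_mult[OF assms] implements_mult[OF implements_act implements_act]] assms by blast

lemma one_PM: "1 \<in> PM" and minus_one_PM: "- 1 \<in> PM"
  using one_in_Even Even_uminus[OF one_in_Even] by (simp_all add: PM_def star_uminus)

lemma act_one: "act 1 = id" and act_minus_one: "act (- 1) = id"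
proof -
  have "implements 1 1 id" "implements (- 1) 1 id"
    using one_in_Even Even_uminus[OF one_in_Even] by (simp_all add: implements_def homogeneous_def)
  then show "act 1 = id" "act (- 1) = id"
    using act_eqI one_PM minus_one_PM by blast+
qed

text \<open>The kernel of the action: an even implementer of the identity is central, and an odd one
  anticommutes with L, so it vanishes.\<close>

lemma implements_id:
  assumes "implements x s id" "x \<noteq> 0"
  obtains n where "x = of_int n" "s = 1"
proof -
  have eq: "x * vec y1 y2 y3 = of_int s * (vec y1 y2 y3 * x)" for y1 y2 y3
    using assms(1) by (simp add: implements_def vec_gamma)
  have "s = 1 \<and> x \<in> Even \<or> s = - 1 \<and> x \<in> Odd"
    using assms(1) by (simp add: implements_def homogeneous_def)
  then show thesis
  proof
    assume s: "s = 1 \<and> x \<in> Even"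
    then show thesis
      using Even_central[of x] disc_nonzero eq that by (metis mult_1 of_int_1)
  next
    assume s: "s = - 1 \<and> x \<in> Odd"
    then have "x * vec y1 y2 y3 = - (vec y1 y2 y3 * x)" for y1 y2 y3
      using eq[of y1 y2 y3] by simp
    then have "x = 0" using Odd_anticentral[of x] disc_nonzero s by blast
    with assms(2) show thesis by blast
  qed
qed

lemma act_eq_id: assumes "x \<in> PM" "act x = id" shows "x = 1 \<or> x = - 1"
proof -
  have "implements x (sgn_of x) id" using implements_act[OF assms(1)] assms(2) by simp
  then obtain k where k: "x = of_int k" by (rule implements_id[OF _ PM_nonzero[OF assms(1)]])
  obtain n where n: "x * star x = of_int n" "n = 1 \<or> n = - 1"
    using assms(1) by (rule PM_cases)
  have "of_int (k * k) = (of_int n :: ext_endo)" using n(1) by (simp add: k)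
  then have "k * k = n" unfolding of_int_eq_of_int .
  then have "k = 1 \<or> k = - 1"
    using n(2) zero_le_square[of k] by (auto simp: zmult_eq_1_iff simp del: zero_le_square)
  then show ?thesis by (auto simp: k)
qed

lemma PM_inverse: assumes "x \<in> PM"
  obtains y where "y \<in> PM" "x * y = 1" "y * x = 1" "homogeneous x s \<Longrightarrow> homogeneous y s"
    "y * star y = x * star x"
proof -
  obtain s n where n: "homogeneous x s" "x * star x = of_int n" "n = 1 \<or> n = - 1" "star x * x = of_int n"
    using assms by (rule PM_cases)
  have nn: "of_int n * of_int n = (1 :: ext_endo)" using n(3) by auto
  have h: "homogeneous (of_int n * star x) t" if "homogeneous x t" for t
    using n(3) that homogeneous_star[OF that] by (auto simp: homogeneous_def)
  have x: "x \<in> range cl" using assms by (rule PM_range)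
  have N: "(of_int n * star x) * star (of_int n * star x) = of_int n"
    using n(3,4) star_star[OF x] by (auto simp: star_uminus)
  show thesis
  proof (rule that)
    show "x * (of_int n * star x) = 1" by (simp only: mult_of_int_left n(2) nn)
    show "of_int n * star x * x = 1" by (simp only: mult.assoc n(4) nn)
    show "of_int n * star x \<in> PM" using PM_I[OF h[OF n(1)] N n(3)] .
    show "of_int n * star x * star (of_int n * star x) = x * star x" by (simp only: N n(2))
  qed (rule h)
qed

text \<open>The form is the anticommutator of vectors. Conjugation respects products of two vectors,
  since the parity sign occurs twice, and x can be cancelled on the right because its norm is
  nonzero.\<close>

lemma implements_isometry:
  assumes "implements x s g" "x * star x = of_int n" "n \<noteq> 0"
  shows "additive g" "b (g y) (g z) = b y z"
proof -
  have hs: "homogeneous x s" using assms(1) by (simp add: implements_def)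
  have ss: "s * s = 1" using hs by (rule homogeneousD(2))
  have eq: "\<gamma> (g y) * x = of_int s * (x * \<gamma> y)" for y
  proof -
    have "of_int s * (x * \<gamma> y) = of_int (s * s) * (\<gamma> (g y) * x)"
      using assms(1) by (simp add: implements_def mult.assoc)
    then show ?thesis by (simp add: ss)
  qed
  note cancel = right_cancel[OF homogeneousD(1)[OF hs] assms(2,3)]
  show "additive g"
  proof
    fix y z
    have "\<gamma> (g (y + z)) * x = \<gamma> (g y + g z) * x"
      by (simp add: eq gamma_add distrib_left distrib_right)
    then have "\<gamma> (g (y + z)) = \<gamma> (g y + g z)" by (rule cancel[OF gamma_in_range gamma_in_range])
    then show "g (y + z) = g y + g z" by simp
  qed
  have eq2: "\<gamma> (g y) * \<gamma> (g z) * x = x * (\<gamma> y * \<gamma> z)" for y z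
  proof -
    have "\<gamma> (g y) * \<gamma> (g z) * x = \<gamma> (g y) * (of_int s * (x * \<gamma> z))"
      by (simp only: mult.assoc eq)
    also have "\<dots> = of_int s * ((\<gamma> (g y) * x) * \<gamma> z)"
      by (simp only: mult_of_int_left mult.assoc)
    also have "\<dots> = of_int (s * s) * (x * (\<gamma> y * \<gamma> z))"
      by (simp only: eq of_int_mult mult.assoc)
    finally show ?thesis by (simp add: ss)
  qed
  have "of_int (b (g y) (g z)) * x = (\<gamma> (g y) * \<gamma> (g z) + \<gamma> (g z) * \<gamma> (g y)) * x"
    by (simp only: gamma_anticommutator)
  also have "\<dots> = x * (\<gamma> y * \<gamma> z + \<gamma> z * \<gamma> y)"
    by (simp only: distrib_left distrib_right eq2)
  also have "\<dots> = of_int (b y z) * x"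
    by (simp only: gamma_anticommutator mult_of_int_commute)
  finally have "of_int (b (g y) (g z)) = (of_int (b y z) :: ext_endo)"
    by (rule cancel[OF range_cl_closed(5) range_cl_closed(5)])
  then show "b (g y) (g z) = b y z" unfolding of_int_eq_of_int .
qed

lemma act_in_O: assumes "x \<in> PM" shows "act x \<in> lattice_O b"
proof -
  obtain n where n: "x * star x = of_int n" "n = 1 \<or> n = - 1"
    using assms by (rule PM_cases)
  then have "n \<noteq> 0" by auto
  note iso = implements_isometry[OF implements_act[OF assms] n(1) this]
  obtain y where y: "y \<in> PM" "x * y = 1" "y * x = 1" by (rule PM_inverse[OF assms])
  have "act x \<circ> act y = id" "act y \<circ> act x = id"
    using act_mult[OF assms y(1)] act_mult[OF y(1) assms] by (simp_all add: y act_one)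
  then have "bij (act x)" by (metis o_bij)
  then show ?thesis using iso by (simp add: lattice_O_def)
qed

section \<open>Integrality on dual vectors, and the determinant\<close>

lemma gamma_divisible:
  assumes "\<gamma> y = of_int m * r" "r \<in> range cl"
  obtains z where "y = zmult m z"
proof -
  obtain c where c: "r = cl c" using assms(2) by blast
  obtain c0 c1 c2 c3 c12 c13 c23 c123 where c': "c = Ext c0 c1 c2 c3 c12 c13 c23 c123" by (cases c)
  have "cl (Ext 0 (X1 y) (X2 y) (X3 y) 0 0 0 0) = cl (ext_scale m c)"
    using assms(1) unfolding \<gamma>_def vec_cl c cl_scale .
  then have "X1 y = m * c1" "X2 y = m * c2" "X3 y = m * c3"
    unfolding cl_inject c' by simp_all
  then have "y = zmult m (comb c1 c2 c3)" by (intro coords_eqI) simp_all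
  then show thesis by (rule that)
qed

text \<open>Here y / m stands for a dual vector. The contraction is linear in the pairings of y, so
  their common factor m comes out.\<close>

lemma commutator_divisible:
  assumes "homogeneous x s" "m dvd b e1 y" "m dvd b e2 y" "m dvd b e3 y"
  obtains r where "r \<in> range cl" "x * \<gamma> y - of_int s * (\<gamma> y * x) = of_int m * r"
proof -
  obtain l1 l2 l3 where l: "D1 y = m * l1" "D2 y = m * l2" "D3 y = m * l3"
    using assms(2-4) by (auto simp: dual_basis elim!: dvdE)
  have "s = 1 \<and> x \<in> Even \<or> s = - 1 \<and> x \<in> Odd"
    using assms(1) by (simp add: homogeneous_def)
  then show thesis
  proof
    assume s: "s = 1 \<and> x \<in> Even"
    then obtain a a12 a13 a23 where x: "x = ev a a12 a13 a23" by (auto elim: EvenE)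
    have "x * \<gamma> y - of_int s * (\<gamma> y * x) =
        of_int m * vec (a12 * l2 + a13 * l3) (a23 * l3 - a12 * l1) (- a13 * l1 - a23 * l2)"
      using ev_commutator[of a a12 a13 a23 "X1 y" "X2 y" "X3 y"] s
      by (simp add: x \<gamma>_def l vec_scale algebra_simps)
    then show thesis by (rule that[OF range_cl_closed(8)])
  next
    assume s: "s = - 1 \<and> x \<in> Odd"
    then obtain x1 x2 x3 t where x: "x = od x1 x2 x3 t" by (auto elim: OddE)
    have "x * \<gamma> y - of_int s * (\<gamma> y * x) =
        ev (m * l1 * x1 + m * l2 * x2 + m * l3 * x3) (t * (m * l3)) (- t * (m * l2)) (t * (m * l1))"
      using od_anticommutator[of x1 x2 x3 t "X1 y" "X2 y" "X3 y"] s
      by (simp add: x \<gamma>_def l)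
    also have "\<dots> = of_int m * ev (l1 * x1 + l2 * x2 + l3 * x3) (t * l3) (- t * l2) (t * l1)"
      unfolding ev_def cl_scale cl_inject by (simp add: algebra_simps)
    finally show thesis by (rule that[OF Even_in_range[OF ev_in_Even]])
  qed
qed

text \<open>The dual vector y / m and its image differ by an element of L. The twisted commutator
  is, up to sign, \<open>\<gamma> (act x y - y) * x\<close>; multiplying by \<open>star x\<close>
  isolates the vector because the norm is a unit.\<close>

lemma act_disc:
  assumes "x \<in> PM" "m dvd b e1 y" "m dvd b e2 y" "m dvd b e3 y"
  obtains z where "act x y - y = zmult m z"
proof -
  obtain s n where s: "homogeneous x s" "x * star x = of_int n" "n = 1 \<or> n = - 1" "s = 1 \<or> s = - 1"
    using assms(1) by (rule PM_cases)
  have "x * \<gamma> y = of_int s * (\<gamma> (act x y) * x)"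
    using implements_act[OF assms(1)] sgn_of_eq[OF assms(1) s(1)] by (simp add: implements_def)
  moreover obtain r where r: "r \<in> range cl" "x * \<gamma> y - of_int s * (\<gamma> y * x) = of_int m * r"
    by (rule commutator_divisible[OF s(1) assms(2-4)])
  ultimately have "of_int s * (\<gamma> (act x y - y) * x) = of_int m * r"
    by (simp add: gamma_diff algebra_simps)
  then have "of_int s * (\<gamma> (act x y - y) * (x * star x)) = of_int m * (r * star x)"
    by (metis mult.assoc)
  then have "of_int s * (of_int n * \<gamma> (act x y - y)) = of_int m * (r * star x)"
    by (simp only: s(2) mult_of_int_commute[of n])
  define k where "k = s * n"
  have eq: "of_int k * \<gamma> (act x y - y) = of_int m * (r * star x)"
    using \<open>of_int s * (of_int n * _) = _\<close> by (simp only: k_def of_int_mult mult.assoc)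
  have "\<gamma> (act x y - y) = of_int (k * k) * \<gamma> (act x y - y)"
    using s(3,4) by (auto simp: k_def)
  also have "\<dots> = of_int k * (of_int m * (r * star x))"
    unfolding of_int_mult mult.assoc eq ..
  also have "\<dots> = of_int m * (of_int k * (r * star x))"
    by (rule mult_of_int_left)
  finally have "\<gamma> (act x y - y) = of_int m * (of_int k * (r * star x))" .
  moreover have "of_int k * (r * star x) \<in> range cl"
    using r(1) by (intro range_cl_closed(3,5) star_closed)
  ultimately show thesis
    using that by (rule gamma_divisible)
qed

lemma lattice_det_eq: "lattice_det g =
    det3 (X1 (g e1)) (X2 (g e1)) (X3 (g e1)) (X1 (g e2)) (X2 (g e2)) (X3 (g e2))
      (X1 (g e3)) (X2 (g e3)) (X3 (g e3))"
  unfolding lattice_det_def basis_choice Let_def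
    sum_permutes_3[OF distinct_basis(1-3), of "\<lambda>x. zmod.representation B (g x)"] X1_def X2_def X3_def det3_def ..

lemma top_coeff_add: "top_coeff (c + d) = top_coeff c + top_coeff d"
  by (cases c; cases d) simp

lemma top_coeff_scale: "top_coeff (ext_scale n c) = n * top_coeff c"
  by (cases c) simp

text \<open>Twice \<open>e1 e2 e3\<close> is a central element plus a vector, so its top coefficient is invariant
  under conjugation.\<close>

lemma implements_det:
  assumes "implements x s g" "x * star x = of_int n" "n \<noteq> 0"
  shows "lattice_det g = s"
proof -
  have hs: "homogeneous x s" using assms(1) by (simp add: implements_def)
  have ss: "s * s = 1" using hs by (rule homogeneousD(2))
  obtain c where c: "x = cl c" using Even_Odd_in_range[OF homogeneousD(1)[OF hs]] by blast
  have eq: "x * \<gamma> y = of_int s * (\<gamma> (g y) * x)" for y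
    using assms(1) by (simp add: implements_def)
  define W where "W = \<gamma> e1 * (\<gamma> e2 * \<gamma> e3)"
  define G where "G = \<gamma> (g e1) * (\<gamma> (g e2) * \<gamma> (g e3))"
  define Z where "Z = od (- u) v (- w) 2"
  have ext: "x * (\<gamma> y * r) = of_int s * (\<gamma> (g y) * (x * r))" for y r
    by (simp only: mult.assoc[symmetric] eq)
  \<comment> \<open>Moving x past three vectors contributes \<open>s * s * s = s\<close>.\<close>
  have "x * W = of_int s * (\<gamma> (g e1) * (of_int s * (\<gamma> (g e2) * (of_int s * (\<gamma> (g e3) * x)))))"
    by (simp only: W_def ext eq)
  also have "\<dots> = of_int (s * s * s) * (G * x)"
    by (simp only: G_def mult_of_int_left[of "\<gamma> _"] of_int_mult mult.assoc)
  finally have xW: "x * W = of_int s * (G * x)" by (simp add: ss)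
  \<comment> \<open>Splits \<open>2 e1 e2 e3\<close> into the central element and a vector; the
    factor 2 avoids the halves of an antisymmetrised product.\<close>
  have "od 0 0 0 2 = od (- u) v (- w) 2 + vec u (- v) w"
    unfolding od_def vec_cl cl_add by simp
  then have "of_int 2 * W = Z + \<gamma> (comb u (- v) w)"
    unfolding od_combination[of 0 0 0 2] by (simp add: W_def Z_def vec_gamma)
  then have "x * (of_int 2 * W) = x * Z + x * \<gamma> (comb u (- v) w)"
    by (simp only: distrib_left)
  also have "x * Z = Z * x"
    unfolding Z_def c by (rule pseudoscalar_central)
  also have "x * \<gamma> (comb u (- v) w) = of_int s * (\<gamma> (g (comb u (- v) w)) * x)"
    by (rule eq)
  finally have "of_int 2 * (of_int s * (G * x)) = Z * x + of_int s * (\<gamma> (g (comb u (- v) w)) * x)"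
    by (simp only: mult_of_int_left[of x] xW)
  then have "(of_int (2 * s) * G) * x = (Z + of_int s * \<gamma> (g (comb u (- v) w))) * x"
    by (simp only: of_int_mult mult.assoc distrib_right)
  note eqx = this
  have r1: "of_int (2 * s) * G \<in> range cl"
    unfolding G_def by (intro range_cl_closed(3,5) gamma_in_range)
  have r2: "Z + of_int s * \<gamma> (g (comb u (- v) w)) \<in> range cl"
    unfolding Z_def by (intro range_cl_closed(1,3,5) Odd_in_range od_in_Odd gamma_in_range)
  have "of_int (2 * s) * G = Z + of_int s * \<gamma> (g (comb u (- v) w))"
    by (rule right_cancel[OF homogeneousD(1)[OF hs] assms(2,3) r1 r2 eqx])
  then have "top_coeff (app (of_int (2 * s) * G) unit) = top_coeff (app (Z + of_int s * \<gamma> (g (comb u (- v) w))) unit)"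
    by (simp only:)
  moreover have "app Z unit = Ext 0 (- u) v (- w) 0 0 0 2"
    by (simp only: Z_def od_def app_cl_unit)
  moreover have "top_coeff (app (\<gamma> y) unit) = 0" for y
    by (simp add: \<gamma>_def unit_def)
  moreover have "top_coeff (app G unit) = lattice_det g"
    unfolding G_def \<gamma>_def top_vec3 lattice_det_eq ..
  \<comment> \<open>On the right only the central element has a top coefficient, namely 2.\<close>
  ultimately have "2 * s * lattice_det g = 2"
    by (simp only: app_simps app_of_int top_coeff_add top_coeff_scale) simp
  then have "s * (s * lattice_det g) = s * 1" by simp
  then show ?thesis by (simp add: mult.assoc[symmetric] ss)
qed

section \<open>The action on the discriminant group\<close>

lemma rat_frac_eq: "m \<noteq> 0 \<Longrightarrow> n \<noteq> 0 \<Longrightarrow> rat_frac x m = rat_frac y n \<longleftrightarrow> zmult n x = zmult m (y :: 'a)"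
proof -
  assume "m \<noteq> 0" "n \<noteq> 0"
  moreover have "zmult (k * n) x = zmult (k * m) y \<longleftrightarrow> zmult n x = zmult m y" if "k \<noteq> 0" for k
    using zmult_cancel[OF that, of "zmult n x" "zmult m y"] by (simp add: zmult_zmult)
  ultimately show ?thesis
    by (subst rat_frac_eq_iff) (auto intro: exI[of _ 1])
qed

lemma rat_incl_add_frac: "m \<noteq> 0 \<Longrightarrow> rat_incl l + rat_frac x m = rat_frac (zmult m l + (x :: 'a)) m"
  by (simp add: rat_incl_def rat_frac_add)

abbreviation "F \<equiv> rat_form b"

lemma F_frac: "m \<noteq> 0 \<Longrightarrow> n \<noteq> 0 \<Longrightarrow> F (rat_frac x m) (rat_frac y n) = of_int (b x y) / of_int (m * n)"
  by (rule rat_form_frac; (rule sym | rule add_left | assumption))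

lemma frac_dual_iff: "m \<noteq> 0 \<Longrightarrow> rat_frac x m \<in> dual_lattice b \<longleftrightarrow> (\<forall>y. m dvd b x y)"
proof -
  assume m: "m \<noteq> 0"
  have "(of_int k / of_int m :: rat) \<in> \<int> \<longleftrightarrow> m dvd k" for k
  proof
    assume "(of_int k / of_int m :: rat) \<in> \<int>"
    then obtain l where "of_int k / of_int m = (of_int l :: rat)" by (elim Ints_cases)
    then have "(of_int k :: rat) = of_int (m * l)" using m by (simp add: field_simps)
    then show "m dvd k" unfolding of_int_eq_iff by simp
  next
    assume "m dvd k"
    then obtain l where "k = m * l" by (elim dvdE)
    then show "(of_int k / of_int m :: rat) \<in> \<int>" using m by simp
  qed
  then show ?thesis using m by (simp add: dual_lattice_def rat_incl_def F_frac)
qed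

lemma carrier_disc_group:
  "carrier (disc_group b) = {{rat_incl l + d | l. True} | d. d \<in> dual_lattice b}"
proof -
  have "(\<Union>h\<in>range rat_incl. {h + d}) = {rat_incl l + d | l. True}" for d :: "'a rat_ext"
    by blast
  then show ?thesis
    unfolding disc_group_def FactGroup_def RCOSETS_def r_coset_def by auto
qed

text \<open>A coset of the dual vector x / m is a translate of L, and g maps L onto L; the coset is
  therefore preserved exactly when x / m moves by an element of L.\<close>

lemma disc_trivial_iff:
  assumes "additive g" "surj g"
  shows "g \<in> disc_trivial b G \<longleftrightarrow> g \<in> G \<and>
    (\<forall>x m. m \<noteq> 0 \<longrightarrow> (\<forall>y. m dvd b x y) \<longrightarrow> (\<exists>z. g x - x = zmult m z))"
proof -
  interpret g: additive g by fact
  have gz: "g (zmult m l) = zmult m (g l)" for m l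
    by (rule zmult_additive[OF assms(1)])
  have map: "rat_map g (rat_incl l + rat_frac x m) = rat_frac (zmult m (g l) + g x) m" if "m \<noteq> 0" for l x m
    using that by (simp add: rat_incl_add_frac rat_map_frac[OF assms(1)] g.add gz)
  define coset where "coset d = {rat_incl l + d | l. True}" for d :: "'a rat_ext"
  have key0: "rat_map g ` {rat_incl l + rat_frac x m | l. True} = {rat_incl l + rat_frac x m | l. True}
     \<longleftrightarrow> (\<exists>z. g x - x = zmult m z)" if m: "m \<noteq> 0" for x m
  proof
    assume *: "rat_map g ` {rat_incl l + rat_frac x m | l. True} = {rat_incl l + rat_frac x m | l. True}"
    have "rat_map g (rat_incl 0 + rat_frac x m) \<in> rat_map g ` {rat_incl l + rat_frac x m | l. True}"
      by blast
    then obtain l where "rat_map g (rat_incl 0 + rat_frac x m) = rat_incl l + rat_frac x m"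
      unfolding * by blast
    then have "rat_frac (g x) m = rat_frac (zmult m l + x) m"
      using m map[OF m, of 0 x] g.zero by (simp add: rat_incl_add_frac)
    then have "g x = zmult m l + x"
      using m by (simp add: rat_frac_eq zmult_cancel)
    then show "\<exists>z. g x - x = zmult m z" by auto
  next
    assume "\<exists>z. g x - x = zmult m z"
    then obtain z where z: "g x = zmult m z + x" by (metis diff_add_cancel)
    have eq: "rat_map g (rat_incl l + rat_frac x m) = rat_incl (g l + z) + rat_frac x m" for l
      using map[OF m, of l x] rat_incl_add_frac[OF m, of "g l + z" x]
      by (simp only: z zmult_add_right add.assoc)
    \<comment> \<open>Surjectivity of g enters because the coset must be equal to its image, not
      merely contain it.\<close>
    have "\<exists>l'. rat_incl l + rat_frac x m = rat_map g (rat_incl l' + rat_frac x m)" for l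
    proof -
      obtain l' where "l - z = g l'" using assms(2) by (rule surjE)
      then have "g l' + z = l" by (metis diff_add_cancel)
      then show ?thesis using eq[of l'] by metis
    qed
    note pre = this
    show "rat_map g ` {rat_incl l + rat_frac x m | l. True} = {rat_incl l + rat_frac x m | l. True}"
    proof (intro subset_antisym subsetI)
      fix c assume "c \<in> rat_map g ` {rat_incl l + rat_frac x m | l. True}"
      then obtain l where "c = rat_map g (rat_incl l + rat_frac x m)" by blast
      then show "c \<in> {rat_incl l + rat_frac x m | l. True}" unfolding eq by blast
    next
      fix c assume "c \<in> {rat_incl l + rat_frac x m | l. True}"
      then obtain l where "c = rat_incl l + rat_frac x m" by blast
      then obtain l' where "c = rat_map g (rat_incl l' + rat_frac x m)" using pre[of l] by metis
      then show "c \<in> rat_map g ` {rat_incl l + rat_frac x m | l. True}" by blast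
    qed
  qed
  have key1: "rat_map g ` coset (rat_frac x m) = coset (rat_frac x m) \<longleftrightarrow> (\<exists>z. g x - x = zmult m z)"
    if "m \<noteq> 0" for x m
    unfolding coset_def by (rule key0[OF that])
  have car: "c \<in> carrier (disc_group b) \<longleftrightarrow> (\<exists>d\<in>dual_lattice b. c = coset d)" for c
    unfolding carrier_disc_group coset_def by blast
  have key2: "(\<forall>c\<in>carrier (disc_group b). rat_map g ` c = c) \<longleftrightarrow>
    (\<forall>x m. m \<noteq> 0 \<longrightarrow> rat_frac x m \<in> dual_lattice b \<longrightarrow>
      rat_map g ` coset (rat_frac x m) = coset (rat_frac x m))"
    unfolding Ball_def car using rat_frac_cases by metis
  show ?thesis
    unfolding disc_trivial_def mem_Collect_eq key2 using key1 frac_dual_iff by metis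
qed

lemma lattice_OD: assumes "g \<in> lattice_O b"
  shows "additive g" "surj g" "bij g" "b (g x) (g y) = b x y"
  using assms by (auto simp: lattice_O_def bij_def)

lemma act_disc_trivial: assumes "x \<in> PM" "act x \<in> G" shows "act x \<in> disc_trivial b G"
proof -
  have "\<exists>z. act x y - y = zmult m z" if "\<forall>z. m dvd b y z" for y m
  proof -
    have "m dvd b e1 y" "m dvd b e2 y" "m dvd b e3 y" using that sym by metis+
    then obtain z where "act x y - y = zmult m z" by (rule act_disc[OF assms(1)])
    then show ?thesis by blast
  qed
  then show ?thesis
    using disc_trivial_iff[OF lattice_OD(1,2)[OF act_in_O[OF assms(1)]]] assms(2) by blast
qed

section \<open>The rational quadratic space and its reflections\<close>

lemma F_sym: "F x y = F y x"
proof -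
  obtain a m where x: "x = rat_frac a m" "m \<noteq> 0" by (rule rat_frac_cases)
  obtain c n where y: "y = rat_frac c n" "n \<noteq> 0" by (rule rat_frac_cases)
  show ?thesis
    unfolding x(1) y(1) F_frac[OF x(2) y(2)] F_frac[OF y(2) x(2)] sym[of a c] mult.commute[of m n] ..
qed

lemma F_add_left: "F (x + y) z = F x z + F y z"
proof -
  obtain a m where x: "x = rat_frac a m" "m \<noteq> 0" by (rule rat_frac_cases)
  obtain c n where y: "y = rat_frac c n" "n \<noteq> 0" by (rule rat_frac_cases)
  obtain d k where z: "z = rat_frac d k" "k \<noteq> 0" by (rule rat_frac_cases)
  have "F (x + y) z = of_int (b (zmult n a + zmult m c) d) / of_int (m * n * k)"
    unfolding x(1) y(1) z(1) rat_frac_add[OF x(2) y(2)] by (rule F_frac) (use x y z in simp_all)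
  also have "\<dots> = of_int (n * b a d) / of_int (m * n * k) + of_int (m * b c d) / of_int (m * n * k)"
    by (simp only: add_left zmult_left of_int_add add_divide_distrib)
  also have "of_int (n * b a d) / of_int (m * n * k) = (of_int (b a d) / of_int (m * k) :: rat)"
    using y(2) by simp
  also have "of_int (m * b c d) / of_int (m * n * k) = (of_int (b c d) / of_int (n * k) :: rat)"
    using x(2) by simp
  also have "of_int (b a d) / of_int (m * k) = F x z"
    unfolding x(1) z(1) by (rule F_frac[OF x(2) z(2), symmetric])
  also have "of_int (b c d) / of_int (n * k) = F y z"
    unfolding y(1) z(1) by (rule F_frac[OF y(2) z(2), symmetric])
  finally show ?thesis .
qed

lemma F_scale_left: "F (qscale r x) y = r * F x y"
proof -
  obtain k l where r: "r = Rat.Fract k l" "l \<noteq> 0" by (cases r) auto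
  obtain a m where x: "x = rat_frac a m" "m \<noteq> 0" by (rule rat_frac_cases)
  obtain c n where y: "y = rat_frac c n" "n \<noteq> 0" by (rule rat_frac_cases)
  show ?thesis
    unfolding r(1) x(1) y(1) qscale_frac[OF r(2) x(2)]
    using r(2) x(2) y(2) by (simp add: F_frac zmult_left Fract_of_int_quotient)
qed

lemma F_add_right: "F x (y + z) = F x y + F x z"
  using F_add_left[of y z x] F_sym[of x y] F_sym[of x z] F_sym[of x "y + z"] by simp

lemma F_scale_right: "F x (qscale r y) = r * F x y"
  using F_scale_left[of r y x] F_sym[of x y] F_sym[of x "qscale r y"] by simp

lemma F_minus_left: "F (- x) y = - F x y"
  using F_add_left[of x "- x" y] F_scale_left[of 0 x y] by simp

lemma F_diff_left: "F (x - y) z = F x z - F y z"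
  using F_add_left[of x "- y" z] F_minus_left[of y z] by simp

lemma F_diff_right: "F x (y - z) = F x y - F x z"
  using F_diff_left[of y z x] F_sym[of x y] F_sym[of x z] F_sym[of x "y - z"] by simp

lemma F_0: "F 0 x = 0" "F x 0 = 0"
  using F_diff_left[of 0 0 x] F_sym[of x 0] by simp_all

lemma F_nondegenerate: assumes "x \<noteq> 0" obtains y where "F x y \<noteq> 0"
proof -
  obtain a m where x: "x = rat_frac a m" "m \<noteq> 0" by (rule rat_frac_cases)
  have "rat_frac 0 m + rat_frac 0 m = (rat_frac 0 m :: 'a rat_ext)"
    using rat_frac_cancel[of m m "0 :: 'a"] x(2) by (simp add: rat_frac_add)
  then have "rat_frac 0 m = (0 :: 'a rat_ext)" by simp
  then have "a \<noteq> 0" using assms x by auto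
  then obtain y where "b a y \<noteq> 0" using nondegenerate by blast
  then have "F x (rat_frac y 1) \<noteq> 0" using x by (simp add: F_frac)
  then show thesis by (rule that)
qed

abbreviation "R \<equiv> rat_reflection b"

lemma R_add: "R r (x + y) = R r x + R r y"
proof -
  have "2 * F (x + y) r / F r r = 2 * F x r / F r r + 2 * F y r / F r r"
    by (simp add: F_add_left add_divide_distrib)
  then show ?thesis
    by (simp add: rat_reflection_def rat_ext.scale_left_distrib)
qed

lemma R_scale: "R r (qscale c x) = qscale c (R r x)"
proof -
  have "2 * F (qscale c x) r / F r r = c * (2 * F x r / F r r)"
    by (simp add: F_scale_left)
  then show ?thesis
    by (simp add: rat_reflection_def rat_ext.scale_right_diff_distrib)
qed

lemma R_self: "F r r \<noteq> 0 \<Longrightarrow> R r r = - r"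
  using rat_ext.scale_left_distrib[of 1 1 r] by (simp add: rat_reflection_def)

lemma F_R: assumes "F r r \<noteq> 0" shows "F (R r x) (R r y) = F x y"
proof -
  have "F (R r x) (R r y) = F x y - 2 * F y r / F r r * F x r - 2 * F x r / F r r * F y r
      + 2 * F x r / F r r * (2 * F y r / F r r * F r r)"
    using F_sym[of r y]
    by (simp only: rat_reflection_def F_diff_left F_diff_right F_scale_left F_scale_right) (simp add: algebra_simps)
  also have "\<dots> = F x y" using assms by simp
  finally show ?thesis .
qed

lemma R_fix: "F x r = 0 \<Longrightarrow> R r x = x"
  by (simp add: rat_reflection_def)

lemma R_involution: assumes "F r r \<noteq> 0" shows "R r (R r x) = x"
proof -
  have eq: "F (R r x) r = - F x r"
    using assms by (simp add: rat_reflection_def F_diff_left F_scale_left)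
  show ?thesis
    unfolding rat_reflection_def[of b r "R r x"] eq by (simp add: rat_reflection_def)
qed

lemma R_in_O: assumes "F r r \<noteq> 0" shows "R r \<in> rat_O b"
proof -
  have "Vector_Spaces.linear qscale qscale (R r)"
    using R_add R_scale by (intro Vector_Spaces.linear_iff[THEN iffD2]) (simp add: rat_ext.vector_space_axioms)
  moreover have "bij (R r)"
    using R_involution[OF assms] by (intro o_bij[of "R r"]) (simp_all add: fun_eq_iff)
  ultimately show ?thesis
    using F_R[OF assms] by (simp add: rat_O_def)
qed

section \<open>Generation by reflections\<close>

lemma mem_rat_O: "g \<in> rat_O b \<longleftrightarrow> (\<forall>x y. g (x + y) = g x + g y) \<and> (\<forall>c x. g (qscale c x) = qscale c (g x))
    \<and> bij g \<and> (\<forall>x y. F (g x) (g y) = F x y)"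
  unfolding rat_O_def Vector_Spaces.linear_iff using rat_ext.vector_space_axioms by blast

lemma rat_O_comp: assumes "g \<in> rat_O b" "h \<in> rat_O b" shows "g \<circ> h \<in> rat_O b"
  using assms unfolding mem_rat_O by (simp add: bij_comp)

lemma rat_O_id: "id \<in> rat_O b"
  unfolding mem_rat_O by simp

inductive_set refl_gen :: "('a rat_ext \<Rightarrow> 'a rat_ext) set" where
  refl_gen_id: "id \<in> refl_gen"
| refl_gen_step: "F r r \<noteq> 0 \<Longrightarrow> g \<in> refl_gen \<Longrightarrow> R r \<circ> g \<in> refl_gen"

lemma refl_gen_R: "F r r \<noteq> 0 \<Longrightarrow> R r \<in> refl_gen"
  using refl_gen_step[OF _ refl_gen_id] by simp

lemma refl_gen_comp: "g \<in> refl_gen \<Longrightarrow> h \<in> refl_gen \<Longrightarrow> g \<circ> h \<in> refl_gen"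
proof (induction rule: refl_gen.induct)
  case (refl_gen_step r g)
  then show ?case unfolding comp_assoc using refl_gen.refl_gen_step by blast
next
  case refl_gen_id
  then show ?case by (simp only: id_comp)
qed

lemma refl_gen_inverse: "g \<in> refl_gen \<Longrightarrow> \<exists>h\<in>refl_gen. h \<circ> g = id"
proof (induction rule: refl_gen.induct)
  case refl_gen_id
  show ?case using refl_gen.refl_gen_id by (intro bexI[of _ id]) simp_all
next
  case (refl_gen_step r g)
  then obtain h where h: "h \<in> refl_gen" "h \<circ> g = id" by blast
  have "R r \<circ> R r = id" using R_involution[OF refl_gen_step(1)] by (simp add: fun_eq_iff)
  then have "(h \<circ> R r) \<circ> (R r \<circ> g) = id" using h(2) by (metis comp_assoc comp_id)
  moreover have "h \<circ> R r \<in> refl_gen" using refl_gen_comp h(1) refl_gen_R[OF refl_gen_step(1)] by blast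
  ultimately show ?case by blast
qed

definition orthogonal_set :: "'a rat_ext set \<Rightarrow> bool" where
  "orthogonal_set S \<longleftrightarrow> finite S \<and> (\<forall>x\<in>S. F x x \<noteq> 0) \<and> (\<forall>x\<in>S. \<forall>y\<in>S. x \<noteq> y \<longrightarrow> F x y = 0)"

lemma orthogonal_set_independent: assumes "orthogonal_set S" shows "rat_ext.independent S"
proof
  assume "rat_ext.dependent S"
  then obtain a where a: "a \<in> S" "a \<in> rat_ext.span (S - {a})"
    unfolding rat_ext.dependent_def by blast
  have "rat_ext.subspace {y. F y a = 0}"
    by (rule rat_ext.subspaceI) (simp_all add: F_0 F_add_left F_scale_left)
  moreover have "S - {a} \<subseteq> {y. F y a = 0}"
    using a(1) assms by (auto simp: orthogonal_set_def)
  ultimately have "rat_ext.span (S - {a}) \<subseteq> {y. F y a = 0}"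
    by (rule rat_ext.span_minimal[rotated])
  with a(2) have "F a a = 0" by blast
  with a(1) assms show False by (simp add: orthogonal_set_def)
qed

lemma rat_incl_add: "rat_incl (x + y) = rat_incl x + rat_incl (y :: 'a)"
  by (simp add: rat_incl_def rat_frac_add)

lemma rat_frac_scale: "m \<noteq> 0 \<Longrightarrow> rat_frac (x :: 'a) m = qscale (Rat.Fract 1 m) (rat_incl x)"
  by (simp add: rat_incl_def qscale_frac)

lemma rat_incl_zmult: "rat_incl (zmult n x) = qscale (of_int n) (rat_incl (x :: 'a))"
proof -
  have "(of_int n :: rat) = Rat.Fract n 1" by (simp add: Fract_of_int_quotient)
  then show ?thesis by (simp add: rat_incl_def qscale_frac)
qed

lemma span_rat_incl_basis: "rat_ext.span (rat_incl ` B) = UNIV"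
proof -
  have "rat_incl x \<in> rat_ext.span (rat_incl ` B)" for x
  proof -
    have "rat_incl x = qscale (of_int (X1 x)) (rat_incl e1) + qscale (of_int (X2 x)) (rat_incl e2)
        + qscale (of_int (X3 x)) (rat_incl e3)"
      by (subst comb_coords[of x, symmetric]) (simp only: comb_def rat_incl_add rat_incl_zmult)
    also have "\<dots> \<in> rat_ext.span (rat_incl ` B)"
      by (intro rat_ext.span_add rat_ext.span_scale rat_ext.span_base) simp_all
    finally show ?thesis .
  qed
  note incl = this
  have "q \<in> rat_ext.span (rat_incl ` B)" for q
  proof -
    obtain x m where q: "q = rat_frac x m" "m \<noteq> 0" by (rule rat_frac_cases)
    show ?thesis unfolding q(1) rat_frac_scale[OF q(2)] by (rule rat_ext.span_scale[OF incl])
  qed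
  then show ?thesis by blast
qed

text \<open>Orthogonal anisotropic vectors are independent in a space spanned by three vectors; the
  bound terminates the construction of an orthogonal basis.\<close>

lemma orthogonal_set_card: assumes "orthogonal_set S" shows "card S \<le> 3"
proof -
  have "card S \<le> card (rat_incl ` B)"
    using rat_ext.independent_span_bound[of "rat_incl ` B" S] orthogonal_set_independent[OF assms]
      span_rat_incl_basis by simp
  also have "\<dots> \<le> card B" by (rule card_image_le) simp
  also have "\<dots> \<le> 3" by simp
  finally show ?thesis .
qed

text \<open>Despite the name, the residue of x orthogonal to S. For an orthogonal set S it vanishes
  for all x exactly when S spans.\<close>

definition proj :: "'a rat_ext set \<Rightarrow> 'a rat_ext \<Rightarrow> 'a rat_ext" where
  "proj S x = x - (\<Sum>y\<in>S. qscale (F x y / F y y) y)"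

lemma F_sum_left: "F (sum f S) y = (\<Sum>x\<in>S. F (f x) y)"
  by (induction S rule: infinite_finite_induct) (simp_all add: F_0 F_add_left)

lemma F_proj: assumes "orthogonal_set S" "y \<in> S" shows "F (proj S x) y = 0"
proof -
  have "(\<Sum>z\<in>S. F (qscale (F x z / F z z) z) y) = F (qscale (F x y / F y y) y) y
      + (\<Sum>z\<in>S - {y}. F (qscale (F x z / F z z) z) y)"
    using assms by (intro sum.remove) (simp_all add: orthogonal_set_def)
  also have "(\<Sum>z\<in>S - {y}. F (qscale (F x z / F z z) z) y) = 0"
    using assms by (intro sum.neutral) (auto simp: orthogonal_set_def F_scale_left)
  also have "F (qscale (F x y / F y y) y) y = F x y"
    using assms by (simp add: orthogonal_set_def F_scale_left)
  finally show ?thesis by (simp add: proj_def F_diff_left F_sum_left)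
qed

lemma F_proj_proj: assumes "orthogonal_set S" shows "F (proj S x) (proj S y) = F (proj S x) y"
proof -
  have "F (\<Sum>z\<in>S. qscale (F y z / F z z) z) (proj S x) = 0"
    unfolding F_sum_left
  proof (intro sum.neutral ballI)
    fix z assume "z \<in> S"
    then show "F (qscale (F y z / F z z) z) (proj S x) = 0"
      using F_proj[OF assms, of z x] F_sym[of z "proj S x"] by (simp add: F_scale_left)
  qed
  then show ?thesis
    unfolding proj_def[of S y] F_diff_right by (simp add: F_sym[of "proj S x" "sum _ _"])
qed

text \<open>A nonzero residue pairs nontrivially with another residue. If both are isotropic, their
  sum is anisotropic by polarisation.\<close>

lemma orthogonal_extend:
  assumes "orthogonal_set S" "proj S x \<noteq> 0"
  obtains a where "a \<notin> S" "orthogonal_set (insert a S)"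
proof -
  obtain y where "F (proj S x) y \<noteq> 0" using F_nondegenerate[OF assms(2)] by blast
  then have ne: "F (proj S x) (proj S y) \<noteq> 0" by (simp add: F_proj_proj[OF assms(1)])
  have sq: "F (proj S x + proj S y) (proj S x + proj S y) = F (proj S x) (proj S x)
      + F (proj S y) (proj S y) + 2 * F (proj S x) (proj S y)"
    using F_sym[of "proj S y" "proj S x"] by (simp add: F_add_left F_add_right)
  have "\<exists>a. F a a \<noteq> 0 \<and> (\<forall>z\<in>S. F a z = 0)"
  proof (cases "F (proj S x) (proj S x) = 0 \<and> F (proj S y) (proj S y) = 0")
    case True
    then have "F (proj S x + proj S y) (proj S x + proj S y) \<noteq> 0" using sq ne by simp
    then show ?thesis using F_proj[OF assms(1)] by (intro exI[of _ "proj S x + proj S y"]) (simp add: F_add_left)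
  next
    case False
    then show ?thesis using F_proj[OF assms(1)] by blast
  qed
  then obtain a where a: "F a a \<noteq> 0" "\<And>z. z \<in> S \<Longrightarrow> F a z = 0" by blast
  have "a \<notin> S" using a by blast
  moreover have "F z a = 0" if "z \<in> S" for z using a(2)[OF that] F_sym[of z a] by simp
  then have "orthogonal_set (insert a S)"
    using assms(1) a by (auto simp: orthogonal_set_def)
  ultimately show thesis by (rule that)
qed

lemma orthogonal_basis: "orthogonal_set S \<Longrightarrow> \<exists>T. orthogonal_set T \<and> (\<forall>x. proj T x = 0)"
proof (induction "3 - card S" arbitrary: S rule: less_induct)
  case less
  show ?case
  proof (cases "\<forall>x. proj S x = 0")
    case True
    then show ?thesis using less.prems by blast
  next
    case False
    then obtain a where a: "a \<notin> S" "orthogonal_set (insert a S)"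
      using orthogonal_extend[OF less.prems] by blast
    have "finite S" using less.prems by (simp add: orthogonal_set_def)
    then have "card (insert a S) = Suc (card S)" using a(1) by simp
    \<comment> \<open>The bound on the larger set ensures that the truncated difference
      \<open>3 - card S\<close> really decreases.\<close>
    moreover have "card (insert a S) \<le> 3" by (rule orthogonal_set_card[OF a(2)])
    ultimately have "3 - card (insert a S) < 3 - card S" by simp
    then show ?thesis using less.hyps a(2) by blast
  qed
qed

text \<open>The reflection in c - a sends c to a if c - a is anisotropic. Otherwise F(c + a, c + a)
  = 4 F(a, a) is nonzero, and the reflection in c + a sends c to -a, which the reflection in a
  corrects.\<close>

lemma reflect_onto:
  assumes "F a a \<noteq> 0" "F c c = F a a"
  obtains \<rho> where "\<rho> \<in> refl_gen" "\<rho> c = a" "\<forall>t. F t a = 0 \<longrightarrow> F t c = 0 \<longrightarrow> \<rho> t = t"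
proof (cases "F (c - a) (c - a) = 0")
  case False
  have "F (c - a) (c - a) = 2 * F c (c - a)"
    using assms F_sym[of a c] by (simp add: F_diff_left F_diff_right)
  then have "2 * F c (c - a) / F (c - a) (c - a) = 1" using False by simp
  then have 1: "R (c - a) c = a" by (simp add: rat_reflection_def)
  have 2: "R (c - a) t = t" if "F t a = 0" "F t c = 0" for t
    using that by (intro R_fix) (simp add: F_diff_right)
  show thesis by (rule that[OF refl_gen_R[OF False] 1]) (use 2 in blast)
next
  case True
  have "F (c + a) (c + a) = 2 * F c (c + a)"
    using assms F_sym[of a c] by (simp add: F_add_left F_add_right)
  moreover have eq: "F (c + a) (c + a) = 4 * F a a"
    using True assms F_sym[of a c] by (simp add: F_add_left F_add_right F_diff_left F_diff_right)
  ultimately have "2 * F c (c + a) / F (c + a) (c + a) = 1" using assms(1) by simp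
  then have 1: "R (c + a) c = - a" by (simp add: rat_reflection_def)
  have "R a (- a) = a" using R_scale[of a "- 1" a] R_self[OF assms(1)] by simp
  with 1 have 2: "(R a \<circ> R (c + a)) c = a" by simp
  have 3: "(R a \<circ> R (c + a)) t = t" if "F t a = 0" "F t c = 0" for t
    using that R_fix[of t "c + a"] R_fix[of t a] by (simp add: F_add_right)
  have "F (c + a) (c + a) \<noteq> 0" using assms(1) eq by simp
  then have 4: "R a \<circ> R (c + a) \<in> refl_gen"
    by (rule refl_gen_comp[OF refl_gen_R[OF assms(1)] refl_gen_R])
  show thesis by (rule that[OF 4 2]) (use 3 in blast)
qed

lemma refl_gen_O: "g \<in> refl_gen \<Longrightarrow> g \<in> rat_O b"
proof (induction rule: refl_gen.induct)
  case refl_gen_id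
  show ?case by (rule rat_O_id)
next
  case (refl_gen_step r g)
  show ?case by (rule rat_O_comp[OF R_in_O[OF refl_gen_step(1)] refl_gen_step(3)])
qed

text \<open>The weak Cartan--Dieudonne theorem, without a bound on the number of reflections.\<close>

lemma rat_O_refl_gen: assumes g: "g \<in> rat_O b" shows "g \<in> refl_gen"
proof -
  have "orthogonal_set {}" by (simp add: orthogonal_set_def)
  then obtain S where S: "orthogonal_set S" "\<And>x. proj S x = 0" using orthogonal_basis by blast
  have iso: "F (h x) (h y) = F x y" if "h \<in> rat_O b" for h x y
    using that unfolding mem_rat_O by blast
  \<comment> \<open>Corrects g on one vector of the orthogonal basis at a time. The vectors already
    treated are orthogonal to the next one and to its current image, so \<open>reflect_onto\<close>
    leaves them fixed.\<close>
  have fix_subset: "T \<subseteq> S \<Longrightarrow> \<exists>\<rho>\<in>refl_gen. \<forall>t\<in>T. \<rho> (g t) = t" if "finite T" for T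
    using that
  proof (induction T rule: finite_induct)
    case empty
    show ?case using refl_gen_id by blast
  next
    case (insert a T)
    then obtain \<rho> where \<rho>: "\<rho> \<in> refl_gen" "\<And>t. t \<in> T \<Longrightarrow> \<rho> (g t) = t" by blast
    have h: "\<rho> \<circ> g \<in> rat_O b" using rat_O_comp[OF refl_gen_O[OF \<rho>(1)] g] .
    have a: "F a a \<noteq> 0" "F t a = 0" if "t \<in> T" for t
      using S(1) insert.prems insert.hyps(2) that by (auto simp: orthogonal_set_def)
    have aa: "F a a \<noteq> 0" using S(1) insert.prems by (simp add: orthogonal_set_def)
    have norm: "F (\<rho> (g a)) (\<rho> (g a)) = F a a" using iso[OF h, of a a] by simp
    obtain \<sigma> where \<sigma>: "\<sigma> \<in> refl_gen" "\<sigma> (\<rho> (g a)) = a"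
      "\<forall>t. F t a = 0 \<longrightarrow> F t (\<rho> (g a)) = 0 \<longrightarrow> \<sigma> t = t"
      by (rule reflect_onto[OF aa norm])
    have "\<sigma> (\<rho> (g t)) = t" if "t \<in> T" for t
    proof -
      have "F t (\<rho> (g a)) = 0" using iso[OF h, of t a] \<rho>(2)[OF that] a(2)[OF that] by simp
      then show ?thesis using \<sigma>(3) a(2)[OF that] \<rho>(2)[OF that] by simp
    qed
    then have "\<forall>t\<in>insert a T. (\<sigma> \<circ> \<rho>) (g t) = t" using \<sigma>(2) by simp
    then show ?case using refl_gen_comp[OF \<sigma>(1) \<rho>(1)] by blast
  qed
  have "finite S" using S(1) by (simp add: orthogonal_set_def)
  then obtain \<rho> where \<rho>: "\<rho> \<in> refl_gen" "\<And>t. t \<in> S \<Longrightarrow> \<rho> (g t) = t"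
    using fix_subset[OF _ subset_refl] by blast
  have h: "\<rho> \<circ> g \<in> rat_O b" using rat_O_comp[OF refl_gen_O[OF \<rho>(1)] g] .
  have add: "\<rho> (g (x + y)) = \<rho> (g x) + \<rho> (g y)" for x y
    using conjunct1[OF h[unfolded mem_rat_O]] by (simp only: comp_apply)
  have scale: "\<rho> (g (qscale c x)) = qscale c (\<rho> (g x))" for c x
    using conjunct1[OF conjunct2[OF h[unfolded mem_rat_O]]] by (simp only: comp_apply)
  have "\<rho> (g 0) = 0" using scale[of 0 0] by simp
  then have sum: "\<rho> (g (sum f A)) = (\<Sum>x\<in>A. \<rho> (g (f x)))" for f and A :: "'a rat_ext set"
    by (induction A rule: infinite_finite_induct) (simp_all add: add)
  have "\<rho> (g x) = x" for x
  proof -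
    have x: "x = (\<Sum>y\<in>S. qscale (F x y / F y y) y)" 
      using S(2)[of x] unfolding proj_def by (rule eq_iff_diff_eq_0[THEN iffD2])
    have "\<rho> (g (\<Sum>y\<in>S. qscale (F x y / F y y) y)) = (\<Sum>y\<in>S. qscale (F x y / F y y) y)"
      unfolding sum by (intro sum.cong refl) (simp add: scale \<rho>(2))
    then show ?thesis unfolding x[symmetric] .
  qed
  then have \<rho>g: "\<rho> \<circ> g = id" by (simp add: fun_eq_iff)
  obtain \<sigma> where \<sigma>: "\<sigma> \<in> refl_gen" "\<sigma> \<circ> \<rho> = id" using refl_gen_inverse[OF \<rho>(1)] by blast
  have "g = (\<sigma> \<circ> \<rho>) \<circ> g" by (simp only: \<sigma>(2) id_comp)
  also have "\<dots> = \<sigma>" by (simp only: comp_assoc \<rho>g comp_id)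
  finally show ?thesis using \<sigma>(1) by (simp only:)
qed

section \<open>The spinor norm\<close>

text \<open>Implementation of a rational isometry by an integral element: values on L determine the
  isometry by linearity, and the denominator m of each value is multiplied out.\<close>

definition rat_implements :: "ext_endo \<Rightarrow> int \<Rightarrow> ('a rat_ext \<Rightarrow> 'a rat_ext) \<Rightarrow> bool" where
  "rat_implements x s G \<longleftrightarrow> homogeneous x s \<and> (\<forall>y. \<exists>z m. m \<noteq> 0 \<and> G (rat_incl y) = rat_frac z m
     \<and> of_int m * (x * \<gamma> y) = of_int s * (\<gamma> z * x))"

lemma homogeneous_range: "homogeneous x s \<Longrightarrow> x \<in> range cl"
  using Even_Odd_in_range[OF homogeneousD(1)] .

lemma rat_implements_any:
  assumes "rat_implements x s G" "m \<noteq> 0" "G (rat_incl y) = rat_frac z m"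
  shows "of_int m * (x * \<gamma> y) = of_int s * (\<gamma> z * x)"
proof -
  obtain z' m' where z': "m' \<noteq> 0" "G (rat_incl y) = rat_frac z' m'" "of_int m' * (x * \<gamma> y) = of_int s * (\<gamma> z' * x)"
    using assms(1) unfolding rat_implements_def by blast
  have x: "x \<in> range cl" using assms(1) homogeneous_range unfolding rat_implements_def by blast
  have "rat_frac z m = rat_frac z' m'" using assms(3) z'(2) by simp
  then have zz: "zmult m' z = zmult m z'" using assms(2) z'(1) by (simp add: rat_frac_eq)
  have "of_int m' * (of_int m * (x * \<gamma> y)) = of_int m * (of_int m' * (x * \<gamma> y))"
    by (rule mult_of_int_left)
  also have "\<dots> = of_int m * (of_int s * (\<gamma> z' * x))" by (simp only: z'(3))
  also have "\<dots> = of_int s * (of_int m * (\<gamma> z' * x))" by (rule mult_of_int_left)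
  also have "of_int m * (\<gamma> z' * x) = \<gamma> (zmult m z') * x" by (simp only: gamma_zmult mult.assoc)
  also have "\<dots> = of_int m' * (\<gamma> z * x)" by (simp only: zz[symmetric] gamma_zmult mult.assoc)
  also have "of_int s * (of_int m' * (\<gamma> z * x)) = of_int m' * (of_int s * (\<gamma> z * x))"
    by (rule mult_of_int_left)
  finally show ?thesis
    by (rule of_int_mult_cancel[OF _ _ z'(1), rotated 2]) (intro range_cl_closed(3,5) x gamma_in_range)+
qed

text \<open>Since \<open>x y = b x y - y x\<close>, a vector implements the reflection in itself
  with the odd sign. With \<open>k = b x x\<close> the image of y is
  \<open>(k y - 2 (b y x) x) / k\<close>, in which the denominator m has cancelled.\<close>

lemma rat_implements_reflection:
  assumes "m \<noteq> 0" "b x x \<noteq> 0"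
  shows "rat_implements (\<gamma> x) (- 1) (R (rat_frac x m))"
proof -
  define k where "k = b x x"
  have k: "k \<noteq> 0" using assms(2) by (simp add: k_def)
  have k2: "2 * (k div 2) = k" using even_square[of x] by (simp add: k_def)
  have "R (rat_frac x m) (rat_incl y) = rat_frac (zmult k y - zmult (2 * b y x) x) k \<and>
    of_int k * (\<gamma> x * \<gamma> y) = of_int (- 1) * (\<gamma> (zmult k y - zmult (2 * b y x) x) * \<gamma> x)" for y
  proof
    have "2 * F (rat_incl y) (rat_frac x m) / F (rat_frac x m) (rat_frac x m) = Rat.Fract (2 * b y x * m) k"
      using assms(1) k by (simp add: rat_incl_def F_frac k_def[symmetric] Fract_of_int_quotient)
    then have eq: "qscale (2 * F (rat_incl y) (rat_frac x m) / F (rat_frac x m) (rat_frac x m)) (rat_frac x m)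
        = rat_frac (zmult (2 * b y x * m) x) (k * m)"
      using qscale_frac[OF k assms(1), of "2 * b y x * m" x] by simp
    have "rat_incl y = rat_frac (zmult k y - zmult (2 * b y x) x) k + rat_frac (zmult (2 * b y x * m) x) (k * m)"
      using assms(1) k
      by (simp add: rat_incl_def rat_frac_add rat_frac_eq zmod.scale_right_diff_distrib zmult_zmult mult_ac)
    then show "R (rat_frac x m) (rat_incl y) = rat_frac (zmult k y - zmult (2 * b y x) x) k"
      unfolding rat_reflection_def eq by (simp add: diff_eq_eq)
    have a: "\<gamma> y * \<gamma> x = of_int (b y x) - \<gamma> x * \<gamma> y"
      using gamma_anticommutator[of y x] by (simp add: eq_diff_eq)
    have "\<gamma> (zmult k y - zmult (2 * b y x) x) * \<gamma> x
        = of_int k * (of_int (b y x) - \<gamma> x * \<gamma> y) - of_int (2 * b y x) * of_int (k div 2)"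
      by (simp only: gamma_diff gamma_zmult left_diff_distrib mult.assoc a gamma_square k_def)
    also have "\<dots> = of_int (k * b y x) - of_int k * (\<gamma> x * \<gamma> y) - of_int (b y x * (2 * (k div 2)))"
      by (simp only: right_diff_distrib of_int_mult[symmetric] mult_ac)
    also have "\<dots> = - (of_int k * (\<gamma> x * \<gamma> y))"
      unfolding k2 by (simp add: mult.commute[of k])
    finally show "of_int k * (\<gamma> x * \<gamma> y) = of_int (- 1) * (\<gamma> (zmult k y - zmult (2 * b y x) x) * \<gamma> x)"
      by simp
  qed
  then show ?thesis
    using k unfolding rat_implements_def homogeneous_def by blast
qed

lemma rat_implements_id: "rat_implements 1 1 id"
proof -
  have "of_int 1 * (1 * \<gamma> y) = of_int 1 * (\<gamma> y * 1)" "id (rat_incl y) = rat_frac y 1" for y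
    by (simp_all add: rat_incl_def)
  then show ?thesis unfolding rat_implements_def homogeneous_def using one_in_Even zero_neq_one by metis
qed

lemma rat_implements_comp:
  assumes "rat_implements x s G" "rat_implements y t H" "G \<in> rat_O b"
  shows "rat_implements (x * y) (s * t) (G \<circ> H)"
proof -
  have "\<exists>z m. m \<noteq> 0 \<and> (G \<circ> H) (rat_incl p) = rat_frac z m
      \<and> of_int m * (x * y * \<gamma> p) = of_int (s * t) * (\<gamma> z * (x * y))" for p
  proof -
    obtain z m where z: "m \<noteq> 0" "H (rat_incl p) = rat_frac z m" "of_int m * (y * \<gamma> p) = of_int t * (\<gamma> z * y)"
      using assms(2) unfolding rat_implements_def by blast
    obtain z' m' where z': "m' \<noteq> 0" "G (rat_incl z) = rat_frac z' m'" "of_int m' * (x * \<gamma> z) = of_int s * (\<gamma> z' * x)"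
      using assms(1) unfolding rat_implements_def by blast
    have "G (qscale (Rat.Fract 1 m) (rat_incl z)) = qscale (Rat.Fract 1 m) (G (rat_incl z))"
      using assms(3) unfolding mem_rat_O by blast
    then have "(G \<circ> H) (rat_incl p) = rat_frac z' (m * m')"
      using z(1) z'(1) by (simp add: z(2) z'(2) rat_frac_scale qscale_frac[of m m' 1 z', simplified])
    moreover have "of_int (m * m') * (x * y * \<gamma> p) = of_int (s * t) * (\<gamma> z' * (x * y))"
    proof -
      have "of_int (m * m') * (x * y * \<gamma> p) = of_int m' * (x * (of_int m * (y * \<gamma> p)))"
        unfolding mult_of_int_left[of x] by (simp only: mult.commute[of m] of_int_mult mult.assoc)
      also have "\<dots> = of_int m' * (of_int t * (x * (\<gamma> z * y)))"
        unfolding z(3) mult_of_int_left[of x] ..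
      also have "\<dots> = of_int t * (of_int m' * (x * (\<gamma> z * y)))"
        by (rule mult_of_int_left)
      also have "of_int m' * (x * (\<gamma> z * y)) = of_int s * (\<gamma> z' * (x * y))"
        using z'(3) by (metis mult.assoc)
      finally show ?thesis by (simp only: mult.commute[of s t] of_int_mult mult.assoc)
    qed
    ultimately show ?thesis using z(1) z'(1) by (metis mult_eq_0_iff)
  qed
  moreover have "homogeneous (x * y) (s * t)"
    using assms(1,2) homogeneous_mult unfolding rat_implements_def by blast
  ultimately show ?thesis unfolding rat_implements_def by blast
qed

lemma frac_square_nonzero: "m \<noteq> 0 \<Longrightarrow> F (rat_frac x m) (rat_frac x m) \<noteq> 0 \<longleftrightarrow> b x x \<noteq> 0"
  by (simp add: F_frac)

text \<open>Each reflection vector is replaced by its numerator in L, whose norm is half of a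
  nonzero self-pairing; so the norm of the product stays nonzero.\<close>

lemma rat_implements_exists: assumes "G \<in> rat_O b"
  shows "\<exists>x s n. rat_implements x s G \<and> x * star x = of_int n \<and> n \<noteq> 0"
proof -
  have "G \<in> refl_gen" using assms by (rule rat_O_refl_gen)
  then show ?thesis
  proof (induction rule: refl_gen.induct)
    case refl_gen_id
    have "1 * star 1 = of_int 1" by simp
    then show ?case using rat_implements_id by (metis zero_neq_one)
  next
    case (refl_gen_step r g)
    then obtain y t n where y: "rat_implements y t g" "y * star y = of_int n" "n \<noteq> 0" by blast
    obtain x m where r: "r = rat_frac x m" "m \<noteq> 0" by (rule rat_frac_cases)
    have bx: "b x x \<noteq> 0" using refl_gen_step(1) r frac_square_nonzero by simp
    have 1: "rat_implements (\<gamma> x * y) (- 1 * t) (R r \<circ> g)"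
      unfolding r(1) using rat_implements_comp[OF rat_implements_reflection[OF r(2) bx] y(1)] R_in_O refl_gen_step(1) r(1) by blast
    have "\<gamma> x * star (\<gamma> x) = of_int (b x x div 2)" by (simp add: gamma_square)
    moreover have "\<gamma> x \<in> Even \<union> Odd" "y \<in> Even \<union> Odd"
      using y(1) homogeneousD(1) gamma_in_Odd unfolding rat_implements_def by blast+
    ultimately have 2: "(\<gamma> x * y) * star (\<gamma> x * y) = of_int (b x x div 2 * n)"
      using norm_mult y(2) by blast
    have "b x x div 2 * n \<noteq> 0" using bx even_square[of x] y(3) by auto
    with 1 2 show ?case by blast
  qed
qed

text \<open>\<open>star x * y\<close> implements the identity, so it is an integer k, and comparing
  norms gives \<open>n * n' = k * k\<close>. Hence the class of the norm modulo squares depends only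
  on the isometry.\<close>

lemma rat_implements_unique:
  assumes "rat_implements x s G" "x * star x = of_int n" "n \<noteq> 0" "rat_implements y t G" "y * star y = of_int n'" "n' \<noteq> 0"
  obtains k where "n * n' = k * k" "k \<noteq> 0"
proof -
  have hx: "homogeneous x s" and hy: "homogeneous y t" using assms(1,4) by (simp_all add: rat_implements_def)
  note ran = homogeneous_range[OF hx] homogeneous_range[OF hy]
  have nx: "star x * x = of_int n" by (rule star_mult_self[OF homogeneousD(1)[OF hx] assms(2,3)])
  have "(star x * y) * \<gamma> z = of_int (s * t) * (\<gamma> (id z) * (star x * y))" for z
  proof -
    obtain z' m where z': "m \<noteq> 0" "G (rat_incl z) = rat_frac z' m" using rat_frac_cases by blast
    have 1: "of_int m * (x * \<gamma> z) = of_int s * (\<gamma> z' * x)" by (rule rat_implements_any[OF assms(1) z'])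
    have 2: "of_int m * (y * \<gamma> z) = of_int t * (\<gamma> z' * y)" by (rule rat_implements_any[OF assms(4) z'])
    \<comment> \<open>Shows that, after clearing denominators, \<open>star x\<close> implements the
      inverse of \<open>G\<close>: relation 1 is multiplied by \<open>star x\<close> on both sides
      and n is cancelled.\<close>
    have "of_int n * (of_int m * (\<gamma> z * star x)) = of_int m * (star x * (x * \<gamma> z)) * star x"
      unfolding mult.assoc[of "star x" x, symmetric] mult.assoc[symmetric] nx mult_of_int_commute[of n "of_int m"] ..
    also have "\<dots> = star x * (of_int m * (x * \<gamma> z)) * star x"
      by (simp only: mult_of_int_left[of "star x"])
    also have "\<dots> = of_int s * (star x * (\<gamma> z' * (x * star x)))"
      unfolding 1 mult_of_int_left[of "star x"] by (simp only: mult.assoc)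
    also have "\<dots> = of_int n * (of_int s * (star x * \<gamma> z'))"
      unfolding assms(2) mult_of_int_commute[of n, symmetric] mult_of_int_left[of "star x" n] by (rule mult_of_int_left)
    finally have 3: "of_int m * (\<gamma> z * star x) = of_int s * (star x * \<gamma> z')"
      by (rule of_int_mult_cancel[OF _ _ assms(3), rotated 2]) (intro range_cl_closed(3,5) star_closed gamma_in_range)+
    have ss: "of_int s * (of_int s * q) = q" for q :: ext_endo
      using homogeneousD(2)[OF hx] by (metis mult.assoc mult_1 of_int_1 of_int_mult)
    have "of_int m * ((star x * y) * \<gamma> z) = star x * (of_int m * (y * \<gamma> z))"
      unfolding mult_of_int_left[of "star x"] by (simp only: mult.assoc)
    also have "\<dots> = of_int t * ((star x * \<gamma> z') * y)"
      unfolding 2 mult_of_int_left[of "star x"] by (simp only: mult.assoc)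
    also have "star x * \<gamma> z' = of_int s * (of_int m * (\<gamma> z * star x))"
      unfolding 3 ss ..
    also have "of_int t * (of_int s * (of_int m * (\<gamma> z * star x)) * y) = of_int m * (of_int (s * t) * (\<gamma> z * (star x * y)))"
      by (simp only: mult.assoc of_int_mult mult_of_int_left[of "of_int t" m] mult_of_int_left[of "of_int s" m] mult_of_int_left[of "of_int t" s])
    finally have "(star x * y) * \<gamma> z = of_int (s * t) * (\<gamma> z * (star x * y))"
      by (rule of_int_mult_cancel[OF _ _ z'(1), rotated 2]) (intro range_cl_closed(3,5) star_closed gamma_in_range ran)+
    then show ?thesis by (simp only: id_apply)
  qed
  then have imp: "implements (star x * y) (s * t) id"
    unfolding implements_def using homogeneous_mult[OF homogeneous_star[OF hx] hy] by blast
  have "star x * star (star x) = of_int n" using nx star_star[OF ran(1)] by simp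
  then have N: "(star x * y) * star (star x * y) = of_int (n * n')"
    using norm_mult[OF homogeneousD(1)[OF homogeneous_star[OF hx]] homogeneousD(1)[OF hy] _ assms(5)] by blast
  have "star x * y \<noteq> 0"
  proof
    assume "star x * y = 0"
    then have "of_int (n * n') = (of_int 0 :: ext_endo)" using N by simp
    then show False using assms(3,6) unfolding of_int_eq_of_int by simp
  qed
  then obtain k where k: "star x * y = of_int k" using implements_id[OF imp] by blast
  have "of_int (n * n') = (of_int (k * k) :: ext_endo)" using N unfolding k by simp
  then have "n * n' = k * k" unfolding of_int_eq_of_int .
  moreover from this have "k \<noteq> 0" using assms(3,6) by auto
  ultimately show thesis by (rule that)
qed

section \<open>Norm classes modulo squares and the definite description of the spinor norm\<close>

abbreviation cls :: "rat \<Rightarrow> rat set" where "cls q \<equiv> rat_squares #>\<^bsub>rat_units\<^esub> q"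

lemma cls_eq: "cls q = {k\<^sup>2 * q | k. k \<noteq> 0}"
  unfolding r_coset_def rat_squares_def rat_units_def by auto

lemma cls_cong: assumes "q * q' = k * k" "k \<noteq> 0" shows "cls q = cls q'"
proof -
  have *: "cls q \<subseteq> cls q'" if "q * q' = k * k" for q q'
  proof
    have q': "q' \<noteq> 0" using that assms(2) by auto
    fix r assume "r \<in> cls q"
    then obtain j where j: "r = j\<^sup>2 * q" "j \<noteq> 0" unfolding cls_eq by blast
    have "(j * k / q')\<^sup>2 * q' = j\<^sup>2 * (k * k) / q'" using q' by (simp add: power2_eq_square)
    also have "\<dots> = r" using q' by (simp add: that[symmetric] j)
    finally have "r = (j * k / q')\<^sup>2 * q'" ..
    moreover have "j * k / q' \<noteq> 0" using j assms(2) q' by simp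
    ultimately show "r \<in> cls q'" unfolding cls_eq by blast
  qed
  show ?thesis using *[OF assms(1)] *[of q' q] assms(1) by (simp add: mult.commute)
qed

lemma cls_mult: "cls q <#>\<^bsub>rat_units\<^esub> cls q' = cls (q * q')"
proof -
  have 1: "x \<in> cls q <#>\<^bsub>rat_units\<^esub> cls q' \<longleftrightarrow> (\<exists>j k. j \<noteq> 0 \<and> k \<noteq> 0 \<and> x = (j\<^sup>2 * q) * (k\<^sup>2 * q'))" for x
    unfolding set_mult_def cls_eq by (auto simp: rat_units_def)
  have 2: "(j\<^sup>2 * q) * (k\<^sup>2 * q') = (j * k)\<^sup>2 * (q * q')" for j k
    by (simp add: power2_eq_square)
  have "x \<in> cls q <#>\<^bsub>rat_units\<^esub> cls q' \<longleftrightarrow> x \<in> cls (q * q')" for x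
  proof
    assume "x \<in> cls (q * q')"
    then obtain j where "j \<noteq> 0" "x = (j * 1)\<^sup>2 * (q * q')" unfolding cls_eq by auto
    then show "x \<in> cls q <#>\<^bsub>rat_units\<^esub> cls q'" unfolding 1 2[symmetric] by (metis zero_neq_one)
  next
    assume "x \<in> cls q <#>\<^bsub>rat_units\<^esub> cls q'"
    then obtain j k where "j \<noteq> 0" "k \<noteq> 0" "x = (j * k)\<^sup>2 * (q * q')" unfolding 1 2 by blast
    moreover from this have "j * k \<noteq> 0" by simp
    ultimately show "x \<in> cls (q * q')" unfolding cls_eq by blast
  qed
  then show ?thesis by blast
qed

definition rnorm :: "('a rat_ext \<Rightarrow> 'a rat_ext) \<Rightarrow> int" where
  "rnorm G = (SOME n. n \<noteq> 0 \<and> (\<exists>x s. rat_implements x s G \<and> x * star x = of_int n))"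

text \<open>\<open>restrict\<close> matches the extensionality demanded by
  \<open>spinor_norm\<close>; by \<open>rat_implements_unique\<close> the chosen norm matters only
  up to squares.\<close>

definition \<theta>0 :: "('a rat_ext \<Rightarrow> 'a rat_ext) \<Rightarrow> rat set" where
  "\<theta>0 = restrict (\<lambda>G. cls (of_int (rnorm G))) (rat_O b)"

lemma rnorm: assumes "G \<in> rat_O b"
  shows "rnorm G \<noteq> 0" "\<exists>x s. rat_implements x s G \<and> x * star x = of_int (rnorm G)"
proof -
  have "\<exists>n. n \<noteq> 0 \<and> (\<exists>x s. rat_implements x s G \<and> x * star x = of_int n)" using rat_implements_exists[OF assms] by blast
  from someI_ex[OF this] show "rnorm G \<noteq> 0" "\<exists>x s. rat_implements x s G \<and> x * star x = of_int (rnorm G)"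
    unfolding rnorm_def by blast+
qed

lemma theta0_eq:
  assumes "G \<in> rat_O b" "rat_implements x s G" "x * star x = of_int n" "n \<noteq> 0"
  shows "\<theta>0 G = cls (of_int n)"
proof -
  obtain y t where y: "rat_implements y t G" "y * star y = of_int (rnorm G)" using rnorm(2)[OF assms(1)] by blast
  obtain k where k: "rnorm G * n = k * k" "k \<noteq> 0"
    by (rule rat_implements_unique[OF y rnorm(1)[OF assms(1)] assms(2-4)])
  have "(of_int (rnorm G) :: rat) * of_int n = of_int k * of_int k" using k(1) by (metis of_int_mult)
  then have "cls (of_int (rnorm G)) = cls (of_int n)" using cls_cong k(2) of_int_eq_0_iff by blast
  then show ?thesis using assms(1) by (simp add: \<theta>0_def)
qed

lemma theta0_comp:
  assumes "G \<in> rat_O b" "H \<in> rat_O b"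
  shows "\<theta>0 (G \<circ> H) = \<theta>0 G <#>\<^bsub>rat_units\<^esub> \<theta>0 H"
proof -
  obtain x s where x: "rat_implements x s G" "x * star x = of_int (rnorm G)" using rnorm(2)[OF assms(1)] by blast
  obtain y t where y: "rat_implements y t H" "y * star y = of_int (rnorm H)" using rnorm(2)[OF assms(2)] by blast
  have N: "(x * y) * star (x * y) = of_int (rnorm G * rnorm H)"
    using norm_mult homogeneousD(1) x y unfolding rat_implements_def by blast
  have "rnorm G * rnorm H \<noteq> 0" using rnorm(1) assms by simp
  then have "\<theta>0 (G \<circ> H) = cls (of_int (rnorm G * rnorm H))"
    by (rule theta0_eq[OF rat_O_comp[OF assms] rat_implements_comp[OF x(1) y(1) assms(1)] N])
  then show ?thesis using assms by (simp add: \<theta>0_def cls_mult)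
qed

text \<open>The implementer is the numerator x of r = x / m, so the two candidate values differ by
  the square of m.\<close>

lemma theta0_reflection: assumes "F r r \<noteq> 0" shows "\<theta>0 (R r) = cls (F r r / 2)"
proof -
  obtain x m where r: "r = rat_frac x m" "m \<noteq> 0" by (rule rat_frac_cases)
  have bx: "b x x \<noteq> 0" using assms r frac_square_nonzero by simp
  define q where "q = b x x div 2"
  have q: "b x x = 2 * q" "q \<noteq> 0" using even_square[of x] bx by (auto simp: q_def)
  have "\<gamma> x * star (\<gamma> x) = of_int q" by (simp add: gamma_square q_def)
  then have "\<theta>0 (R r) = cls (of_int q)"
    using theta0_eq[OF R_in_O[OF assms]] rat_implements_reflection[OF r(2) bx] q(2) r(1) by blast
  moreover have "F r r / 2 = of_int q / (of_int m * of_int m)" using r by (simp add: F_frac q(1))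
  then have "of_int q * (F r r / 2) = (of_int q / of_int m) * (of_int q / of_int m)" by simp
  then have "cls (of_int q) = cls (F r r / 2)" by (rule cls_cong) (use q(2) r(2) in simp)
  ultimately show ?thesis by simp
qed

text \<open>Supplies one reflection, so that the value of a candidate spinor norm at
  \<open>id = R r \<circ> R r\<close> is determined by its values on reflections.\<close>

lemma anisotropic_exists: obtains r where "F r r \<noteq> 0"
proof -
  obtain y where y: "b e1 y = disc * 1" using dual_vector[of 1 0 0] by blast
  have "F (rat_incl e1) (rat_incl y) \<noteq> 0" using y disc_nonzero by (simp add: rat_incl_def F_frac)
  then have "rat_incl e1 \<noteq> 0" using F_0 by metis
  then have "proj {} (rat_incl e1) \<noteq> 0" by (simp add: proj_def)
  moreover have "orthogonal_set {}" by (simp add: orthogonal_set_def)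
  ultimately obtain a where "orthogonal_set (insert a {})" using orthogonal_extend by blast
  then have "F a a \<noteq> 0" by (simp add: orthogonal_set_def)
  then show thesis by (rule that)
qed

text \<open>Existence in the definite description comes from the norms of implementers, uniqueness
  from the generation of \<open>rat_O b\<close> by reflections.\<close>

lemma spinor_norm_eq: "spinor_norm b = \<theta>0"
  unfolding spinor_norm_def
proof (rule the_equality, intro conjI allI impI)
  show "\<theta>0 \<in> hom (comp_group (rat_O b)) (rat_units Mod rat_squares)"
  proof (rule homI)
    fix G assume "G \<in> carrier (comp_group (rat_O b))"
    then have "G \<in> rat_O b" by (simp add: comp_group_def)
    then have "\<theta>0 G = cls (of_int (rnorm G))" "(of_int (rnorm G) :: rat) \<in> carrier rat_units"
      using rnorm(1) by (simp_all add: \<theta>0_def rat_units_def)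
    then show "\<theta>0 G \<in> carrier (rat_units Mod rat_squares)"
      unfolding FactGroup_def RCOSETS_def by auto
  next
    fix G H assume "G \<in> carrier (comp_group (rat_O b))" "H \<in> carrier (comp_group (rat_O b))"
    then show "\<theta>0 (G \<otimes>\<^bsub>comp_group (rat_O b)\<^esub> H) = \<theta>0 G \<otimes>\<^bsub>rat_units Mod rat_squares\<^esub> \<theta>0 H"
      using theta0_comp[of G H] by (simp add: comp_group_def FactGroup_def)
  qed
  show "\<theta>0 \<in> extensional (rat_O b)" unfolding \<theta>0_def by (rule restrict_extensional)
  show "\<theta>0 (R r) = cls (F r r / 2)" if "F r r \<noteq> 0" for r using that by (rule theta0_reflection)
next
  fix \<theta>
  assume \<theta>: "\<theta> \<in> hom (comp_group (rat_O b)) (rat_units Mod rat_squares) \<and> \<theta> \<in> extensional (rat_O b) \<and>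
    (\<forall>r. F r r \<noteq> 0 \<longrightarrow> \<theta> (R r) = cls (F r r / 2))"
  have comp: "\<theta> (G \<circ> H) = \<theta> G <#>\<^bsub>rat_units\<^esub> \<theta> H" if "G \<in> rat_O b" "H \<in> rat_O b" for G H
    using hom_mult[OF conjunct1[OF \<theta>], of G H] that by (simp add: comp_group_def FactGroup_def)
  have refl: "\<theta> (R r) = \<theta>0 (R r)" if "F r r \<noteq> 0" for r
    using \<theta> that theta0_reflection by simp
  have "\<theta> G = \<theta>0 G" if "G \<in> refl_gen" for G
    using that
  proof (induction rule: refl_gen.induct)
    case refl_gen_id
    obtain r where r: "F r r \<noteq> 0" by (rule anisotropic_exists)
    then have "R r \<circ> R r = id" using R_involution by (simp add: fun_eq_iff)
    then show ?case using comp[OF R_in_O[OF r] R_in_O[OF r]] theta0_comp[OF R_in_O[OF r] R_in_O[OF r]] refl[OF r] by (simp only:)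
  next
    case (refl_gen_step r g)
    note O = R_in_O[OF refl_gen_step(1)] refl_gen_O[OF refl_gen_step(2)]
    show ?case
      using comp[OF O] theta0_comp[OF O] refl[OF refl_gen_step(1)] refl_gen_step(3) by (simp only:)
  qed
  then have "\<theta> G = \<theta>0 G" if "G \<in> rat_O b" for G using rat_O_refl_gen[OF that] by blast
  then show "\<theta> = \<theta>0"
    using \<theta> by (intro extensionalityI[of \<theta> "rat_O b" \<theta>0]) (simp_all add: \<theta>0_def)
qed

end

section \<open>Surjectivity\<close>

lemma extract_content:
  fixes a b c d :: int
  assumes "\<not> (a = 0 \<and> b = 0 \<and> c = 0 \<and> d = 0)"
  obtains k a' b' c' d' where "k \<noteq> 0" "a = k * a'" "b = k * b'" "c = k * c'" "d = k * d'"
    "\<forall>p. Factorial_Ring.prime p \<longrightarrow> \<not> (p dvd a' \<and> p dvd b' \<and> p dvd c' \<and> p dvd d')"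
proof -
  define k where "k = gcd (gcd a b) (gcd c d)"
  have k0: "k \<noteq> 0" using assms by (auto simp: k_def)
  have "k dvd gcd a b" "k dvd gcd c d" unfolding k_def by (rule gcd_dvd1, rule gcd_dvd2)
  then have "k dvd a" "k dvd b" "k dvd c" "k dvd d" by (auto intro: dvd_trans)
  then obtain a' b' c' d' where k: "a = k * a'" "b = k * b'" "c = k * c'" "d = k * d'"
    by (elim dvdE) blast
  have "\<not> (p dvd a' \<and> p dvd b' \<and> p dvd c' \<and> p dvd d')" if p: "Factorial_Ring.prime p" for p
  proof
    assume *: "p dvd a' \<and> p dvd b' \<and> p dvd c' \<and> p dvd d'"
    have "k * p dvd a" "k * p dvd b" "k * p dvd c" "k * p dvd d"
      using * unfolding k by (simp_all add: mult_dvd_mono)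
    then have "k * p dvd k * 1" unfolding k_def mult_1_right by (intro gcd_greatest)
    then have "p dvd 1" using k0 by (simp only: dvd_mult_cancel_left) simp
    then show False using p not_prime_unit by blast
  qed
  then show thesis using that[OF k0 k] by blast
qed

context ternary_lattice
begin

lemma ev_scale: "of_int k * ev a a12 a13 a23 = ev (k * a) (k * a12) (k * a13) (k * a23)"
  unfolding ev_def cl_scale by simp

lemma od_scale: "of_int k * od x1 x2 x3 t = od (k * x1) (k * x2) (k * x3) (k * t)"
  unfolding od_def cl_scale by simp

lemma implements_scale_cancel:
  assumes "implements (of_int k * x) s g" "homogeneous x s" "k \<noteq> 0"
  shows "implements x s g"
proof -
  have x: "x \<in> range cl" by (rule homogeneous_range[OF assms(2)])
  have "x * \<gamma> y = of_int s * (\<gamma> (g y) * x)" for y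
  proof -
    have "of_int k * (x * \<gamma> y) = of_int s * (\<gamma> (g y) * (of_int k * x))"
      using assms(1) unfolding implements_def by (simp only: mult.assoc)
    also have "\<dots> = of_int k * (of_int s * (\<gamma> (g y) * x))"
      unfolding mult_of_int_left[of "\<gamma> (g y)"] by (rule mult_of_int_left)
    finally show ?thesis
      by (rule of_int_mult_cancel[OF _ _ assms(3), rotated 2]) (intro range_cl_closed(3,5) gamma_in_range x)+
  qed
  then show ?thesis using assms(2) unfolding implements_def by blast
qed

text \<open>The converse of \<open>act_disc\<close>: for the dual vector z / \<open>disc\<close>
  representing the form, triviality on the discriminant group makes g z - z divisible by
  \<open>disc\<close>. So the contraction of x is a vector of L times x.\<close>

lemma contraction_quotient:
  assumes g: "g \<in> disc_trivial b (lattice_O b)" and imp: "implements x s g"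
  shows "\<exists>z y. D1 z = disc * l1 \<and> D2 z = disc * l2 \<and> D3 z = disc * l3 \<and>
    x * \<gamma> z - of_int s * (\<gamma> z * x) = of_int disc * (\<gamma> y * x)"
proof -
  have gO: "g \<in> lattice_O b" using g by (simp add: disc_trivial_def)
  obtain z where z: "b e1 z = disc * l1" "b e2 z = disc * l2" "b e3 z = disc * l3"
    by (rule dual_vector)
  have "disc dvd b z y" for y
    unfolding sym[of z y] form_coords[of y z] z by simp
  then obtain y where y: "g z - z = zmult disc y"
    using g disc_nonzero unfolding disc_trivial_iff[OF lattice_OD(1,2)[OF gO]] by blast
  have "x * \<gamma> z - of_int s * (\<gamma> z * x) = of_int s * (\<gamma> (g z) * x) - of_int s * (\<gamma> z * x)"
    using imp unfolding implements_def by simp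
  also have "\<dots> = of_int s * (\<gamma> (g z - z) * x)"
    by (simp only: gamma_diff left_diff_distrib right_diff_distrib)
  also have "\<dots> = of_int s * (of_int disc * (\<gamma> y * x))"
    by (simp only: y gamma_zmult mult.assoc)
  also have "\<dots> = of_int disc * (of_int s * (\<gamma> y * x))" by (rule mult_of_int_left)
  also have "of_int s * (\<gamma> y * x) = \<gamma> (zmult s y) * x" by (simp only: gamma_zmult mult.assoc)
  finally show ?thesis using z unfolding dual_basis by blast
qed

lemma rat_map_O: assumes "g \<in> lattice_O b" shows "rat_map g \<in> rat_O b"
proof -
  note g = lattice_OD[OF assms]
  interpret additive g by (rule g(1))
  have gz: "g (zmult m l) = zmult m (g l)" for m l by (rule zmult_additive[OF g(1)])
  have inj: "inj g" using g(3) by (simp add: bij_def)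
  show ?thesis
    unfolding mem_rat_O
  proof (intro conjI allI)
    fix p q :: "'a rat_ext"
    obtain x m where p: "p = rat_frac x m" "m \<noteq> 0" by (rule rat_frac_cases)
    obtain y n where q: "q = rat_frac y n" "n \<noteq> 0" by (rule rat_frac_cases)
    show "rat_map g (p + q) = rat_map g p + rat_map g q"
      using p(2) q(2) unfolding p(1) q(1) by (simp add: rat_frac_add rat_map_frac[OF g(1)] add gz)
    show "F (rat_map g p) (rat_map g q) = F p q"
      using p(2) q(2) unfolding p(1) q(1) by (simp add: rat_map_frac[OF g(1)] F_frac g(4))
    show "rat_map g (qscale c p) = qscale c (rat_map g p)" for c
    proof -
      obtain k l where c: "c = Rat.Fract k l" "l \<noteq> 0" by (cases c) auto
      show ?thesis using p(2) c(2) unfolding p(1) c(1) by (simp add: qscale_frac rat_map_frac[OF g(1)] gz)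
    qed
  next
    show "bij (rat_map g)"
    proof (rule bijI)
      show "inj (rat_map g)"
      proof (rule injI)
        fix p q assume eq: "rat_map g p = rat_map g q"
        obtain x m where p: "p = rat_frac x m" "m \<noteq> 0" by (rule rat_frac_cases)
        obtain y n where q: "q = rat_frac y n" "n \<noteq> 0" by (rule rat_frac_cases)
        have "zmult n (g x) = zmult m (g y)"
          using eq p(2) q(2) unfolding p(1) q(1) by (simp add: rat_map_frac[OF g(1)] rat_frac_eq)
        then have "zmult n x = zmult m y" using inj by (simp add: gz[symmetric] inj_eq)
        then show "p = q" using p q by (simp add: rat_frac_eq)
      qed
      have "\<exists>p. q = rat_map g p" for q
      proof -
        obtain y n where q: "q = rat_frac y n" "n \<noteq> 0" by (rule rat_frac_cases)
        obtain x where "y = g x" using g(2) by (rule surjE)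
        then show ?thesis using q rat_map_frac[OF g(1) q(2), of x] by metis
      qed
      then show "surj (rat_map g)" unfolding surj_def by blast
    qed
  qed
qed

lemma rat_implements_rat_map:
  assumes "additive g"
  shows "rat_implements x s (rat_map g) \<longleftrightarrow> implements x s g"
proof -
  have m: "rat_map g (rat_incl y) = rat_frac (g y) 1" for y
    by (simp add: rat_incl_def rat_map_frac[OF assms])
  show ?thesis
  proof
    assume r: "rat_implements x s (rat_map g)"
    have "x * \<gamma> y = of_int s * (\<gamma> (g y) * x)" for y
      using rat_implements_any[OF r _ m[of y]] by simp
    then show "implements x s g" using r unfolding implements_def rat_implements_def by blast
  next
    assume i: "implements x s g"
    have "of_int 1 * (x * \<gamma> y) = of_int s * (\<gamma> (g y) * x)" for y
      using i unfolding implements_def by simp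
    then show "rat_implements x s (rat_map g)"
      unfolding rat_implements_def using i m zero_neq_one unfolding implements_def by metis
  qed
qed

lemma act_surj: assumes g: "g \<in> disc_trivial b (lattice_O b)" shows "\<exists>x\<in>PM. act x = g"
proof -
  have gO: "g \<in> lattice_O b" using g by (simp add: disc_trivial_def)
  obtain x s n where x: "rat_implements x s (rat_map g)" "x * star x = of_int n" "n \<noteq> 0"
    using rat_implements_exists[OF rat_map_O[OF gO]] by blast
  have imp: "implements x s g" using x(1) rat_implements_rat_map[OF lattice_OD(1)[OF gO]] by blast
  have x0: "x \<noteq> 0"
    using x(2,3) of_int_eq_of_int[of n 0] by auto
  have zero: "ev 0 0 0 0 = 0" "od 0 0 0 0 = 0"
    using ev_of_int[of 0] od_vec[of 0 0 0] vec_scale[of 0 0 0 0] by simp_all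
  have "s = 1 \<and> x \<in> Even \<or> s = - 1 \<and> x \<in> Odd"
    using imp by (simp add: implements_def homogeneous_def)
  then show ?thesis
  proof
    assume s: "s = 1 \<and> x \<in> Even"
    then obtain a a12 a13 a23 where xe: "x = ev a a12 a13 a23" by (auto elim: EvenE)
    then have "\<not> (a = 0 \<and> a12 = 0 \<and> a13 = 0 \<and> a23 = 0)" using x0 zero by auto
    then obtain k c c12 c13 c23 where k: "k \<noteq> 0" "a = k * c" "a12 = k * c12" "a13 = k * c13" "a23 = k * c23"
      and prim: "\<forall>p. Factorial_Ring.prime p \<longrightarrow> \<not> (p dvd c \<and> p dvd c12 \<and> p dvd c13 \<and> p dvd c23)"
      by (rule extract_content)
    define y where "y = ev c c12 c13 c23"
    have hy: "homogeneous y 1" by (simp add: homogeneous_def y_def)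
    have "x = of_int k * y" by (simp only: xe y_def ev_scale k)
    then have iy: "implements y 1 g" using implements_scale_cancel[OF _ hy k(1)] imp s by simp
    \<comment> \<open>Both sides of \<open>contraction_quotient\<close> are multiples of
      \<open>disc\<close>; cancelling it gives the contraction by an arbitrary integral
      form.\<close>
    have quot: "\<exists>y1 y2 y3. vec y1 y2 y3 * ev c c12 c13 c23 =
      vec (c12 * l2 + c13 * l3) (c23 * l3 - c12 * l1) (- c13 * l1 - c23 * l2)" for l1 l2 l3
    proof -
      obtain z p where z: "D1 z = disc * l1" "D2 z = disc * l2" "D3 z = disc * l3"
        "y * \<gamma> z - of_int 1 * (\<gamma> z * y) = of_int disc * (\<gamma> p * y)"
        using contraction_quotient[OF g iy] by blast
      have "of_int disc * (\<gamma> p * y) = y * \<gamma> z - \<gamma> z * y" using z(4) by (simp only: of_int_1 mult_1)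
      also have "\<dots> = vec (c12 * (disc * l2) + c13 * (disc * l3))
          (c23 * (disc * l3) - c12 * (disc * l1)) (- c13 * (disc * l1) - c23 * (disc * l2))"
        unfolding y_def \<gamma>_def[of z] ev_commutator z(1-3) ..
      also have "\<dots> = of_int disc * vec (c12 * l2 + c13 * l3) (c23 * l3 - c12 * l1) (- c13 * l1 - c23 * l2)"
        unfolding vec_scale by (simp add: algebra_simps)
      finally have "\<gamma> p * y = vec (c12 * l2 + c13 * l3) (c23 * l3 - c12 * l1) (- c13 * l1 - c23 * l2)"
        by (rule of_int_mult_cancel[OF _ _ disc_nonzero, rotated 2])
          (intro range_cl_closed(3,8) gamma_in_range homogeneous_range[OF hy])+
      then show ?thesis unfolding \<gamma>_def y_def by blast
    qed
    have "\<bar>norm_ev c c12 c13 c23\<bar> = 1"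
    proof (rule primitive_norm_ev)
      show "\<not> (p dvd c \<and> p dvd c12 \<and> p dvd c13 \<and> p dvd c23)" if "Factorial_Ring.prime p" for p
        using prim that by blast
    qed (rule quot)
    then have "norm_ev c c12 c13 c23 = 1 \<or> norm_ev c c12 c13 c23 = - 1" by linarith
    then have "y \<in> PM" by (rule PM_I[OF hy ev_mult_star[of c c12 c13 c23, folded y_def]])
    then show ?thesis using act_eqI[OF _ iy] by blast
  next
    assume s: "s = - 1 \<and> x \<in> Odd"
    then obtain x1 x2 x3 t where xo: "x = od x1 x2 x3 t" by (auto elim: OddE)
    then have "\<not> (x1 = 0 \<and> x2 = 0 \<and> x3 = 0 \<and> t = 0)" using x0 zero by auto
    then obtain k c1 c2 c3 r where k: "k \<noteq> 0" "x1 = k * c1" "x2 = k * c2" "x3 = k * c3" "t = k * r"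
      and prim: "\<forall>p. Factorial_Ring.prime p \<longrightarrow> \<not> (p dvd c1 \<and> p dvd c2 \<and> p dvd c3 \<and> p dvd r)"
      by (rule extract_content)
    define y where "y = od c1 c2 c3 r"
    have hy: "homogeneous y (- 1)" by (simp add: homogeneous_def y_def)
    have "x = of_int k * y" by (simp only: xo y_def od_scale k)
    then have iy: "implements y (- 1) g" using implements_scale_cancel[OF _ hy k(1)] imp s by simp
    have quot: "\<exists>y1 y2 y3. vec y1 y2 y3 * od c1 c2 c3 r =
      ev (l1 * c1 + l2 * c2 + l3 * c3) (r * l3) (- r * l2) (r * l1)" for l1 l2 l3
    proof -
      obtain z p where z: "D1 z = disc * l1" "D2 z = disc * l2" "D3 z = disc * l3"
        "y * \<gamma> z - of_int (- 1) * (\<gamma> z * y) = of_int disc * (\<gamma> p * y)"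
        using contraction_quotient[OF g iy] by blast
      have "y * \<gamma> z - of_int (- 1) * (\<gamma> z * y) = y * \<gamma> z + \<gamma> z * y" by simp
      then have "of_int disc * (\<gamma> p * y) = y * \<gamma> z + \<gamma> z * y" using z(4) by (simp only:)
      also have "\<dots> = ev (disc * l1 * c1 + disc * l2 * c2 + disc * l3 * c3)
          (r * (disc * l3)) (- r * (disc * l2)) (r * (disc * l1))"
        unfolding y_def \<gamma>_def[of z] od_anticommutator z(1-3) ..
      also have "\<dots> = of_int disc * ev (l1 * c1 + l2 * c2 + l3 * c3) (r * l3) (- r * l2) (r * l1)"
        unfolding ev_scale by (simp add: algebra_simps)
      finally have "\<gamma> p * y = ev (l1 * c1 + l2 * c2 + l3 * c3) (r * l3) (- r * l2) (r * l1)"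
        by (rule of_int_mult_cancel[OF _ _ disc_nonzero, rotated 2])
          (intro range_cl_closed(3) gamma_in_range homogeneous_range[OF hy] Even_in_range ev_in_Even)+
      then show ?thesis unfolding \<gamma>_def y_def by blast
    qed
    have "\<bar>norm_od c1 c2 c3 r\<bar> = 1"
    proof (rule primitive_norm_od)
      show "\<not> (p dvd c1 \<and> p dvd c2 \<and> p dvd c3 \<and> p dvd r)" if "Factorial_Ring.prime p" for p
        using prim that by blast
    qed (rule quot)
    then have "norm_od c1 c2 c3 r = 1 \<or> norm_od c1 c2 c3 r = - 1" by linarith
    then have "y \<in> PM" by (rule PM_I[OF hy od_mult_star[of c1 c2 c3 r, folded y_def]])
    then show ?thesis using act_eqI[OF _ iy] by blast
  qed
qed

lemma act_det: assumes "x \<in> PM" shows "lattice_det (act x) = sgn_of x"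
proof -
  obtain n where n: "x * star x = of_int n" "n = 1 \<or> n = - 1" using assms by (rule PM_cases)
  then have "n \<noteq> 0" by auto
  then show ?thesis by (rule implements_det[OF implements_act[OF assms] n(1)])
qed

text \<open>The class consists of nonzero squares times n, so all its elements have the sign of
  n.\<close>

lemma act_spinor: assumes "x \<in> PM" "x * star x = of_int n" "n = 1 \<or> n = - 1"
  shows "(\<forall>q\<in>spinor_norm b (rat_map (act x)). 0 < q) \<longleftrightarrow> n = 1"
proof -
  have O: "act x \<in> lattice_O b" by (rule act_in_O[OF assms(1)])
  have "rat_implements x (sgn_of x) (rat_map (act x))"
    unfolding rat_implements_rat_map[OF lattice_OD(1)[OF O]] by (rule implements_act[OF assms(1)])
  then have eq: "spinor_norm b (rat_map (act x)) = {k\<^sup>2 * of_int n | k. k \<noteq> 0}"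
    unfolding spinor_norm_eq cls_eq[symmetric] using assms(2,3) by (intro theta0_eq[OF rat_map_O[OF O]]) auto
  show ?thesis
  proof
    assume *: "\<forall>q\<in>spinor_norm b (rat_map (act x)). 0 < q"
    have "1\<^sup>2 * of_int n \<in> spinor_norm b (rat_map (act x))" unfolding eq by (intro CollectI exI[of _ 1]) simp
    then have "0 < 1\<^sup>2 * (of_int n :: rat)" by (rule bspec[OF *])
    then show "n = 1" using assms(3) by auto
  qed (auto simp: eq)
qed

section \<open>The isomorphisms\<close>

definition subgroup_of :: "ext_endo set \<Rightarrow> 'a clifford set" where
  "subgroup_of K = {\<alpha> \<in> carrier C. \<kappa> \<alpha> \<in> K}"

text \<open>What the three groups of the theorem have in common; containing both signs makes the
  kernel of the action exactly the group of signs.\<close>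

definition unit_subgroup :: "ext_endo set \<Rightarrow> bool" where
  "unit_subgroup K \<longleftrightarrow> K \<subseteq> PM \<and> 1 \<in> K \<and> - 1 \<in> K \<and> (\<forall>x\<in>K. \<forall>y\<in>K. x * y \<in> K)
     \<and> (\<forall>x\<in>K. \<exists>y\<in>K. x * y = 1 \<and> y * x = 1)"

lemma pm_units_eq: "cl_pm_units b = subgroup_of PM"
  by (auto simp: subgroup_of_def mem_pm_units)

lemma even_units_eq: "cl_even_units b = subgroup_of (PM \<inter> Even)"
  by (auto simp: subgroup_of_def mem_even_units)

lemma even_norm1_eq: "cl_even_norm1 b = subgroup_of {x \<in> Even. x * star x = 1}"
  by (auto simp: subgroup_of_def mem_even_norm1)

lemma even_inverse:
  assumes "x \<in> PM" "x \<in> Even"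
  obtains y where "y \<in> PM" "y \<in> Even" "x * y = 1" "y * x = 1" "y * star y = x * star x"
proof -
  have hx: "homogeneous x 1" using assms(2) by (simp add: homogeneous_def)
  show thesis
  proof (rule PM_inverse[OF assms(1)])
    fix y assume y: "y \<in> PM" "x * y = 1" "y * x = 1" "homogeneous x 1 \<Longrightarrow> homogeneous y 1"
      "y * star y = x * star x"
    have "y \<in> Even" using y(4)[OF hx] by (simp add: homogeneous_def)
    then show thesis by (rule that[OF y(1) _ y(2,3,5)])
  qed
qed

lemma unit_subgroup_PM: "unit_subgroup PM"
  unfolding unit_subgroup_def
proof (intro conjI ballI subset_refl one_PM minus_one_PM PM_mult)
  fix x assume "x \<in> PM"
  then show "\<exists>y\<in>PM. x * y = 1 \<and> y * x = 1"
  proof (rule PM_inverse)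
    fix y assume "y \<in> PM" "x * y = 1" "y * x = 1"
    then show ?thesis by blast
  qed
qed

lemma unit_subgroup_even: "unit_subgroup (PM \<inter> Even)"
  unfolding unit_subgroup_def
proof (intro conjI ballI IntI Int_lower1 one_PM minus_one_PM one_in_Even Even_uminus[OF one_in_Even])
  fix x assume "x \<in> PM \<inter> Even"
  then have x: "x \<in> PM" "x \<in> Even" by simp_all
  obtain y where "y \<in> PM" "y \<in> Even" "x * y = 1" "y * x = 1" by (rule even_inverse[OF x])
  then show "\<exists>y\<in>PM \<inter> Even. x * y = 1 \<and> y * x = 1" by blast
qed (simp_all add: PM_mult Even_mult_Even)

lemma unit_subgroup_norm1: "unit_subgroup {x \<in> Even. x * star x = 1}"
  unfolding unit_subgroup_def
proof (intro conjI ballI subsetI CollectI)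
  fix x assume x: "x \<in> {x \<in> Even. x * star x = 1}"
  then show xPM: "x \<in> PM" by (simp add: PM_def)
  have xE: "x \<in> Even" "x * star x = 1" using x by simp_all
  obtain y where "y \<in> PM" "y \<in> Even" "x * y = 1" "y * x = 1" "y * star y = x * star x"
    by (rule even_inverse[OF xPM xE(1)])
  then show "\<exists>y\<in>{x \<in> Even. x * star x = 1}. x * y = 1 \<and> y * x = 1"
    using xE by (intro bexI[of _ y]) simp_all
next
  fix x y assume "x \<in> {x \<in> Even. x * star x = 1}" "y \<in> {x \<in> Even. x * star x = 1}"
  then have *: "x \<in> Even" "x * star x = of_int 1" "y \<in> Even" "y * star y = of_int 1" by simp_all
  then show "x * y \<in> Even" by (intro Even_mult_Even)
  show "x * y * star (x * y) = 1" using norm_mult[of x y 1 1] * by simp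
qed (simp_all add: one_in_Even Even_uminus star_uminus)

abbreviation "U \<equiv> units_of C"

lemma kappa_eqI: "\<alpha> \<in> carrier C \<Longrightarrow> \<beta> \<in> carrier C \<Longrightarrow> \<kappa> \<alpha> = \<kappa> \<beta> \<Longrightarrow> \<alpha> = \<beta>"
  using kappa_inject by blast

lemma subgroup_of_inverse:
  assumes "unit_subgroup K" "\<alpha> \<in> subgroup_of K"
  shows "\<alpha> \<in> Units C" "inv\<^bsub>C\<^esub> \<alpha> \<in> subgroup_of K" "\<kappa> \<alpha> * \<kappa> (inv\<^bsub>C\<^esub> \<alpha>) = 1"
proof -
  have \<alpha>: "\<alpha> \<in> carrier C" "\<kappa> \<alpha> \<in> K" using assms(2) by (simp_all add: subgroup_of_def)
  obtain y where y: "y \<in> K" "\<kappa> \<alpha> * y = 1" "y * \<kappa> \<alpha> = 1"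
    using assms(1) \<alpha>(2) unfolding unit_subgroup_def by blast
  have "y \<in> range cl" using y(1) assms(1) PM_range unfolding unit_subgroup_def by blast
  then obtain \<beta> where \<beta>: "\<beta> \<in> carrier C" "\<kappa> \<beta> = y" by (rule kappa_surj)
  have 1: "\<alpha> \<otimes>\<^bsub>C\<^esub> \<beta> = \<one>\<^bsub>C\<^esub>" "\<beta> \<otimes>\<^bsub>C\<^esub> \<alpha> = \<one>\<^bsub>C\<^esub>"
    using \<alpha>(1) \<beta> y by (intro kappa_eqI; simp add: kappa_hom)+
  then show U: "\<alpha> \<in> Units C" unfolding Units_def using \<alpha>(1) \<beta>(1) by blast
  have "inv\<^bsub>C\<^esub> \<alpha> = \<beta>" by (rule C.inv_unique'[OF \<alpha>(1) \<beta>(1) 1, symmetric])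
  then show "inv\<^bsub>C\<^esub> \<alpha> \<in> subgroup_of K" "\<kappa> \<alpha> * \<kappa> (inv\<^bsub>C\<^esub> \<alpha>) = 1"
    using \<beta> y by (simp_all add: subgroup_of_def)
qed

lemma subgroup_of_subgroup: assumes K: "unit_subgroup K" shows "subgroup (subgroup_of K) U"
proof
  show "subgroup_of K \<subseteq> carrier U"
    using subgroup_of_inverse(1)[OF K] by (auto simp: units_of_carrier)
  show "\<alpha> \<otimes>\<^bsub>U\<^esub> \<beta> \<in> subgroup_of K" if "\<alpha> \<in> subgroup_of K" "\<beta> \<in> subgroup_of K" for \<alpha> \<beta>
    using that K by (simp add: units_of_mult subgroup_of_def unit_subgroup_def kappa_hom)
  show "\<one>\<^bsub>U\<^esub> \<in> subgroup_of K"
    using K by (simp add: units_of_one subgroup_of_def unit_subgroup_def kappa_hom)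
  show "inv\<^bsub>U\<^esub> \<alpha> \<in> subgroup_of K" if "\<alpha> \<in> subgroup_of K" for \<alpha>
    using C.units_of_inv[OF subgroup_of_inverse(1)[OF K that]] subgroup_of_inverse(2)[OF K that] by simp
qed

lemma carrier_cl_group [simp]: "carrier (cl_group b S) = S"
  and mult_cl_group [simp]: "\<alpha> \<otimes>\<^bsub>cl_group b S\<^esub> \<beta> = \<alpha> \<otimes>\<^bsub>C\<^esub> \<beta>"
  and one_cl_group [simp]: "\<one>\<^bsub>cl_group b S\<^esub> = \<one>\<^bsub>C\<^esub>"
  by (simp_all add: cl_group_def units_of_def)

abbreviation h :: "'a clifford \<Rightarrow> 'a \<Rightarrow> 'a" where "h \<alpha> \<equiv> act (\<kappa> \<alpha>)"

text \<open>The first isomorphism theorem. The group laws of \<open>comp_group T\<close> are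
  inherited from T being the image of a homomorphism.\<close>

lemma group_part:
  assumes K: "unit_subgroup K" and T: "h ` subgroup_of K = T"
  shows "subgroup (subgroup_of K) U" "cl_pm1 b \<lhd> cl_group b (subgroup_of K)"
    "(\<lambda>A. the_elem (h ` A)) \<in> iso (cl_group b (subgroup_of K) Mod cl_pm1 b) (comp_group T)"
proof -
  let ?G = "cl_group b (subgroup_of K)"
  show sub: "subgroup (subgroup_of K) U" by (rule subgroup_of_subgroup[OF K])
  have grp: "group ?G"
    unfolding cl_group_def by (rule subgroup.subgroup_is_group[OF sub C.units_group])
  have K': "K \<subseteq> PM" "1 \<in> K" "- 1 \<in> K" using K unfolding unit_subgroup_def by simp_all
  have PM: "\<kappa> \<alpha> \<in> PM" "\<alpha> \<in> carrier C" if "\<alpha> \<in> subgroup_of K" for \<alpha>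
    using that K'(1) unfolding subgroup_of_def by blast+
  have hom: "h \<in> hom ?G (comp_group T)"
  proof (rule homI)
    show "h \<alpha> \<in> carrier (comp_group T)" if "\<alpha> \<in> carrier ?G" for \<alpha>
      using that T by (auto simp: comp_group_def)
    show "h (\<alpha> \<otimes>\<^bsub>?G\<^esub> \<beta>) = h \<alpha> \<otimes>\<^bsub>comp_group T\<^esub> h \<beta>" if "\<alpha> \<in> carrier ?G" "\<beta> \<in> carrier ?G" for \<alpha> \<beta>
      using that PM by (simp add: comp_group_def kappa_hom act_mult)
  qed
  have "group (comp_group T \<lparr>carrier := h ` carrier ?G, one := h \<one>\<^bsub>?G\<^esub>\<rparr>)"
    by (rule group.hom_imp_img_group[OF grp hom])
  moreover have "comp_group T \<lparr>carrier := h ` carrier ?G, one := h \<one>\<^bsub>?G\<^esub>\<rparr> = comp_group T"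
    using T by (simp add: comp_group_def kappa_hom act_one)
  ultimately have grpT: "group (comp_group T)" by simp
  interpret gh: group_hom ?G "comp_group T" h
    using grp grpT hom by (simp add: group_hom_def group_hom_axioms_def)
  have ker: "kernel ?G (comp_group T) h = cl_pm1 b"
  proof (intro subset_antisym subsetI)
    fix \<alpha> assume "\<alpha> \<in> kernel ?G (comp_group T) h"
    then have "\<alpha> \<in> subgroup_of K" "h \<alpha> = id" by (simp_all add: kernel_def comp_group_def)
    then show "\<alpha> \<in> cl_pm1 b" using act_eq_id[OF PM(1)] PM(2) by (auto simp: mem_pm1)
  next
    fix \<alpha> assume "\<alpha> \<in> cl_pm1 b"
    then have "\<alpha> \<in> carrier C" "\<kappa> \<alpha> = 1 \<or> \<kappa> \<alpha> = - 1" by (simp_all add: mem_pm1)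
    then show "\<alpha> \<in> kernel ?G (comp_group T) h"
      using K'(2,3) act_one act_minus_one by (auto simp: kernel_def comp_group_def subgroup_of_def)
  qed
  show "cl_pm1 b \<lhd> ?G" using gh.normal_kernel unfolding ker .
  have "h ` carrier ?G = carrier (comp_group T)" using T by (simp add: comp_group_def)
  then show "(\<lambda>A. the_elem (h ` A)) \<in> iso (?G Mod cl_pm1 b) (comp_group T)"
    using gh.FactGroup_iso_set unfolding ker by blast
qed

lemma twisted_conj_act:
  assumes "\<alpha> \<in> cl_pm_units b"
  shows "cl_incl b (h \<alpha> y) = cl_twisted_conj b \<alpha> y"
proof -
  have \<alpha>: "\<alpha> \<in> subgroup_of PM" using assms by (simp add: pm_units_eq)
  have car: "\<alpha> \<in> carrier C" "\<kappa> \<alpha> \<in> PM" using assms by (simp_all add: mem_pm_units)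
  note inv = subgroup_of_inverse[OF unit_subgroup_PM \<alpha>]
  have ic: "inv\<^bsub>C\<^esub> \<alpha> \<in> carrier C" using inv(2) by (simp add: subgroup_of_def)
  have eq: "\<kappa> \<alpha> * \<gamma> y = of_int (sgn_of (\<kappa> \<alpha>)) * (\<gamma> (h \<alpha> y) * \<kappa> \<alpha>)"
    using implements_act[of "\<kappa> \<alpha>"] car unfolding implements_def by blast
  define \<beta> where "\<beta> = \<alpha> \<otimes>\<^bsub>C\<^esub> cl_incl b y \<otimes>\<^bsub>C\<^esub> inv\<^bsub>C\<^esub> \<alpha>"
  have \<beta>: "\<beta> \<in> carrier C" using car ic by (simp add: \<beta>_def)
  have "\<kappa> \<beta> = \<kappa> \<alpha> * \<gamma> y * \<kappa> (inv\<^bsub>C\<^esub> \<alpha>)" using car ic by (simp add: \<beta>_def kappa_hom)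
  also have "\<dots> = of_int (sgn_of (\<kappa> \<alpha>)) * (\<gamma> (h \<alpha> y) * (\<kappa> \<alpha> * \<kappa> (inv\<^bsub>C\<^esub> \<alpha>)))"
    by (simp only: eq mult.assoc)
  finally have k: "\<kappa> \<beta> = of_int (sgn_of (\<kappa> \<alpha>)) * \<gamma> (h \<alpha> y)" by (simp add: inv(3))
  have even: "\<alpha> \<in> cl_even b \<longleftrightarrow> \<kappa> \<alpha> \<in> Even" using car by (simp add: mem_cl_even)
  have "cl_twisted_conj b \<alpha> y = (if \<alpha> \<in> cl_even b then \<beta> else \<ominus>\<^bsub>C\<^esub> \<beta>)"
    unfolding cl_twisted_conj_def Let_def \<beta>_def ..
  moreover have "(if \<alpha> \<in> cl_even b then \<beta> else \<ominus>\<^bsub>C\<^esub> \<beta>) = cl_incl b (h \<alpha> y)"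
  proof (rule kappa_eqI)
    show "(if \<alpha> \<in> cl_even b then \<beta> else \<ominus>\<^bsub>C\<^esub> \<beta>) \<in> carrier C" using \<beta> by simp
    show "\<kappa> (if \<alpha> \<in> cl_even b then \<beta> else \<ominus>\<^bsub>C\<^esub> \<beta>) = \<kappa> (cl_incl b (h \<alpha> y))"
      using \<beta> k by (simp add: even kappa_hom sgn_of_def)
  qed simp
  ultimately show ?thesis by simp
qed

text \<open>The signs act trivially, so \<open>the_elem\<close> is applied to a singleton.\<close>

lemma coset_act:
  assumes "\<alpha> \<in> cl_pm_units b"
  shows "the_elem (h ` (cl_pm1 b #>\<^bsub>cl_group b (cl_pm_units b)\<^esub> \<alpha>)) = h \<alpha>"
proof -
  have \<alpha>: "\<alpha> \<in> carrier C" "\<kappa> \<alpha> \<in> PM" using assms by (simp_all add: mem_pm_units)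
  have const: "h (\<beta> \<otimes>\<^bsub>C\<^esub> \<alpha>) = h \<alpha>" if "\<beta> \<in> cl_pm1 b" for \<beta>
  proof -
    have "\<beta> \<in> carrier C" "\<kappa> \<beta> = 1 \<or> \<kappa> \<beta> = - 1" using that by (simp_all add: mem_pm1)
    then show ?thesis
      using act_mult[OF one_PM \<alpha>(2)] act_mult[OF minus_one_PM \<alpha>(2)] \<alpha>(1)
      by (elim disjE) (simp_all add: kappa_hom act_one act_minus_one)
  qed
  have "h ` (cl_pm1 b #>\<^bsub>cl_group b (cl_pm_units b)\<^esub> \<alpha>) = (\<lambda>\<beta>. h (\<beta> \<otimes>\<^bsub>C\<^esub> \<alpha>)) ` cl_pm1 b"
    unfolding r_coset_def mult_cl_group by (simp only: UNION_singleton_eq_range image_image)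
  also have "\<dots> = (\<lambda>\<beta>. h \<alpha>) ` cl_pm1 b" by (rule image_cong[OF refl const])
  also have "\<dots> = {h \<alpha>}" by (simp add: cl_pm1_def)
  finally have "h ` (cl_pm1 b #>\<^bsub>cl_group b (cl_pm_units b)\<^esub> \<alpha>) = {h \<alpha>}" .
  then show ?thesis by simp
qed

lemma image_kappa: assumes "K \<subseteq> range cl" shows "h ` subgroup_of K = act ` K"
proof -
  have "\<kappa> ` subgroup_of K = K"
  proof (intro subset_antisym subsetI)
    fix x assume x: "x \<in> K"
    then have "x \<in> range cl" using assms by blast
    then obtain \<alpha> where "\<alpha> \<in> carrier C" "\<kappa> \<alpha> = x" by (rule kappa_surj)
    then show "x \<in> \<kappa> ` subgroup_of K" using x by (auto simp: subgroup_of_def)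
  next
    fix x assume "x \<in> \<kappa> ` subgroup_of K"
    then show "x \<in> K" unfolding subgroup_of_def by blast
  qed
  then show ?thesis using image_image[of act \<kappa> "subgroup_of K"] by (simp only:)
qed

section \<open>The images of the three unit groups\<close>

lemma image_PM: "act ` PM = disc_trivial b (lattice_O b)"
proof (intro subset_antisym subsetI)
  fix g assume "g \<in> act ` PM"
  then obtain x where x: "x \<in> PM" "g = act x" by blast
  show "g \<in> disc_trivial b (lattice_O b)" unfolding x(2) by (rule act_disc_trivial[OF x(1) act_in_O[OF x(1)]])
next
  fix g assume "g \<in> disc_trivial b (lattice_O b)"
  then obtain x where "x \<in> PM" "act x = g" using act_surj by blast
  then show "g \<in> act ` PM" by blast
qed

lemma disc_trivial_SO: "g \<in> disc_trivial b (lattice_SO b) \<longleftrightarrow> g \<in> disc_trivial b (lattice_O b) \<and> lattice_det g = 1"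
  by (auto simp: disc_trivial_def lattice_SO_def)

lemma image_even: "act ` (PM \<inter> Even) = disc_trivial b (lattice_SO b)"
proof (intro subset_antisym subsetI)
  fix g assume "g \<in> act ` (PM \<inter> Even)"
  then obtain x where x: "x \<in> PM" "x \<in> Even" "g = act x" by blast
  then show "g \<in> disc_trivial b (lattice_SO b)"
    unfolding disc_trivial_SO x(3) using act_det[OF x(1)] act_disc_trivial[OF x(1) act_in_O[OF x(1)]]
    by (simp add: sgn_of_def)
next
  fix g assume "g \<in> disc_trivial b (lattice_SO b)"
  then have g: "g \<in> disc_trivial b (lattice_O b)" "lattice_det g = 1" unfolding disc_trivial_SO by blast+
  obtain x where x: "x \<in> PM" "act x = g" using act_surj[OF g(1)] by blast
  then have "sgn_of x = 1" using act_det[OF x(1)] g(2) by simp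
  then have "x \<in> Even" by (simp add: sgn_of_def split: if_splits)
  then show "g \<in> act ` (PM \<inter> Even)" using x by blast
qed

lemma image_norm1: "act ` {x \<in> Even. x * star x = 1} = disc_trivial b (lattice_SO_plus b)"
proof -
  have plus: "g \<in> disc_trivial b (lattice_SO_plus b) \<longleftrightarrow> g \<in> disc_trivial b (lattice_SO b) \<and>
      (\<forall>q\<in>spinor_norm b (rat_map g). 0 < q)" for g
    by (auto simp: disc_trivial_def lattice_SO_plus_def)
  have spin: "(\<forall>q\<in>spinor_norm b (rat_map (act x)). 0 < q) \<longleftrightarrow> x * star x = 1" if x: "x \<in> PM" for x
  proof -
    obtain n where n: "x * star x = of_int n" "n = 1 \<or> n = - 1" using x by (rule PM_cases)
    have "x * star x = 1 \<longleftrightarrow> n = 1" using n(1) of_int_eq_of_int[of n 1] by simp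
    then show ?thesis using act_spinor[OF x n] by blast
  qed
  have PM: "{x \<in> Even. x * star x = 1} = {x \<in> PM \<inter> Even. x * star x = 1}" by (auto simp: PM_def)
  show ?thesis
  proof (intro subset_antisym subsetI)
    fix g assume "g \<in> act ` {x \<in> Even. x * star x = 1}"
    then obtain x where x: "x \<in> PM" "x \<in> Even" "x * star x = 1" "g = act x" unfolding PM by blast
    have "act x \<in> disc_trivial b (lattice_SO b)" unfolding image_even[symmetric] using x by blast
    then show "g \<in> disc_trivial b (lattice_SO_plus b)"
      unfolding plus x(4) spin[OF x(1)] using x(3) by (rule conjI)
  next
    fix g assume g: "g \<in> disc_trivial b (lattice_SO_plus b)"
    then have "g \<in> act ` (PM \<inter> Even)" unfolding plus image_even by (rule conjunct1)
    then obtain x where x: "x \<in> PM" "x \<in> Even" "g = act x" by blast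
    have "x * star x = 1" using g unfolding plus x(3) spin[OF x(1)] by (rule conjunct2)
    then show "g \<in> act ` {x \<in> Even. x * star x = 1}" using x by blast
  qed
qed

lemma inj_cl_incl: "inj (cl_incl b)"
proof (rule injI)
  fix x y assume "cl_incl b x = cl_incl b y"
  then have "\<kappa> (cl_incl b x) = \<kappa> (cl_incl b y)" by simp
  then show "x = y" unfolding kappa_incl gamma_inject .
qed

text \<open>A single \<phi> serves all three quotients: it sends a coset to the common value of the
  action on its elements, irrespective of the ambient group.\<close>

lemma twisted_conj_isomorphisms:
  "inj (cl_incl b)
    \<and> (\<forall>S \<in> {cl_pm_units b, cl_even_units b, cl_even_norm1 b}.
         subgroup S (units_of (clifford_algebra b)) \<and> cl_pm1 b \<lhd> cl_group b S)
    \<and> (\<exists>\<phi>. \<phi> \<in> iso (cl_group b (cl_pm_units b) Mod cl_pm1 b)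
                     (comp_group (disc_trivial b (lattice_O b)))
         \<and> (\<forall>\<alpha> \<in> cl_pm_units b. \<forall>v.
              cl_incl b (\<phi> (cl_pm1 b #>\<^bsub>cl_group b (cl_pm_units b)\<^esub> \<alpha>) v) = cl_twisted_conj b \<alpha> v)
         \<and> \<phi> \<in> iso (cl_group b (cl_even_units b) Mod cl_pm1 b)
                    (comp_group (disc_trivial b (lattice_SO b)))
         \<and> \<phi> \<in> iso (cl_group b (cl_even_norm1 b) Mod cl_pm1 b)
                    (comp_group (disc_trivial b (lattice_SO_plus b))))"
proof -
  have ran: "PM \<subseteq> range cl" "PM \<inter> Even \<subseteq> range cl" "{x \<in> Even. x * star x = 1} \<subseteq> range cl"
    using PM_range Even_in_range by blast+
  note 1 = group_part[OF unit_subgroup_PM, OF image_kappa[OF ran(1), unfolded image_PM], folded pm_units_eq]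
  note 2 = group_part[OF unit_subgroup_even, OF image_kappa[OF ran(2), unfolded image_even], folded even_units_eq]
  note 3 = group_part[OF unit_subgroup_norm1, OF image_kappa[OF ran(3), unfolded image_norm1], folded even_norm1_eq]
  have conj: "cl_incl b (the_elem (h ` (cl_pm1 b #>\<^bsub>cl_group b (cl_pm_units b)\<^esub> \<alpha>)) y) = cl_twisted_conj b \<alpha> y"
    if "\<alpha> \<in> cl_pm_units b" for \<alpha> y
    unfolding coset_act[OF that] by (rule twisted_conj_act[OF that])
  have S: "\<forall>S \<in> {cl_pm_units b, cl_even_units b, cl_even_norm1 b}. subgroup S U \<and> cl_pm1 b \<lhd> cl_group b S"
    using 1(1,2) 2(1,2) 3(1,2) by simp
  show ?thesis
    by (intro conjI inj_cl_incl S exI[of _ "\<lambda>A. the_elem (h ` A)"] 1(3) 2(3) 3(3) ballI allI conj)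
qed

end

text \<open>The parity pattern of the coordinates identifies L / 2 L with the power set of B, while
  the fibres are described without reference to B.\<close>

lemma zbasis_parity:
  fixes B :: "'a::ab_group_add set"
  assumes "zbasis B"
  defines "f \<equiv> \<lambda>x. {y \<in> B. odd (zmod.representation B x y)}"
  shows "f x = f y \<longleftrightarrow> (\<exists>z. x - y = z + z)" "range f = Pow B"
proof -
  have B: "finite B" "zmod.independent B" "zmod.span B = UNIV" using assms(1) by (auto simp: zbasis_def)
  have diff: "zmod.representation B (x - y) t = zmod.representation B x t - zmod.representation B y t" for x y t
    using zmod.representation_diff[of B y x] B by simp
  have add: "zmod.representation B (x + y) t = zmod.representation B x t + zmod.representation B y t" for x y t
    using zmod.representation_add[of B y x] B by simp
  have expand: "(\<Sum>t\<in>B. zmult (zmod.representation B x t) t) = x" for x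
    by (rule zmod.sum_representation_eq) (simp_all add: B)
  show "f x = f y \<longleftrightarrow> (\<exists>z. x - y = z + z)"
  proof
    assume "f x = f y"
    then have "even (zmod.representation B (x - y) t)" if "t \<in> B" for t
      using that unfolding f_def diff by auto
    then have e: "zmod.representation B (x - y) t = zmod.representation B (x - y) t div 2 + zmod.representation B (x - y) t div 2"
      if "t \<in> B" for t using that by fastforce
    define z where "z = (\<Sum>t\<in>B. zmult (zmod.representation B (x - y) t div 2) t)"
    have "z + z = (\<Sum>t\<in>B. zmult (zmod.representation B (x - y) t div 2 + zmod.representation B (x - y) t div 2) t)"
      by (simp only: z_def zmult_add_left sum.distrib)
    also have "\<dots> = (\<Sum>t\<in>B. zmult (zmod.representation B (x - y) t) t)"
      by (intro sum.cong refl) (simp only: e[symmetric])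
    also have "\<dots> = x - y" by (rule expand)
    finally show "\<exists>z. x - y = z + z" by metis
  next
    assume "\<exists>z. x - y = z + z"
    then obtain z where z: "x - y = z + z" by blast
    have "zmod.representation B x t - zmod.representation B y t = zmod.representation B z t + zmod.representation B z t" for t
      unfolding diff[symmetric] z add ..
    then have "odd (zmod.representation B x t) \<longleftrightarrow> odd (zmod.representation B y t)" for t
      by (smt (verit) even_add even_diff)
    then show "f x = f y" unfolding f_def by simp
  qed
  have "S \<in> range f" if "S \<subseteq> B" for S
  proof -
    have rep: "zmod.representation B (\<Sum>s\<in>S'. s) t = (if t \<in> S' then 1 else 0)" if "S' \<subseteq> B" "finite S'" for S' t
      using that(2,1)
    proof (induction S' rule: finite_induct)
      case empty
      show ?case by (simp add: zmod.representation_zero)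
    next
      case (insert s S')
      then show ?case using zmod.representation_basis[OF B(2), of s] by (simp add: add)
    qed
    have "finite S" using that B(1) by (rule finite_subset)
    then have "f (\<Sum>s\<in>S. s) = S" using rep[OF that] that unfolding f_def by auto
    then show ?thesis by (metis rangeI)
  qed
  then show "range f = Pow B" unfolding f_def by blast
qed

text \<open>Two bases induce the same partition of L into classes modulo 2 L, so their power sets
  have the same size.\<close>

lemma zbasis_card_unique:
  fixes B B' :: "'a::ab_group_add set"
  assumes "zbasis B" "zbasis B'"
  shows "card B = card B'"
proof -
  have *: "card (Pow B') \<le> card (Pow B)" if "zbasis B" "zbasis B'" for B B' :: "'a set"
  proof -
    define f where "f x = {y \<in> B. odd (zmod.representation B x y)}" for x
    define f' where "f' x = {y \<in> B'. odd (zmod.representation B' x y)}" for x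
    note f = zbasis_parity[OF that(1), folded f_def] and f' = zbasis_parity[OF that(2), folded f'_def]
    have "f' x = f' (inv_into UNIV f (f x))" for x
    proof -
      have "f x = f (inv_into UNIV f (f x))" by (simp add: f_inv_into_f)
      then show ?thesis unfolding f(1) f'(1) .
    qed
    then have "range f' = (\<lambda>S. f' (inv_into UNIV f S)) ` range f" by auto
    moreover have "finite (range f)" using f(2) that(1) by (simp add: zbasis_def)
    ultimately have "card (range f') \<le> card (range f)" by (metis card_image_le)
    then show ?thesis unfolding f(2) f'(2) .
  qed
  have "finite B" "finite B'" using assms by (simp_all add: zbasis_def)
  then have "(2 :: nat) ^ card B = 2 ^ card B'"
    using *[OF assms] *[OF assms(2,1)] by (simp add: card_Pow)
  then show ?thesis by simp
qed

theorem theorem1p1: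
  fixes b :: "'a::ab_group_add \<Rightarrow> 'a \<Rightarrow> int"
  assumes "lattice_of_rank 3 b" and "even_form b" and "nondegenerate_form b"
  shows "inj (cl_incl b)
    \<and> (\<forall>S \<in> {cl_pm_units b, cl_even_units b, cl_even_norm1 b}.
         subgroup S (units_of (clifford_algebra b)) \<and> cl_pm1 b \<lhd> cl_group b S)
    \<and> (\<exists>\<phi>. \<phi> \<in> iso (cl_group b (cl_pm_units b) Mod cl_pm1 b)
                     (comp_group (disc_trivial b (lattice_O b)))
         \<and> (\<forall>\<alpha> \<in> cl_pm_units b. \<forall>v.
              cl_incl b (\<phi> (cl_pm1 b #>\<^bsub>cl_group b (cl_pm_units b)\<^esub> \<alpha>) v) = cl_twisted_conj b \<alpha> v)
         \<and> \<phi> \<in> iso (cl_group b (cl_even_units b) Mod cl_pm1 b)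
                    (comp_group (disc_trivial b (lattice_SO b)))
         \<and> \<phi> \<in> iso (cl_group b (cl_even_norm1 b) Mod cl_pm1 b)
                    (comp_group (disc_trivial b (lattice_SO_plus b))))"
proof -
  obtain B0 :: "'a set" where B0: "zbasis B0" "card B0 = 3"
    using assms(1) unfolding lattice_of_rank_def by blast
  \<comment> \<open>\<open>lattice_det\<close> uses this chosen basis, whereas the hypothesis
    provides some basis with three elements; invariance of the rank transfers the
    cardinality.\<close>
  define B where "B = (SOME B :: 'a set. zbasis B)"
  have B: "zbasis B" unfolding B_def using B0(1) by (rule someI)
  then have "card B = 3" using zbasis_card_unique[OF B B0(1)] B0(2) by simp
  then obtain e1 e2 e3 where e: "B = {e1, e2, e3}" "e1 \<noteq> e2" "e2 \<noteq> e3" "e1 \<noteq> e3"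
    unfolding card_3_iff by blast
  have sym: "b x y = b y x" for x y using assms(1) unfolding lattice_of_rank_def by blast
  have add: "b (x + y) z = b x z + b y z" for x y z using assms(1) unfolding lattice_of_rank_def by blast
  have ev: "even (b x x)" for x using assms(2) unfolding even_form_def by blast
  interpret ternary_lattice "b e1 e1 div 2" "b e2 e2 div 2" "b e3 e3 div 2" "b e2 e3" "b e1 e3" "b e1 e2" b e1 e2 e3
  proof
    show "x = 0" if "\<And>y. b x y = 0" for x
      using assms(3) that unfolding nondegenerate_form_def by blast
    show "(SOME B. zbasis B) = {e1, e2, e3}" using e(1) by (simp only: B_def)
    show "zbasis {e1, e2, e3}" using B unfolding e(1) .
    show "b x y = b y x" "b (x + y) z = b x z + b y z" for x y z
      by (rule sym, rule add)
  qed (use e ev in simp_all)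
  show ?thesis by (rule twisted_conj_isomorphisms)
qed

end
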